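(* Let $\varepsilon_j>0$ with $\varepsilon_j\to0$. For any $(\mathbf n,g)\in\mathcal A$ there exists a sequence $(\mathbf n_j,g_j)\in\mathcal Y$, converging to $(\mathbf n,g)$ in $L^1(\mathbb T^2,\mathbb S^2)\times L^2(\mathbb T^2)$ as $j\to\infty$, such that $$\limsup_{j\to\infty}G_{\varepsilon_j}(\mathbf n_j,g_j)=G_0(\mathbf n,g).$$
   Context: Fix constants $\sigma>0$ and $l>0$. Put $A=(1+\sigma)^{-1}\in(0,1)$, $\bar n_1=\sqrt{1-A^2}$, and $\mathbf n^{\pm}=(\pm\bar n_1,0,A)\in\mathbb S^2$. Let $\mathbb T^2=\mathbb R^2/(2l\mathbb Z)^2$ be the flat torus, i.e. the square $[-l,l)^2$ with periodic boundary conditions. For $\mathbf n=(n_1,n_2,n_3)\in\mathbb S^2$ let $$W(\mathbf n)=\sigma n_2^2+\frac1A(n_3-A)^2\ \ge 0,$$ whose zero set on $\mathbb S^2$ is $\{\mathbf n^+,\mathbf n^-\}$. For $\varepsilon>0$ let $$F_\varepsilon(\mathbf n,g)=\int_{\mathbb T^2}\Big[\varepsilon|\nabla\mathbf n|^2+\frac1\varepsilon W(\mathbf n)+\frac1\varepsilon(g_x+n_1)^2+\frac1\varepsilon(g_y+n_2)^2\Big]\,dx\,dy .$$ Let $\mathcal Y=W^{1,2}(\mathbb T^2,\mathbb S^2)\times W^{1,2}(\mathbb T^2)$ and $$\mathcal A=\Big\{(\mathbf n,g)\in BV(\mathbb T^2,\{\mathbf n^{\pm}\})\times W^{1,2}(\mathbb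 T^2):\ g_x\in BV(\mathbb T^2,\{\pm\bar n_1\}),\ g=g(x),\ \mathbf n=\mathbf n(x),\ g_x+n_1=0\text{ a.e.},\ n_2=0\text{ a.e.},\ \int_{\mathbb T^2}n_1=0\Big\}$$ (here $g=g(x)$, $\mathbf n=\mathbf n(x)$ mean dependence on $x$ only). On $L^1(\mathbb T^2,\mathbb S^2)\times L^2(\mathbb T^2)$ define $G_\varepsilon(\mathbf n,g)=F_\varepsilon(\mathbf n,g)$ if $(\mathbf n,g)\in\mathcal Y$ and $+\infty$ otherwise; and $G_0(\mathbf n,g)=2c_0P_{\mathbb T^2}(A_{\mathbf n^-})$ if $(\mathbf n,g)\in\mathcal A$ and $+\infty$ otherwise, where $A_{\mathbf n^-}=\{(x,y)\in\mathbb T^2:\mathbf n(x)=\mathbf n^-\}$, $P_{\mathbb T^2}$ is the perimeter in the torus, and $$c_0=\inf\Big\{\int_0^1\sqrt{W(\gamma(t))}\,|\gamma'(t)|\,dt:\ \gamma\in C^1([0,1],\mathbb S^2),\ \gamma(0)=\mathbf n^-,\ \gamma(1)=\mathbf n^+\Big\}.$$ *)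

theory Defs
  imports "HOL-Analysis.Analysis"
begin

section \<open>The flat torus\<close>

text \<open>
  The torus $R^2/(2lZ)^2$ is represented by its fundamental domain $[-l,l)^2$ with Lebesgue
  measure. Elements of Lebesgue, Sobolev and BV spaces on the torus are a.e. classes of Borel
  functions on this domain, represented by functions on the plane whose values outside the domain
  are irrelevant. The periodic boundary conditions enter through the test functions, which are
  $2l$-periodic in both variables.
\<close>

definition torus :: "real \<Rightarrow> (real \<times> real) measure" where
  "torus l = restrict_space lborel ({-l..<l} \<times> {-l..<l})"

definition part_x :: "(real \<times> real \<Rightarrow> real) \<Rightarrow> real \<times> real \<Rightarrow> real" where
  "part_x \<phi> p = frechet_derivative \<phi> (at p) (1, 0)"

definition part_y :: "(real \<times> real \<Rightarrow> real) \<Rightarrow> real \<times> real \<Rightarrow> real" where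
  "part_y \<phi> p = frechet_derivative \<phi> (at p) (0, 1)"

definition torus_C1 :: "real \<Rightarrow> (real \<times> real \<Rightarrow> real) set" where
  "torus_C1 l = {\<phi>.
     (\<forall>x y. \<phi> (x + 2 * l, y) = \<phi> (x, y) \<and> \<phi> (x, y + 2 * l) = \<phi> (x, y)) \<and>
     (\<forall>p. \<phi> differentiable (at p)) \<and>
     continuous_on UNIV (part_x \<phi>) \<and> continuous_on UNIV (part_y \<phi>)}"

section \<open>Sobolev and BV functions on the torus\<close>

definition torus_L1 :: "real \<Rightarrow> (real \<times> real \<Rightarrow> real) set" where
  "torus_L1 l = {f. integrable (torus l) f}"

definition torus_L2 :: "real \<Rightarrow> (real \<times> real \<Rightarrow> real) set" where
  "torus_L2 l = {f. f \<in> borel_measurable (torus l) \<and> integrable (torus l) (\<lambda>p. (f p)\<^sup>2)}"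

definition is_weak_dx :: "real \<Rightarrow> (real \<times> real \<Rightarrow> real) \<Rightarrow> (real \<times> real \<Rightarrow> real) \<Rightarrow> bool" where
  "is_weak_dx l f h \<longleftrightarrow> (\<forall>\<phi>\<in>torus_C1 l.
     (LINT p|torus l. f p * part_x \<phi> p) = - (LINT p|torus l. h p * \<phi> p))"

definition is_weak_dy :: "real \<Rightarrow> (real \<times> real \<Rightarrow> real) \<Rightarrow> (real \<times> real \<Rightarrow> real) \<Rightarrow> bool" where
  "is_weak_dy l f h \<longleftrightarrow> (\<forall>\<phi>\<in>torus_C1 l.
     (LINT p|torus l. f p * part_y \<phi> p) = - (LINT p|torus l. h p * \<phi> p))"

definition torus_W12 :: "real \<Rightarrow> (real \<times> real \<Rightarrow> real) set" where
  "torus_W12 l = {f \<in> torus_L2 l.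
     (\<exists>h\<in>torus_L2 l. is_weak_dx l f h) \<and> (\<exists>h\<in>torus_L2 l. is_weak_dy l f h)}"

text \<open>For functions in \<open>torus_W12\<close> the choice below is unique up to null sets.\<close>

definition weak_dx :: "real \<Rightarrow> (real \<times> real \<Rightarrow> real) \<Rightarrow> real \<times> real \<Rightarrow> real" where
  "weak_dx l f = (SOME h. h \<in> torus_L2 l \<and> is_weak_dx l f h)"

definition weak_dy :: "real \<Rightarrow> (real \<times> real \<Rightarrow> real) \<Rightarrow> real \<times> real \<Rightarrow> real" where
  "weak_dy l f = (SOME h. h \<in> torus_L2 l \<and> is_weak_dy l f h)"

text \<open>
  Total variation, as a supremum over $C^1$ vector fields of Euclidean norm at most 1. Cutting off
  negative integrals by \<open>ennreal\<close> is harmless, since the zero field is admissible.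
\<close>

definition torus_variation :: "real \<Rightarrow> (real \<times> real \<Rightarrow> real) \<Rightarrow> ennreal" where
  "torus_variation l f =
     (SUP \<phi> \<in> {\<phi> :: real \<times> real \<Rightarrow> real \<times> real.
                 fst \<circ> \<phi> \<in> torus_C1 l \<and> snd \<circ> \<phi> \<in> torus_C1 l \<and> (\<forall>p. norm (\<phi> p) \<le> 1)}.
        ennreal (LINT p|torus l. f p * (part_x (fst \<circ> \<phi>) p + part_y (snd \<circ> \<phi>) p)))"

definition torus_BV :: "real \<Rightarrow> (real \<times> real \<Rightarrow> real) set" where
  "torus_BV l = {f \<in> torus_L1 l. torus_variation l f < \<infinity>}"

definition torus_perimeter :: "real \<Rightarrow> (real \<times> real) set \<Rightarrow> ennreal" where
  "torus_perimeter l E = torus_variation l (indicator E)"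

definition torus_L1_dist :: "real \<Rightarrow> (real \<times> real \<Rightarrow> real^3) \<Rightarrow> (real \<times> real \<Rightarrow> real^3) \<Rightarrow> real" where
  "torus_L1_dist l n m = (LINT p|torus l. norm (n p - m p))"

definition torus_L2_dist :: "real \<Rightarrow> (real \<times> real \<Rightarrow> real) \<Rightarrow> (real \<times> real \<Rightarrow> real) \<Rightarrow> real" where
  "torus_L2_dist l f g = sqrt (LINT p|torus l. (f p - g p)\<^sup>2)"

section \<open>The energies\<close>

definition constA :: "real \<Rightarrow> real" where
  "constA \<sigma> = inverse (1 + \<sigma>)"

definition nbar1 :: "real \<Rightarrow> real" where
  "nbar1 \<sigma> = sqrt (1 - (constA \<sigma>)\<^sup>2)"

definition n_plus :: "real \<Rightarrow> real^3" where
  "n_plus \<sigma> = vector [nbar1 \<sigma>, 0, constA \<sigma>]"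

definition n_minus :: "real \<Rightarrow> real^3" where
  "n_minus \<sigma> = vector [- nbar1 \<sigma>, 0, constA \<sigma>]"

definition W :: "real \<Rightarrow> real^3 \<Rightarrow> real" where
  "W \<sigma> v = \<sigma> * (v $ 2)\<^sup>2 + 1 / constA \<sigma> * (v $ 3 - constA \<sigma>)\<^sup>2"

definition grad_sq :: "real \<Rightarrow> (real \<times> real \<Rightarrow> real^3) \<Rightarrow> real \<times> real \<Rightarrow> real" where
  "grad_sq l n p =
     (\<Sum>i\<in>UNIV. (weak_dx l (\<lambda>q. n q $ i) p)\<^sup>2 + (weak_dy l (\<lambda>q. n q $ i) p)\<^sup>2)"

definition F_energy ::
  "real \<Rightarrow> real \<Rightarrow> real \<Rightarrow> (real \<times> real \<Rightarrow> real^3) \<Rightarrow> (real \<times> real \<Rightarrow> real) \<Rightarrow> ennreal" where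
  "F_energy \<sigma> l \<epsilon> n g = (\<integral>\<^sup>+ p. ennreal
     (\<epsilon> * grad_sq l n p + 1 / \<epsilon> * W \<sigma> (n p)
      + 1 / \<epsilon> * (weak_dx l g p + n p $ 1)\<^sup>2 + 1 / \<epsilon> * (weak_dy l g p + n p $ 2)\<^sup>2) \<partial>torus l)"

definition class_Y :: "real \<Rightarrow> ((real \<times> real \<Rightarrow> real^3) \<times> (real \<times> real \<Rightarrow> real)) set" where
  "class_Y l = {(n, g).
     (\<forall>i. (\<lambda>p. n p $ i) \<in> torus_W12 l) \<and> (AE p in torus l. n p \<in> sphere 0 1) \<and>
     g \<in> torus_W12 l}"

definition depends_on_x_only :: "real \<Rightarrow> (real \<times> real \<Rightarrow> 'a::topological_space) \<Rightarrow> bool" where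
  "depends_on_x_only l f \<longleftrightarrow>
     (\<exists>u \<in> borel_measurable borel. AE p in torus l. f p = u (fst p))"

definition class_A ::
  "real \<Rightarrow> real \<Rightarrow> ((real \<times> real \<Rightarrow> real^3) \<times> (real \<times> real \<Rightarrow> real)) set" where
  "class_A \<sigma> l = {(n, g).
     (\<forall>i. (\<lambda>p. n p $ i) \<in> torus_BV l) \<and> (AE p in torus l. n p \<in> {n_plus \<sigma>, n_minus \<sigma>}) \<and>
     g \<in> torus_W12 l \<and>
     weak_dx l g \<in> torus_BV l \<and> (AE p in torus l. weak_dx l g p \<in> {nbar1 \<sigma>, - nbar1 \<sigma>}) \<and>
     depends_on_x_only l g \<and> depends_on_x_only l n \<and>
     (AE p in torus l. weak_dx l g p + n p $ 1 = 0) \<and>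
     (AE p in torus l. n p $ 2 = 0) \<and>
     (LINT p|torus l. n p $ 1) = 0}"

text \<open>The derivative at the end points of $[0,1]$ is one-sided; values of \<open>\<gamma>\<close> outside do not matter.\<close>

definition c0 :: "real \<Rightarrow> real" where
  "c0 \<sigma> = Inf {(LBINT t:{0..1}. sqrt (W \<sigma> (\<gamma> t)) * norm (\<gamma>' t)) | \<gamma> \<gamma>'.
     (\<forall>t\<in>{0..1}. (\<gamma> has_vector_derivative \<gamma>' t) (at t within {0..1})) \<and>
     continuous_on {0..1} \<gamma>' \<and> \<gamma> ` {0..1} \<subseteq> sphere 0 1 \<and>
     \<gamma> 0 = n_minus \<sigma> \<and> \<gamma> 1 = n_plus \<sigma>}"

definition G_eps ::
  "real \<Rightarrow> real \<Rightarrow> real \<Rightarrow> (real \<times> real \<Rightarrow> real^3) \<Rightarrow> (real \<times> real \<Rightarrow> real) \<Rightarrow> ennreal" where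
  "G_eps \<sigma> l \<epsilon> n g = (if (n, g) \<in> class_Y l then F_energy \<sigma> l \<epsilon> n g else \<infinity>)"

definition G_zero ::
  "real \<Rightarrow> real \<Rightarrow> (real \<times> real \<Rightarrow> real^3) \<Rightarrow> (real \<times> real \<Rightarrow> real) \<Rightarrow> ennreal" where
  "G_zero \<sigma> l n g =
     (if (n, g) \<in> class_A \<sigma> l
      then ennreal (2 * c0 \<sigma>) * torus_perimeter l {p \<in> space (torus l). n p = n_minus \<sigma>}
      else \<infinity>)"

end

theory Submission
  imports Defs
begin

text \<open>
  The map \<open>n\<close> depends on \<open>x\<close> only and jumps at finitely many points of the circle, and the
  perimeter of the phase \<open>n = n\<^sup>-\<close> is \<open>2 l\<close> times the number of jumps. Along the great circle
  \<open>n\<^sub>2 = 0\<close> the one-dimensional profile \<open>(sin \<vartheta>, 0, cos \<vartheta>)\<close> with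
  \<open>\<vartheta>' = (cos \<vartheta> - A) / sqrt A\<close> has equipartitioned energy. The recovery sequence is this
  profile, evaluated at the truncated signed distance to the jumps divided by \<open>\<epsilon>\<close>. As the mean of
  its first component is \<open>O(\<epsilon>)\<close>, a potential \<open>g\<close> with \<open>g\<^sub>x + n\<^sub>1 = O(\<epsilon>)\<close> exists.
  A calibration depending on \<open>n\<^sub>1\<close> alone shows that the great circle arc is optimal for \<open>c0\<close>, so
  that the energies converge to exactly \<open>2 c0\<close> times the perimeter.
\<close>

section \<open>The torus as a product of two circles\<close>

text \<open>Null sets shape the work. The hypotheses on \<open>n\<close> and \<open>g\<close> hold
  only almost everywhere, so the jumps are read off as the essential boundary of a periodic set
  \<open>E\<close>. Moreover \<open>weak_dx\<close> and \<open>weak_dy\<close> are arbitrary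
  choices, so no energy can be computed before weak derivatives are known to be unique almost
  everywhere. Finiteness of the jumps comes from duality: near each of finitely many boundary points
  a test function of sup norm at most 1 gains almost 1, so the total variation bounds their number.
  The distance is truncated at a level \<open>r\<close> independent of \<epsilon>, so that different
  jumps do not interact. The price is a tail of the profile; the crude decay
  \<open>speed T \<le> pi / T\<close> makes it of order \<epsilon>, which survives squaring and
  division by \<epsilon>. The same holds for the mean, which is spread evenly over the circle.
  Gradient and potential each cost \<open>transition_cost\<close> per jump and unit length, whence
  the factor 2 in the limit.\<close>

definition circ :: "real \<Rightarrow> real measure" where
  "circ l = restrict_space lborel {-l..<l}"

lemma space_circ [simp]: "space (circ l) = {-l..<l}"
  by (simp add: circ_def space_restrict_space)

lemma space_torus [simp]: "space (torus l) = {-l..<l} \<times> {-l..<l}"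
  by (simp add: torus_def space_restrict_space)

lemma square_sets [measurable]: "{-l..<l} \<times> {-l..<l::real} \<in> sets borel"
  by (simp add: borel_prod[symmetric])

lemma emeasure_circ_space: "0 \<le> l \<Longrightarrow> emeasure (circ l) {-l..<l} = ennreal (2 * l)"
  unfolding circ_def by (subst emeasure_restrict_space) auto

lemma finite_measure_circ: "finite_measure (circ l)"
proof (cases "0 \<le> l")
  case True
  then show ?thesis by (intro finite_measureI) (simp add: emeasure_circ_space)
next
  case False
  then have "{-l..<l} = {}" by auto
  then show ?thesis by (intro finite_measureI) simp
qed

lemma measure_circ_space: "0 \<le> l \<Longrightarrow> measure (circ l) {-l..<l} = 2 * l"
  by (simp add: measure_def emeasure_circ_space)

lemma borel_measurable_circ: "f \<in> borel_measurable borel \<Longrightarrow> f \<in> borel_measurable (circ l)"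
  unfolding circ_def by (rule measurable_restrict_space1) simp

lemma borel_measurable_torus: "f \<in> borel_measurable borel \<Longrightarrow> f \<in> borel_measurable (torus l)"
  unfolding torus_def by (rule measurable_restrict_space1) simp

text \<open>Fubini on the torus rests on this. Both sigma-algebras are traces of the Borel sets, and
  the two measures agree on rectangles, which suffices by sigma-finiteness.\<close>

lemma torus_eq_pair: "torus l = circ l \<Otimes>\<^sub>M circ l"
proof -
  interpret c: finite_measure "circ l" by (rule finite_measure_circ)
  have sc: "sets (circ l) = {A. A \<subseteq> {-l..<l} \<and> A \<in> sets borel}"
    unfolding circ_def by (subst sets_restrict_space) (auto simp: image_def)
  have st: "sets (torus l) = {A. A \<subseteq> {-l..<l} \<times> {-l..<l} \<and> A \<in> sets borel}"
    unfolding torus_def by (subst sets_restrict_space) (auto simp: image_def)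
  have m: "(\<lambda>x. x) \<in> measurable (circ l) borel"
    unfolding circ_def by (rule measurable_restrict_space1) simp
  have "sets (circ l \<Otimes>\<^sub>M circ l) = sets (torus l)"
  proof
    show "sets (circ l \<Otimes>\<^sub>M circ l) \<subseteq> sets (torus l)"
      by (rule sets_pair_in_sets) (auto simp: sc st borel_prod[symmetric])
    show "sets (torus l) \<subseteq> sets (circ l \<Otimes>\<^sub>M circ l)"
    proof
      fix A assume A: "A \<in> sets (torus l)"
      have "(\<lambda>p. p) \<in> measurable (circ l \<Otimes>\<^sub>M circ l) (borel \<Otimes>\<^sub>M borel)"
        using measurable_compose[OF measurable_fst m] measurable_compose[OF measurable_snd m]
        by (auto simp: measurable_pair_iff comp_def)
      then have "(\<lambda>p. p) -` A \<inter> space (circ l \<Otimes>\<^sub>M circ l) \<in> sets (circ l \<Otimes>\<^sub>M circ l)"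
        using A by (intro measurable_sets) (auto simp: st borel_prod)
      then show "A \<in> sets (circ l \<Otimes>\<^sub>M circ l)"
        using A by (simp add: st space_pair_measure Int_absorb2)
    qed
  qed
  then have "circ l \<Otimes>\<^sub>M circ l = torus l"
  proof (rule pair_measure_eqI[OF c.sigma_finite_measure_axioms c.sigma_finite_measure_axioms])
    fix A B assume AB: "A \<in> sets (circ l)" "B \<in> sets (circ l)"
    then have "emeasure (torus l) (A \<times> B) = emeasure (lborel \<Otimes>\<^sub>M lborel) (A \<times> B)"
      unfolding torus_def by (subst emeasure_restrict_space) (auto simp: sc lborel_prod)
    also have "\<dots> = emeasure lborel A * emeasure lborel B"
      using AB by (subst lborel.emeasure_pair_measure_Times) (auto simp: sc)
    also have "\<dots> = emeasure (circ l) A * emeasure (circ l) B"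
      using AB[unfolded sc] unfolding circ_def by (simp add: emeasure_restrict_space)
    finally show "emeasure (circ l) A * emeasure (circ l) B = emeasure (torus l) (A \<times> B)" by simp
  qed
  then show ?thesis by simp
qed

lemma pair_sigma_finite_circ: "pair_sigma_finite (circ l) (circ l)"
  using finite_measure_circ[of l]
  by (simp add: pair_sigma_finite_def finite_measure_def)

lemma finite_measure_torus: "finite_measure (torus l)"
  unfolding torus_eq_pair by (intro finite_measure_pair_measure finite_measure_circ)

lemma integrable_circ_bounded:
  assumes "f \<in> borel_measurable (circ l)" "\<And>x. x \<in> {-l..<l} \<Longrightarrow> \<bar>f x\<bar> \<le> (M::real)"
  shows "integrable (circ l) f"
  using assms by (intro finite_measure.integrable_const_bound[OF finite_measure_circ, of _ M]) auto

lemma integrable_torus_bounded: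
  assumes "f \<in> borel_measurable (torus l)" "AE p in torus l. \<bar>f p\<bar> \<le> (M::real)"
  shows "integrable (torus l) f"
  using assms by (intro finite_measure.integrable_const_bound[OF finite_measure_torus, of _ M]) auto

section \<open>Slicing integrals and almost-everywhere statements\<close>

lemma integral_torus_yx:
  fixes f :: "real \<times> real \<Rightarrow> real"
  assumes "integrable (torus l) f"
  shows "(LINT p|torus l. f p) = (LINT y|circ l. LINT x|circ l. f (x, y))"
proof -
  interpret pair_sigma_finite "circ l" "circ l" by (rule pair_sigma_finite_circ)
  show ?thesis using integral_snd[of "\<lambda>x y. f (x, y)"] assms by (simp add: torus_eq_pair)
qed

lemma integral_torus_xy:
  fixes f :: "real \<times> real \<Rightarrow> real"
  assumes "integrable (torus l) f"
  shows "(LINT p|torus l. f p) = (LINT x|circ l. LINT y|circ l. f (x, y))"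
proof -
  interpret pair_sigma_finite "circ l" "circ l" by (rule pair_sigma_finite_circ)
  show ?thesis using integral_fst[of "\<lambda>x y. f (x, y)"] assms by (simp add: torus_eq_pair)
qed

lemma borel_measurable_torus_fst:
  assumes "f \<in> borel_measurable borel"
  shows "(\<lambda>p. f (fst p)) \<in> borel_measurable (torus l)"
  by (rule borel_measurable_torus[OF measurable_compose[OF _ assms]]) (simp add: borel_prod[symmetric])

text \<open>The circle has positive measure, so a statement that does not mention the point can be
  taken out of the quantifier. This is how facts about almost every slice become facts about
  \<open>x\<close> alone.\<close>

lemma AE_circ_const:
  assumes "0 < l"
  shows "(AE x in circ l. Q) \<longleftrightarrow> Q"
proof -
  have "\<not> (AE x in circ l. False)"
  proof
    assume "AE x in circ l. False"
    then have "emeasure (circ l) (space (circ l)) = 0"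
      by (subst (asm) AE_iff_measurable[OF sets.top]) auto
    with assms show False by (simp add: emeasure_circ_space)
  qed
  then show ?thesis by (cases Q) auto
qed

lemma AE_torus_fst:
  assumes "AE x in circ l. P x"
  shows "AE p in torus l. P (fst p)"
proof -
  from assms obtain N where N: "{x \<in> space (circ l). \<not> P x} \<subseteq> N" "N \<in> null_sets (circ l)"
    by (auto simp: eventually_ae_filter)
  interpret c: finite_measure "circ l" by (rule finite_measure_circ)
  have "N \<times> space (circ l) \<in> null_sets (torus l)"
    unfolding torus_eq_pair using N(2) by (intro c.times_in_null_sets1 sets.top)
  then show ?thesis
    by (rule AE_I') (use N(1) in \<open>auto simp: torus_eq_pair space_pair_measure\<close>)
qed

lemma AE_circ_of_torus:
  assumes "0 < l" "AE p in torus l. P (fst p)"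
  shows "AE x in circ l. P x"
proof -
  interpret pair_sigma_finite "circ l" "circ l" by (rule pair_sigma_finite_circ)
  have "AE x in circ l. AE y in circ l. P x"
    using AE_pair[OF assms(2)[unfolded torus_eq_pair]] by simp
  then show ?thesis using AE_circ_const[OF assms(1)] by simp
qed

lemma integral_torus_fst:
  fixes f :: "real \<Rightarrow> real"
  assumes "0 < l" "integrable (circ l) f"
  shows "integrable (torus l) (\<lambda>p. f (fst p))"
    and "(LINT p|torus l. f (fst p)) = 2 * l * (LINT x|circ l. f x)"
proof -
  interpret pair_sigma_finite "circ l" "circ l" by (rule pair_sigma_finite_circ)
  interpret c: finite_measure "circ l" by (rule finite_measure_circ)
  have f: "f \<in> borel_measurable (circ l)" using assms(2) by simp
  show 1: "integrable (torus l) (\<lambda>p. f (fst p))"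
    unfolding torus_eq_pair
    by (rule Fubini_integrable) (use assms(2) f in \<open>auto simp: measure_circ_space\<close>)
  show "(LINT p|torus l. f (fst p)) = 2 * l * (LINT x|circ l. f x)"
    by (subst integral_torus_yx[OF 1]) (use assms in \<open>simp add: measure_circ_space\<close>)
qed

lemma integral_circ_eq:
  fixes f :: "real \<Rightarrow> real"
  shows "(LINT x|circ l. f x) = (LINT x:{-l..<l}|lborel. f x)"
  unfolding circ_def set_lebesgue_integral_def by (subst integral_restrict_space) auto

text \<open>Gateway to the fundamental theorem of calculus, which is stated for the gauge integral
  on the closed interval; the added end point is negligible.\<close>

lemma integral_circ_HK:
  fixes f :: "real \<Rightarrow> real"
  assumes "integrable (circ l) f"
  shows "(f has_integral (LINT x|circ l. f x)) {-l..l}"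
proof -
  have "set_integrable lborel {-l..<l} f"
    using assms unfolding circ_def set_integrable_def by (subst (asm) integrable_restrict_space) auto
  then have "(f has_integral (LINT x|circ l. f x)) {-l..<l}"
    using set_borel_integral_eq_integral[of "{-l..<l}" f] by (simp add: integral_circ_eq has_integral_iff)
  moreover have "negligible {x \<in> {-l..l} - {-l..<l}. f x \<noteq> 0}" "negligible {x \<in> {-l..<l} - {-l..l}. f x \<noteq> 0}"
    by (rule negligible_subset[of "{l}"], auto)+
  ultimately show ?thesis
    using has_integral_spike_set_eq by blast
qed

section \<open>Test functions and weak derivatives of one-dimensional functions\<close>

lemma torus_C1D:
  assumes "\<phi> \<in> torus_C1 l"
  shows torus_C1_shift_x: "\<phi> (x + 2 * l, y) = \<phi> (x, y)"
    and torus_C1_shift_y: "\<phi> (x, y + 2 * l) = \<phi> (x, y)"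
    and torus_C1_has_derivative: "(\<phi> has_derivative frechet_derivative \<phi> (at p)) (at p)"
    and continuous_part_x: "continuous_on UNIV (part_x \<phi>)"
    and continuous_part_y: "continuous_on UNIV (part_y \<phi>)"
    and torus_C1_continuous: "continuous_on UNIV \<phi>"
proof -
  show "continuous_on UNIV \<phi>"
    using assms by (auto simp: torus_C1_def differentiable_on_def
      intro!: differentiable_imp_continuous_on differentiable_at_imp_differentiable_on)
  show "(\<phi> has_derivative frechet_derivative \<phi> (at p)) (at p)"
    using assms unfolding torus_C1_def frechet_derivative_works[symmetric] by blast
qed (use assms in \<open>simp_all add: torus_C1_def\<close>)

lemma torus_C1_partial_x:
  assumes "\<phi> \<in> torus_C1 l"
  shows "((\<lambda>x. \<phi> (x, y)) has_real_derivative part_x \<phi> (x, y)) (at x)"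
proof -
  let ?D = "frechet_derivative \<phi> (at (x, y))"
  interpret D: bounded_linear ?D
    using torus_C1_has_derivative[OF assms] by (rule has_derivative_bounded_linear)
  have "((\<lambda>x. (x, y)) has_derivative (\<lambda>h. (h, 0))) (at x)"
    by (auto intro!: derivative_eq_intros)
  from diff_chain_at[OF this torus_C1_has_derivative[OF assms]]
  have "((\<lambda>x. \<phi> (x, y)) has_derivative (\<lambda>h. ?D (h, 0))) (at x)"
    by (simp add: o_def)
  moreover have "(\<lambda>h. ?D (h, 0)) = (*) (part_x \<phi> (x, y))"
  proof
    fix h
    have "?D (h *\<^sub>R (1, 0)) = h *\<^sub>R ?D (1, 0)" by (rule D.scaleR)
    then show "?D (h, 0) = part_x \<phi> (x, y) * h" by (simp add: part_x_def)
  qed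
  ultimately show ?thesis
    by (simp only: has_field_derivative_def)
qed

lemma torus_C1_partial_y:
  assumes "\<phi> \<in> torus_C1 l"
  shows "((\<lambda>y. \<phi> (x, y)) has_real_derivative part_y \<phi> (x, y)) (at y)"
proof -
  let ?D = "frechet_derivative \<phi> (at (x, y))"
  interpret D: bounded_linear ?D
    using torus_C1_has_derivative[OF assms] by (rule has_derivative_bounded_linear)
  have "((\<lambda>y. (x, y)) has_derivative (\<lambda>h. (0, h))) (at y)"
    by (auto intro!: derivative_eq_intros)
  from diff_chain_at[OF this torus_C1_has_derivative[OF assms]]
  have "((\<lambda>y. \<phi> (x, y)) has_derivative (\<lambda>h. ?D (0, h))) (at y)"
    by (simp add: o_def)
  moreover have "(\<lambda>h. ?D (0, h)) = (*) (part_y \<phi> (x, y))"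
  proof
    fix h
    have "?D (h *\<^sub>R (0, 1)) = h *\<^sub>R ?D (0, 1)" by (rule D.scaleR)
    then show "?D (0, h) = part_y \<phi> (x, y) * h" by (simp add: part_y_def)
  qed
  ultimately show ?thesis
    by (simp only: has_field_derivative_def)
qed

lemma continuous_bounded_torus:
  fixes \<phi> :: "real \<times> real \<Rightarrow> real"
  assumes "continuous_on UNIV \<phi>"
  obtains M where "M \<ge> 0" "\<And>p. p \<in> {-l..l} \<times> {-l..l} \<Longrightarrow> \<bar>\<phi> p\<bar> \<le> M"
proof -
  have "compact ({-l..l} \<times> {-l..l})" by (intro compact_Times) auto
  then have "bounded (\<phi> ` ({-l..l} \<times> {-l..l}))"
    by (intro compact_imp_bounded compact_continuous_image continuous_on_subset[OF assms]) auto
  then obtain M where "M > 0" "\<forall>p \<in> {-l..l} \<times> {-l..l}. \<bar>\<phi> p\<bar> \<le> M"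
    unfolding bounded_pos by auto
  then show ?thesis using that[of M] by auto
qed

lemma integrable_torus_times_continuous:
  fixes \<phi> h :: "real \<times> real \<Rightarrow> real"
  assumes "continuous_on UNIV \<phi>" "integrable (torus l) h"
  shows "integrable (torus l) (\<lambda>p. h p * \<phi> p)"
proof -
  obtain M where M: "M \<ge> 0" "\<And>p. p \<in> {-l..l} \<times> {-l..l} \<Longrightarrow> \<bar>\<phi> p\<bar> \<le> M"
    using continuous_bounded_torus[OF assms(1)] by blast
  have m: "\<phi> \<in> borel_measurable (torus l)"
    by (intro borel_measurable_torus borel_measurable_continuous_onI assms)
  have ae: "AE p in torus l. norm (h p * \<phi> p) \<le> norm (M * h p)"
  proof (rule AE_I2)
    fix p assume "p \<in> space (torus l)"
    then have "p \<in> {-l..l} \<times> {-l..l}" by auto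
    from mult_left_mono[OF M(2)[OF this], of "\<bar>h p\<bar>"] M(1)
    show "norm (h p * \<phi> p) \<le> norm (M * h p)" by (simp add: abs_mult mult.commute)
  qed
  show ?thesis
    by (rule Bochner_Integration.integrable_bound[OF integrable_mult_right[OF assms(2), of M]
          borel_measurable_times[OF borel_measurable_integrable[OF assms(2)] m] ae])
qed

lemma continuous_bounded_interval:
  fixes f :: "real \<Rightarrow> real"
  assumes "continuous_on {a..b} f"
  obtains M where "\<And>x. x \<in> {a..b} \<Longrightarrow> \<bar>f x\<bar> \<le> M"
proof -
  have "bounded (f ` {a..b})"
    by (intro compact_imp_bounded compact_continuous_image assms) auto
  then obtain M where "\<forall>x\<in>{a..b}. \<bar>f x\<bar> \<le> M" by (auto simp: bounded_iff)
  then show ?thesis by (intro that[of M]) blast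
qed

lemma integrable_circ_continuous:
  assumes "continuous_on {-l..l} f"
  shows "integrable (circ l) (f :: real \<Rightarrow> real)"
proof -
  obtain M where M: "\<And>x. x \<in> {-l..l} \<Longrightarrow> \<bar>f x\<bar> \<le> M"
    by (rule continuous_bounded_interval[OF assms]) blast
  have "f \<in> borel_measurable (restrict_space borel {-l..<l})"
    by (rule borel_measurable_continuous_on_restrict)
       (use assms in \<open>auto intro: continuous_on_subset\<close>)
  then have "f \<in> borel_measurable (circ l)"
    by (simp add: circ_def cong: measurable_cong_sets sets_restrict_space_cong)
  then show ?thesis using M by (intro integrable_circ_bounded[of _ _ M]) auto
qed

text \<open>The finite exceptional set \<open>K\<close> admits functions with corners, such as
  compositions with the signed distance; continuity across \<open>K\<close> keeps the formula free
  of jump terms.\<close>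

lemma FTC_circ:
  assumes "0 < l" "finite K" "integrable (circ l) f'" "continuous_on {-l..l} f"
    and "\<And>x. x \<in> {-l<..<l} - K \<Longrightarrow> (f has_real_derivative f' x) (at x)"
  shows "(LINT x|circ l. f' x) = f l - f (-l)"
proof -
  have "(f' has_integral (f l - f (-l))) {-l..l}"
    by (rule fundamental_theorem_of_calculus_interior_strong[OF assms(2)])
       (use assms in \<open>auto simp: has_real_derivative_iff_has_vector_derivative\<close>)
  with integral_circ_HK[OF assms(3)] show ?thesis by (rule has_integral_unique)
qed

text \<open>Integration by parts on every horizontal line: \<open>w * \<phi>\<close> is continuous
  with the expected derivative off \<open>K\<close>, and the boundary terms cancel because both
  factors take equal values at \<open>-l\<close> and \<open>l\<close>.\<close>

lemma is_weak_dx_fst: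
  assumes l: "0 < l" and K: "finite K"
    and w': "w' \<in> borel_measurable borel" "\<And>x. x \<in> {-l..<l} \<Longrightarrow> \<bar>w' x\<bar> \<le> M"
    and cont: "continuous_on {-l..l} w" and per: "w (-l) = w l"
    and deriv: "\<And>x. x \<in> {-l<..<l} - K \<Longrightarrow> (w has_real_derivative w' x) (at x)"
  shows "is_weak_dx l (\<lambda>p. w (fst p)) (\<lambda>p. w' (fst p))"
  unfolding is_weak_dx_def
proof
  fix \<phi> assume \<phi>: "\<phi> \<in> torus_C1 l"
  have iw: "integrable (circ l) w" by (rule integrable_circ_continuous[OF cont])
  have iw': "integrable (circ l) w'"
    by (rule integrable_circ_bounded[OF borel_measurable_circ[OF w'(1)] w'(2)])
  have 1: "integrable (torus l) (\<lambda>p. w (fst p) * part_x \<phi> p)"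
    using iw l by (intro integrable_torus_times_continuous continuous_part_x[OF \<phi>] integral_torus_fst)
  have 2: "integrable (torus l) (\<lambda>p. w' (fst p) * \<phi> p)"
    using iw' l by (intro integrable_torus_times_continuous torus_C1_continuous[OF \<phi>] integral_torus_fst)
  have contx: "continuous_on S (\<lambda>x. \<phi> (x, y))" "continuous_on S (\<lambda>x. part_x \<phi> (x, y))" for y S
    by (rule continuous_on_compose2[OF torus_C1_continuous[OF \<phi>]]
          continuous_on_compose2[OF continuous_part_x[OF \<phi>]]; auto intro!: continuous_intros)+
  have "(LINT x|circ l. w x * part_x \<phi> (x, y) + w' x * \<phi> (x, y)) = 0" for y
  proof -
    have "integrable (circ l) (\<lambda>x. w x * part_x \<phi> (x, y))"
      by (intro integrable_circ_continuous continuous_intros cont contx)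
    moreover have "integrable (circ l) (\<lambda>x. w' x * \<phi> (x, y))"
    proof -
      obtain C where "C \<ge> 0" "\<And>p. p \<in> {-l..l} \<times> {-l..l} \<Longrightarrow> \<bar>\<phi> p\<bar> \<le> C"
        using continuous_bounded_torus[OF torus_C1_continuous[OF \<phi>]] by blast
      have "integrable (circ l) (\<lambda>x. \<phi> (x, y))" by (intro integrable_circ_continuous contx)
      then have "integrable (circ l) (\<lambda>x. M * \<phi> (x, y))" by simp
      then show ?thesis
      proof (rule Bochner_Integration.integrable_bound)
        show "(\<lambda>x. w' x * \<phi> (x, y)) \<in> borel_measurable (circ l)"
          by (rule borel_measurable_circ[OF borel_measurable_times[OF w'(1)
                borel_measurable_continuous_onI[OF contx(1)]]])
        show "AE x in circ l. norm (w' x * \<phi> (x, y)) \<le> norm (M * \<phi> (x, y))"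
          using w'(2) by (intro AE_I2) (fastforce simp: abs_mult intro!: mult_right_mono)
      qed
    qed
    ultimately have "(LINT x|circ l. w x * part_x \<phi> (x, y) + w' x * \<phi> (x, y))
      = w l * \<phi> (l, y) - w (-l) * \<phi> (-l, y)"
      using K l deriv
      by (intro FTC_circ[where K=K and f="\<lambda>x. w x * \<phi> (x, y)"])
         (auto intro!: continuous_intros cont contx derivative_eq_intros torus_C1_partial_x[OF \<phi>])
    then show ?thesis using per torus_C1_shift_x[OF \<phi>, of "-l" y] by simp
  qed
  then have "(LINT p|torus l. w (fst p) * part_x \<phi> p + w' (fst p) * \<phi> p) = 0"
    using 1 2 by (subst integral_torus_yx) auto
  then show "(LINT p|torus l. w (fst p) * part_x \<phi> p) = - (LINT p|torus l. w' (fst p) * \<phi> p)"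
    using 1 2 by simp
qed

text \<open>\<open>w\<close> comes out of the inner integral over \<open>y\<close>, and the integral
  of \<open>part_y \<phi>\<close> over a period is zero. Asking only for integrability of
  \<open>w\<close> admits the discontinuous \<open>sgn (sdist x)\<close>.\<close>

lemma is_weak_dy_fst:
  assumes l: "0 < l" and w: "integrable (circ l) w"
  shows "is_weak_dy l (\<lambda>p. w (fst p)) (\<lambda>p. 0)"
  unfolding is_weak_dy_def
proof
  fix \<phi> assume \<phi>: "\<phi> \<in> torus_C1 l"
  have 1: "integrable (torus l) (\<lambda>p. w (fst p) * part_y \<phi> p)"
    using w l by (intro integrable_torus_times_continuous continuous_part_y[OF \<phi>] integral_torus_fst)
  have conty: "continuous_on S (\<lambda>y. \<phi> (x, y))" "continuous_on S (\<lambda>y. part_y \<phi> (x, y))" for x S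
    by (rule continuous_on_compose2[OF torus_C1_continuous[OF \<phi>]]
          continuous_on_compose2[OF continuous_part_y[OF \<phi>]]; auto intro!: continuous_intros)+
  have "(LINT y|circ l. part_y \<phi> (x, y)) = \<phi> (x, l) - \<phi> (x, -l)" for x
    using l by (intro FTC_circ[where K="{}"] integrable_circ_continuous conty torus_C1_partial_y[OF \<phi>]) auto
  then have "(LINT y|circ l. part_y \<phi> (x, y)) = 0" for x
    using torus_C1_shift_y[OF \<phi>, of x "-l"] by simp
  then show "(LINT p|torus l. w (fst p) * part_y \<phi> p) = - (LINT p|torus l. 0 * \<phi> p)"
    by (subst integral_torus_xy[OF 1]) auto
qed

section \<open>Periodic functions of one variable and product test functions\<close>

definition per_C1 :: "real \<Rightarrow> (real \<Rightarrow> real) \<Rightarrow> (real \<Rightarrow> real) \<Rightarrow> bool" where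
  "per_C1 l \<theta> \<theta>' \<longleftrightarrow> (\<forall>x. \<theta> (x + 2 * l) = \<theta> x) \<and> continuous_on UNIV \<theta>' \<and>
     (\<forall>x. (\<theta> has_real_derivative \<theta>' x) (at x))"

lemma per_C1_continuous: "per_C1 l \<theta> \<theta>' \<Longrightarrow> continuous_on S \<theta>"
  unfolding per_C1_def by (meson DERIV_isCont continuous_at_imp_continuous_on)

lemma per_C1_const: "per_C1 l (\<lambda>_. c) (\<lambda>_. 0)"
  by (simp add: per_C1_def)

lemma torus_C1_product:
  assumes "per_C1 l \<theta> \<theta>'" "per_C1 l \<eta> \<eta>'"
  shows "(\<lambda>p. \<theta> (fst p) * \<eta> (snd p)) \<in> torus_C1 l"
    and "part_x (\<lambda>p. \<theta> (fst p) * \<eta> (snd p)) = (\<lambda>p. \<theta>' (fst p) * \<eta> (snd p))"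
    and "part_y (\<lambda>p. \<theta> (fst p) * \<eta> (snd p)) = (\<lambda>p. \<theta> (fst p) * \<eta>' (snd p))"
proof -
  have d1: "(\<theta> has_derivative (\<lambda>h. \<theta>' x * h)) (at x)" "(\<eta> has_derivative (\<lambda>h. \<eta>' x * h)) (at x)" for x
    using assms by (auto simp: per_C1_def has_field_derivative_def)
  have d: "((\<lambda>p. \<theta> (fst p) * \<eta> (snd p)) has_derivative
      (\<lambda>h. \<theta> (fst p) * (\<eta>' (snd p) * snd h) + \<theta>' (fst p) * fst h * \<eta> (snd p))) (at p)" for p
    by (auto intro!: derivative_eq_intros has_derivative_compose[OF _ d1(1)] has_derivative_compose[OF _ d1(2)])
  have fd: "frechet_derivative (\<lambda>p. \<theta> (fst p) * \<eta> (snd p)) (at p) =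
      (\<lambda>h. \<theta> (fst p) * (\<eta>' (snd p) * snd h) + \<theta>' (fst p) * fst h * \<eta> (snd p))" for p
    using frechet_derivative_at[OF d] by simp
  show px: "part_x (\<lambda>p. \<theta> (fst p) * \<eta> (snd p)) = (\<lambda>p. \<theta>' (fst p) * \<eta> (snd p))"
    and py: "part_y (\<lambda>p. \<theta> (fst p) * \<eta> (snd p)) = (\<lambda>p. \<theta> (fst p) * \<eta>' (snd p))"
    by (auto simp: part_x_def part_y_def fd)
  have c: "continuous_on UNIV \<theta>'" "continuous_on UNIV \<eta>'" "continuous_on UNIV \<theta>" "continuous_on UNIV \<eta>"
    using assms per_C1_continuous by (auto simp: per_C1_def)
  show "(\<lambda>p. \<theta> (fst p) * \<eta> (snd p)) \<in> torus_C1 l"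
    unfolding torus_C1_def mem_Collect_eq px py
  proof (intro conjI allI)
    show "(\<lambda>p. \<theta> (fst p) * \<eta> (snd p)) differentiable at p" for p
      using d differentiable_def by blast
  qed (use assms in \<open>auto simp: per_C1_def
        intro!: continuous_intros continuous_on_compose2[OF c(1)] continuous_on_compose2[OF c(2)]
          continuous_on_compose2[OF c(3)] continuous_on_compose2[OF c(4)]\<close>)
qed

lemma continuous_antiderivative:
  fixes \<psi> :: "real \<Rightarrow> real"
  assumes "continuous_on UNIV \<psi>"
  obtains F where "\<And>x. (F has_real_derivative \<psi> x) (at x)"
proof -
  define F where "F u = (LBINT y=ereal 0..ereal u. \<psi> y)" for u :: real
  have F: "(F has_real_derivative \<psi> x) (at x)" for x
  proof -
    define a b where "a = min x 0 - 1" and "b = max x 0 + 1"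
    have ab: "a < 0" "0 < b" "a < x" "x < b" by (auto simp: a_def b_def)
    have "(F has_vector_derivative \<psi> x) (at x within {a..b})"
      unfolding F_def using ab
      by (intro interval_integral_FTC2 continuous_on_subset[OF assms]) auto
    then have "(F has_vector_derivative \<psi> x) (at x within {a<..<b})"
      by (rule has_vector_derivative_within_subset) auto
    moreover have "at x within {a<..<b} = at x"
      by (rule at_within_open) (use ab in auto)
    ultimately show ?thesis
      by (simp only: has_real_derivative_iff_has_vector_derivative)
  qed
  then show ?thesis by (rule that)
qed

text \<open>The increment of an antiderivative over one period does not depend on the starting
  point, since its derivative is \<open>\<psi> (x + 2 * l) - \<psi> x\<close>; started at
  \<open>c\<close> it is the vanishing integral.\<close>

lemma per_C1_primitive:
  assumes "0 < l" "continuous_on UNIV \<psi>" "\<And>x. \<psi> (x + 2 * l) = \<psi> x"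
    and "(\<psi> has_integral 0) {c..c + 2 * l}"
  obtains \<Psi> where "per_C1 l \<Psi> \<psi>" "\<Psi> c = 0"
proof -
  obtain F where F: "\<And>x. (F has_real_derivative \<psi> x) (at x)"
    by (rule continuous_antiderivative[OF assms(2)]) blast
  have "((\<lambda>x. F (x + 2 * l) - F x) has_real_derivative 0) (at x)" for x
  proof -
    have "((\<lambda>x. F (x + 2 * l)) has_real_derivative \<psi> (x + 2 * l)) (at x)"
      using F[of "x + 2 * l"] by (simp only: DERIV_shift)
    from DERIV_diff[OF this F[of x]] show ?thesis by (simp add: assms(3))
  qed
  then have const: "F (x + 2 * l) - F x = F (c + 2 * l) - F c" for x
    by (intro DERIV_isconst_all[of "\<lambda>x. F (x + 2 * l) - F x" x c]) blast
  have "(\<psi> has_integral (F (c + 2 * l) - F c)) {c..c + 2 * l}"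
    by (rule fundamental_theorem_of_calculus)
       (use F[unfolded has_real_derivative_iff_has_vector_derivative] assms(1) in
          \<open>auto intro: has_vector_derivative_at_within\<close>)
  with assms(4) have "F (c + 2 * l) - F c = 0" by (metis has_integral_unique)
  then have per: "F (x + 2 * l) - F c = F x - F c" for x using const[of x] by simp
  have "((\<lambda>x. F x - F c) has_real_derivative \<psi> x) (at x)" for x
    using DERIV_diff[OF F[of x] DERIV_const[of "F c"]] by simp
  with per assms(2) have "per_C1 l (\<lambda>x. F x - F c) \<psi>"
    unfolding per_C1_def by blast
  then show ?thesis by (rule that) simp
qed

section \<open>The fundamental lemma of the calculus of variations on the torus\<close>

text \<open>The squared positive part is the basic \<open>C1\<close> cutoff from which both the
  periodic bumps and \<open>smooth_step\<close> are built. At 0 its difference quotient is at most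
  \<open>\<bar>h\<bar>\<close>.\<close>

lemma max0_sq_derivative: "((\<lambda>t::real. (max 0 t)\<^sup>2) has_real_derivative 2 * max 0 t) (at t)"
proof (cases t "0 :: real" rule: linorder_cases)
  case less
  have "((\<lambda>t::real. 0) has_real_derivative 2 * max 0 t) (at t)" using less by simp
  then show ?thesis
    by (rule DERIV_cong_ev[THEN iffD1, rotated 3])
       (use less in \<open>auto intro!: eventually_mono[OF eventually_nhds_in_open[of "{..<0}"]]\<close>)
next
  case equal
  have "((\<lambda>h::real. (max 0 h)\<^sup>2 / h) \<longlongrightarrow> 0) (at 0)"
  proof (rule Lim_null_comparison)
    show "\<forall>\<^sub>F h::real in at 0. norm ((max 0 h)\<^sup>2 / h) \<le> \<bar>h\<bar>"
      by (auto simp: max_def power2_eq_square)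
    show "((\<lambda>h::real. \<bar>h\<bar>) \<longlongrightarrow> 0) (at 0)" by (rule tendsto_rabs_zero) (rule tendsto_ident_at)
  qed
  then show ?thesis using equal by (simp add: DERIV_def)
next
  case greater
  have "((\<lambda>t::real. t\<^sup>2) has_real_derivative 2 * max 0 t) (at t)"
    using greater by (auto intro!: derivative_eq_intros)
  then show ?thesis
    by (rule DERIV_cong_ev[THEN iffD1, rotated 3])
       (use greater in \<open>auto intro!: eventually_mono[OF eventually_nhds_in_open[of "{0<..}"]]\<close>)
qed

text \<open>The periodic \<open>C\<^sup>1\<close> bump is built from the positive part of
  \<open>cos (\<pi> (x - m) / l) - cos (\<pi> d / l)\<close>, which is positive exactly within distance \<open>d\<close> of
  \<open>m + 2 l \<int>\<close>.\<close>

lemma periodic_bumps: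
  assumes l: "0 < l" and ab: "-l \<le> a" "a < b" "b \<le> l"
  obtains \<theta> \<theta>' where "\<And>k. per_C1 l (\<theta> k) (\<theta>' k)"
    and "\<And>(k::nat) x. 0 \<le> \<theta> k x \<and> \<theta> k x \<le> (1::real)"
    and "\<And>x. x \<in> {-l..<l} \<Longrightarrow> (\<lambda>k. \<theta> k x) \<longlonglongrightarrow> indicator {a<..<b} x"
proof -
  define m d where "m = (a + b) / 2" and "d = (b - a) / 2"
  have md: "a = m - d" "b = m + d" "0 < d" "d \<le> l" using ab by (auto simp: m_def d_def field_simps)
  define \<beta> where "\<beta> x = cos (pi * (x - m) / l) - cos (pi * d / l)" for x
  define q where "q x = (max 0 (\<beta> x))\<^sup>2" for x
  define q' where "q' x = 2 * max 0 (\<beta> x) * (- sin (pi * (x - m) / l) * (pi / l))" for x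
  \<comment> \<open>This is \<open>k * q / (1 + k * q)\<close>: it stays in [0, 1), vanishes where
    \<open>q\<close> does, and increases to 1 where \<open>q > 0\<close>.\<close>
  define \<theta> where "\<theta> k x = 1 - 1 / (1 + real k * q x)" for k x
  define \<theta>' where "\<theta>' k x = real k * q' x / (1 + real k * q x)\<^sup>2" for k x
  have q0: "0 \<le> q x" for x by (simp add: q_def)
  have pos: "0 < 1 + real k * q x" for k x using q0[of x] by (simp add: add_pos_nonneg)
  have \<beta>per: "\<beta> (x + 2 * l) = \<beta> x" for x
  proof -
    have "pi * (x + 2 * l - m) / l = pi * (x - m) / l + 2 * pi" using l by (simp add: field_simps)
    then show ?thesis by (simp add: \<beta>_def)
  qed
  have \<beta>deriv: "(\<beta> has_real_derivative (- sin (pi * (x - m) / l) * (pi / l))) (at x)" for x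
    unfolding \<beta>_def using l by (auto intro!: derivative_eq_intros)
  have qderiv: "(q has_real_derivative q' x) (at x)" for x
    unfolding q_def q'_def by (rule DERIV_chain2[OF max0_sq_derivative \<beta>deriv])
  have \<theta>deriv: "(\<theta> k has_real_derivative \<theta>' k x) (at x)" for k x
  proof -
    have "((\<lambda>x. 1 - inverse (1 + real k * q x)) has_real_derivative
        - (- (inverse (1 + real k * q x) * (real k * q' x) * inverse (1 + real k * q x)))) (at x)"
      using pos[of k x] by (auto intro!: derivative_eq_intros qderiv)
    moreover have "\<theta> k = (\<lambda>x. 1 - inverse (1 + real k * q x))"
      by (rule ext) (simp add: \<theta>_def inverse_eq_divide)
    ultimately show ?thesis by (simp add: \<theta>'_def field_simps power2_eq_square)
  qed
  have cont: "continuous_on UNIV q" "continuous_on UNIV q'"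
    unfolding q_def q'_def \<beta>_def by (auto intro!: continuous_intros simp: l less_imp_neq[symmetric] l[THEN less_imp_neq, symmetric])
  have C1: "per_C1 l (\<theta> k) (\<theta>' k)" for k
    unfolding per_C1_def
  proof (intro conjI allI \<theta>deriv)
    show "\<theta> k (x + 2 * l) = \<theta> k x" for x by (simp add: \<theta>_def q_def \<beta>per)
    have "(1 + real k * q x)\<^sup>2 \<noteq> 0" for x using pos[of k x] by simp
    then show "continuous_on UNIV (\<theta>' k)"
      unfolding \<theta>'_def by (intro continuous_intros cont) auto
  qed
  have range: "0 \<le> \<theta> k x \<and> \<theta> k x \<le> 1" for k x
    using q0[of x] pos[of k x] by (simp add: \<theta>_def field_simps)
  have \<beta>pos: "0 < \<beta> x \<longleftrightarrow> x \<in> {a<..<b}" if x: "x \<in> {-l..<l}" for x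
  proof -
    have dl: "0 \<le> pi * d / l" "pi * d / l \<le> pi"
      using md l by (auto simp: field_simps)
    have abs: "cos (pi * (x - m) / l) = cos (pi * \<bar>x - m\<bar> / l)"
    proof -
      have "cos \<bar>pi * (x - m) / l\<bar> = cos (pi * (x - m) / l)" by (rule cos_abs_real)
      moreover have "\<bar>pi * (x - m) / l\<bar> = pi * \<bar>x - m\<bar> / l" using l by (simp add: abs_mult)
      ultimately show ?thesis by metis
    qed
    show ?thesis
    proof (cases "\<bar>x - m\<bar> \<le> l")
      case True
      have r: "0 \<le> pi * \<bar>x - m\<bar> / l" "pi * \<bar>x - m\<bar> / l \<le> pi" using True l by (auto simp: field_simps)
      have "0 < \<beta> x \<longleftrightarrow> pi * \<bar>x - m\<bar> / l < pi * d / l"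
        unfolding \<beta>_def abs using cos_mono_less_eq[OF dl r] by simp
      also have "\<dots> \<longleftrightarrow> \<bar>x - m\<bar> < d" using l by (simp add: divide_less_cancel)
      also have "\<dots> \<longleftrightarrow> x \<in> {a<..<b}" using md by auto
      finally show ?thesis .
    next
      case False
      \<comment> \<open>The nearest copy of \<open>m\<close> now lies across the cut of the circle,
        at distance \<open>2 * l - \<bar>x - m\<bar>\<close>. As \<open>{a..b}\<close> lies in
        \<open>{-l..l}\<close>, this distance is at least \<open>d\<close>, so
        \<open>\<beta> x\<close> is not positive.\<close>
      have b2: "d \<le> 2 * l - \<bar>x - m\<bar>" using ab x md by auto
      have b3: "2 * l - \<bar>x - m\<bar> \<le> l" using False by simp
      have r: "0 \<le> pi * (2 * l - \<bar>x - m\<bar>) / l" "pi * (2 * l - \<bar>x - m\<bar>) / l \<le> pi"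
        using b2 b3 md l by (auto simp: field_simps)
      have "pi * (2 * l - \<bar>x - m\<bar>) / l = 2 * pi - pi * \<bar>x - m\<bar> / l" using l by (simp add: field_simps)
      then have "cos (pi * (x - m) / l) = cos (pi * (2 * l - \<bar>x - m\<bar>) / l)" by (simp add: abs)
      moreover have "pi * d / l \<le> pi * (2 * l - \<bar>x - m\<bar>) / l"
        using b2 l by (intro divide_right_mono mult_left_mono) auto
      ultimately have "\<not> 0 < \<beta> x"
        unfolding \<beta>_def using cos_mono_le_eq[OF r dl] by simp
      moreover have "x \<notin> {a<..<b}" using False md by auto
      ultimately show ?thesis by simp
    qed
  qed
  have lim: "(\<lambda>k. \<theta> k x) \<longlonglongrightarrow> indicator {a<..<b} x" if x: "x \<in> {-l..<l}" for x
  proof (cases "x \<in> {a<..<b}")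
    case True
    then have "0 < q x" using \<beta>pos[OF x] by (simp add: q_def)
    then have "filterlim (\<lambda>k. 1 + q x * real k) at_top sequentially"
      by (intro filterlim_tendsto_add_at_top[OF tendsto_const]
          filterlim_tendsto_pos_mult_at_top[OF tendsto_const _ filterlim_real_sequentially])
    then have "(\<lambda>k. 1 - inverse (1 + q x * real k)) \<longlonglongrightarrow> 1 - 0"
      by (intro tendsto_diff tendsto_const tendsto_inverse_0_at_top)
    then show ?thesis using True by (simp add: \<theta>_def inverse_eq_divide mult.commute)
  next
    case False
    then have "max 0 (\<beta> x) = 0" using \<beta>pos[OF x] by (simp only: max_def not_less) auto
    then have "q x = 0" by (simp add: q_def)
    then show ?thesis using False by (simp add: \<theta>_def)
  qed
  show ?thesis by (rule that[OF C1 range lim])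
qed

lemma AE_torus_snd:
  assumes "AE x in circ l. P x"
  shows "AE p in torus l. P (snd p)"
proof -
  from assms obtain N where N: "{x \<in> space (circ l). \<not> P x} \<subseteq> N" "N \<in> null_sets (circ l)"
    by (auto simp: eventually_ae_filter)
  interpret c: finite_measure "circ l" by (rule finite_measure_circ)
  have "space (circ l) \<times> N \<in> null_sets (torus l)"
    unfolding torus_eq_pair using N(2) by (intro c.times_in_null_sets2 sets.top)
  then show ?thesis
    by (rule AE_I') (use N(1) in \<open>auto simp: torus_eq_pair space_pair_measure\<close>)
qed

lemma AE_circ_iff: "(AE x in circ l. P x) \<longleftrightarrow> (AE x in lborel. x \<in> {-l..<l} \<longrightarrow> P x)"
  unfolding circ_def by (rule AE_restrict_space_iff) simp

lemma AE_torus_interior: "AE p in torus l. p \<in> {-l<..<l} \<times> {-l<..<l}"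
proof -
  have "AE x in circ l. x \<in> {-l<..<l}"
    unfolding AE_circ_iff using AE_lborel_singleton[of "-l"] by eventually_elim auto
  from AE_torus_fst[OF this] AE_torus_snd[OF this] show ?thesis
    by eventually_elim auto
qed

text \<open>Products of bumps converge boundedly to indicators of rectangles, so \<open>h\<close>
  has integral zero over every box; boxes form an intersection-stable generator of the Borel sets,
  and zero integrals over all Borel sets force \<open>h\<close> to vanish almost everywhere.
  Restricting the hypothesis to products lets \<open>du_Bois_Reymond\<close> treat the factor in
  \<open>x\<close> alone.\<close>

lemma torus_fundamental_lemma:
  assumes l: "0 < l" and h: "integrable (torus l) h"
    and test: "\<And>\<theta> \<theta>' \<eta> \<eta>'. per_C1 l \<theta> \<theta>' \<Longrightarrow> per_C1 l \<eta> \<eta>' \<Longrightarrow>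
      (LINT p|torus l. h p * (\<theta> (fst p) * \<eta> (snd p))) = 0"
  shows "AE p in torus l. h p = 0"
proof -
  have hm: "h \<in> borel_measurable (torus l)" using h by simp
  define S where "S = {-l<..<l} \<times> {-l<..<l}"
  have openS: "S = box (-l, -l) (l, l)" by (auto simp: S_def box_prod)
  have S_AE: "AE p in torus l. p \<in> S" using AE_torus_interior by (simp add: S_def)
  have rect: "(LINT p|torus l. h p * indicator ({a<..<b} \<times> {c<..<d}) p) = 0"
    if ab: "-l \<le> a" "a < b" "b \<le> l" and cd: "-l \<le> c" "c < d" "d \<le> l" for a b c d
  proof -
    obtain \<theta> \<theta>' where \<theta>: "\<And>k. per_C1 l (\<theta> k) (\<theta>' k)" "\<And>k x. 0 \<le> \<theta> k x \<and> \<theta> k x \<le> 1"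
      "\<And>x. x \<in> {-l..<l} \<Longrightarrow> (\<lambda>k. \<theta> k x) \<longlonglongrightarrow> indicator {a<..<b} x"
      using periodic_bumps[OF l ab] by metis
    obtain \<eta> \<eta>' where \<eta>: "\<And>k. per_C1 l (\<eta> k) (\<eta>' k)" "\<And>k x. 0 \<le> \<eta> k x \<and> \<eta> k x \<le> 1"
      "\<And>x. x \<in> {-l..<l} \<Longrightarrow> (\<lambda>k. \<eta> k x) \<longlonglongrightarrow> indicator {c<..<d} x"
      using periodic_bumps[OF l cd] by metis
    have "(\<lambda>k. LINT p|torus l. h p * (\<theta> k (fst p) * \<eta> k (snd p)))
        \<longlonglongrightarrow> (LINT p|torus l. h p * indicator ({a<..<b} \<times> {c<..<d}) p)"
    proof (rule integral_dominated_convergence[where w="\<lambda>p. \<bar>h p\<bar>"])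
      show "(\<lambda>p. h p * indicator ({a<..<b} \<times> {c<..<d}) p) \<in> borel_measurable (torus l)"
        by (intro borel_measurable_times hm borel_measurable_torus borel_measurable_indicator)
           (simp add: borel_prod[symmetric])
      show "(\<lambda>p. h p * (\<theta> k (fst p) * \<eta> k (snd p))) \<in> borel_measurable (torus l)" for k
        by (intro borel_measurable_times hm borel_measurable_torus borel_measurable_continuous_onI
            torus_C1_continuous[OF torus_C1_product(1)[OF \<theta>(1)[of k] \<eta>(1)[of k]]] continuous_on_mult
            continuous_on_compose2[OF per_C1_continuous[OF \<theta>(1)[of k], of UNIV]]
            continuous_on_compose2[OF per_C1_continuous[OF \<eta>(1)[of k], of UNIV]]
            continuous_on_fst continuous_on_snd continuous_on_id) auto
      show "integrable (torus l) (\<lambda>p. \<bar>h p\<bar>)" using h by simp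
      show "AE p in torus l. (\<lambda>k. h p * (\<theta> k (fst p) * \<eta> k (snd p)))
          \<longlonglongrightarrow> h p * indicator ({a<..<b} \<times> {c<..<d}) p"
      proof (rule AE_I2)
        fix p assume "p \<in> space (torus l)"
        then have "(\<lambda>k. h p * (\<theta> k (fst p) * \<eta> k (snd p)))
            \<longlonglongrightarrow> h p * (indicator {a<..<b} (fst p) * indicator {c<..<d} (snd p))"
          by (intro tendsto_intros \<theta>(3) \<eta>(3)) auto
        then show "(\<lambda>k. h p * (\<theta> k (fst p) * \<eta> k (snd p)))
          \<longlonglongrightarrow> h p * indicator ({a<..<b} \<times> {c<..<d}) p"
          by (simp add: indicator_times)
      qed
      show "AE p in torus l. norm (h p * (\<theta> k (fst p) * \<eta> k (snd p))) \<le> \<bar>h p\<bar>" for k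
      proof (rule AE_I2)
        fix p
        have "\<bar>\<theta> k (fst p) * \<eta> k (snd p)\<bar> \<le> 1"
          using \<theta>(2)[of k "fst p"] \<eta>(2)[of k "snd p"] by (simp add: abs_mult mult_le_one)
        from mult_left_mono[OF this, of "\<bar>h p\<bar>"]
        show "norm (h p * (\<theta> k (fst p) * \<eta> k (snd p))) \<le> \<bar>h p\<bar>" by (simp add: abs_mult)
      qed
    qed
    then show ?thesis using test[OF \<theta>(1) \<eta>(1)] by (simp add: LIMSEQ_const_iff)
  qed
  have box: "(LINT p|torus l. h p * indicator (box u v) p) = 0" for u v
  proof -
    obtain a c b d where uv: "u = (a, c)" "v = (b, d)" by (cases u; cases v) auto
    define R where "R = {max a (-l)<..<min b l} \<times> {max c (-l)<..<min d l}"
    have "(LINT p|torus l. h p * indicator (box u v) p) = (LINT p|torus l. h p * indicator R p)"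
    proof (rule integral_cong_AE)
      show "(\<lambda>p. h p * indicator (box u v) p) \<in> borel_measurable (torus l)"
        by (intro borel_measurable_times hm borel_measurable_torus borel_measurable_indicator) simp
      show "(\<lambda>p. h p * indicator R p) \<in> borel_measurable (torus l)"
        by (intro borel_measurable_times hm borel_measurable_torus borel_measurable_indicator)
           (simp add: R_def borel_prod[symmetric])
      show "AE p in torus l. h p * indicator (box u v) p = h p * indicator R p"
        using S_AE by eventually_elim (auto simp: S_def R_def uv box_prod indicator_def)
    qed
    also have "\<dots> = 0"
    proof (cases "max a (-l) < min b l \<and> max c (-l) < min d l")
      case True
      then show ?thesis unfolding R_def by (intro rect) auto
    next
      case False
      then have "R = {}" by (auto simp: R_def)
      then show ?thesis by simp
    qed
    finally show ?thesis .
  qed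
  \<comment> \<open>The constant 1 is an admissible test; the complement step of the induction below
    needs this integral.\<close>
  have all: "(LINT p|torus l. h p) = 0"
    using test[OF per_C1_const[of l 1] per_C1_const[of l 1]] by simp
  have int: "integrable (torus l) (\<lambda>p. h p * indicator A p)" if "A \<in> sets borel" for A
  proof (rule Bochner_Integration.integrable_bound[OF h])
    show "(\<lambda>p. h p * indicator A p) \<in> borel_measurable (torus l)"
      by (intro borel_measurable_times hm borel_measurable_torus borel_measurable_indicator that)
    show "AE p in torus l. norm (h p * indicator A p) \<le> norm (h p)"
      by (rule AE_I2) (simp add: indicator_def)
  qed
  have borel: "(LINT p|torus l. h p * indicator A p) = 0" if A: "A \<in> sets borel" for A
  proof -
    define G where "G = range (\<lambda>(a, b). box a b :: (real \<times> real) set)"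
    have "Int_stable G"
      unfolding G_def Int_stable_def by (auto simp: box_Int_box)
    moreover have "G \<subseteq> Pow UNIV" by simp
    moreover have sg: "sigma_sets UNIV G = sets borel"
      by (simp add: G_def borel_eq_box)
    then have "A \<in> sigma_sets UNIV G" using A by simp
    ultimately show ?thesis
    proof (induction rule: sigma_sets_induct_disjoint)
      case (basic A)
      then show ?case by (auto simp: G_def box)
    next
      case empty
      then show ?case by simp
    next
      case (compl A)
      have "(LINT p|torus l. h p * indicator (UNIV - A) p) = (LINT p|torus l. h p - h p * indicator A p)"
        by (rule Bochner_Integration.integral_cong) (auto simp: indicator_def)
      also have "\<dots> = (LINT p|torus l. h p) - (LINT p|torus l. h p * indicator A p)"
        using compl(1) by (intro Bochner_Integration.integral_diff h int) (simp add: sg)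
      finally show ?case using all compl(2) by simp
    next
      case (union A)
      have Am: "A i \<in> sets borel" for i using union(2) sg by auto
      have "(\<lambda>n. LINT p|torus l. h p * indicator (\<Union>i<n. A i) p)
          \<longlonglongrightarrow> (LINT p|torus l. h p * indicator (\<Union>i. A i) p)"
      proof (rule integral_dominated_convergence[where w="\<lambda>p. \<bar>h p\<bar>"])
        show "(\<lambda>p. h p * indicator (\<Union>i. A i) p) \<in> borel_measurable (torus l)"
          "(\<lambda>p. h p * indicator (\<Union>i<n. A i) p) \<in> borel_measurable (torus l)" for n
          using Am by (intro borel_measurable_times hm borel_measurable_torus borel_measurable_indicator; auto)+
        show "integrable (torus l) (\<lambda>p. \<bar>h p\<bar>)" using h by simp
        show "AE p in torus l. (\<lambda>n. h p * indicator (\<Union>i<n. A i) p) \<longlonglongrightarrow> h p * indicator (\<Union>i. A i) p"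
          by (intro AE_I2 tendsto_mult tendsto_const LIMSEQ_indicator_UN)
        show "AE p in torus l. norm (h p * indicator (\<Union>i<n. A i) p) \<le> \<bar>h p\<bar>" for n
          by (rule AE_I2) (simp add: indicator_def)
      qed
      moreover have "(LINT p|torus l. h p * indicator (\<Union>i<n. A i) p) = 0" for n
      proof -
        have "(LINT p|torus l. h p * indicator (\<Union>i<n. A i) p)
            = (LINT p|torus l. (\<Sum>i<n. h p * indicator (A i) p))"
          by (rule Bochner_Integration.integral_cong)
             (use union(1) in \<open>auto simp: sum_distrib_left[symmetric] disjoint_family_on_def
                intro!: indicator_UN_disjoint\<close>)
        also have "\<dots> = (\<Sum>i<n. LINT p|torus l. h p * indicator (A i) p)"
          by (intro Bochner_Integration.integral_sum int Am)
        finally show ?thesis using union(3) by simp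
      qed
      ultimately show ?case by (simp add: LIMSEQ_const_iff)
    qed
  qed
  have "AE p in torus l. h p = (\<lambda>_. 0) p"
  proof (rule density_unique_real[OF h])
    fix A assume "A \<in> sets (torus l)"
    then have A: "A \<in> sets borel"
      unfolding torus_def using square_sets[of l] by (auto simp: sets_restrict_space)
    show "(LINT p:A|torus l. h p) = (LINT p:A|torus l. 0)"
      using borel[OF A] by (simp add: set_lebesgue_integral_def mult.commute)
  qed simp
  then show ?thesis by simp
qed

section \<open>Uniqueness of weak derivatives\<close>

lemma torus_L2_integrable: "h \<in> torus_L2 l \<Longrightarrow> integrable (torus l) h"
proof -
  assume h: "h \<in> torus_L2 l"
  interpret finite_measure "torus l" by (rule finite_measure_torus)
  show ?thesis
  proof (rule Bochner_Integration.integrable_bound[where f="\<lambda>p. 1 + (h p)\<^sup>2"])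
    show "integrable (torus l) (\<lambda>p. 1 + (h p)\<^sup>2)" "h \<in> borel_measurable (torus l)"
      using h by (auto simp: torus_L2_def)
    show "AE p in torus l. norm (h p) \<le> norm (1 + (h p)\<^sup>2)"
    proof (rule AE_I2)
      fix p
      have "0 \<le> (\<bar>h p\<bar> - 1)\<^sup>2" by simp
      then have "2 * \<bar>h p\<bar> \<le> 1 + (h p)\<^sup>2" by (simp add: power2_diff)
      then show "norm (h p) \<le> norm (1 + (h p)\<^sup>2)" by simp
    qed
  qed
qed

lemma torus_L2_bounded:
  assumes "h \<in> borel_measurable (torus l)" "AE p in torus l. \<bar>h p\<bar> \<le> M"
  shows "h \<in> torus_L2 l"
proof -
  have "AE p in torus l. \<bar>(h p)\<^sup>2\<bar> \<le> M\<^sup>2"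
    using assms(2) by eventually_elim (simp add: abs_le_square_iff[symmetric])
  from integrable_torus_bounded[OF _ this] show ?thesis
    using assms(1) unfolding torus_L2_def by simp
qed

lemma torus_L2_AE_eq:
  assumes l: "0 < l" and h: "h \<in> torus_L2 l" "k \<in> torus_L2 l"
    and eq: "\<And>\<phi>. \<phi> \<in> torus_C1 l \<Longrightarrow> (LINT p|torus l. h p * \<phi> p) = (LINT p|torus l. k p * \<phi> p)"
  shows "AE p in torus l. h p = k p"
proof -
  have "AE p in torus l. h p - k p = 0"
  proof (rule torus_fundamental_lemma[OF l])
    show "integrable (torus l) (\<lambda>p. h p - k p)"
      using h torus_L2_integrable by (intro Bochner_Integration.integrable_diff) blast+
    fix \<theta> \<theta>' \<eta> \<eta>' assume "per_C1 l \<theta> \<theta>'" "per_C1 l \<eta> \<eta>'"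
    note \<phi> = torus_C1_product(1)[OF this]
    let ?\<phi> = "\<lambda>p. \<theta> (fst p) * \<eta> (snd p)"
    have "(LINT p|torus l. (h p - k p) * ?\<phi> p)
        = (LINT p|torus l. h p * ?\<phi> p) - (LINT p|torus l. k p * ?\<phi> p)"
      unfolding left_diff_distrib
      using h by (intro Bochner_Integration.integral_diff integrable_torus_times_continuous
        torus_C1_continuous[OF \<phi>] torus_L2_integrable) auto
    then show "(LINT p|torus l. (h p - k p) * ?\<phi> p) = 0" using eq[OF \<phi>] by simp
  qed
  then show ?thesis by simp
qed

text \<open>The only access to the chosen \<open>weak_dx\<close>: an explicitly computed weak
  derivative \<open>h\<close> shows that the choice is meaningful, and the fundamental lemma
  identifies it with \<open>h\<close> almost everywhere.\<close>

lemma weak_dx_AE_eq: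
  assumes l: "0 < l" and h: "h \<in> torus_L2 l" "is_weak_dx l f h"
  shows "AE p in torus l. weak_dx l f p = h p"
proof -
  have "weak_dx l f \<in> torus_L2 l \<and> is_weak_dx l f (weak_dx l f)"
    unfolding weak_dx_def by (rule someI[of _ h]) (use h in simp)
  then show ?thesis
    using h by (intro torus_L2_AE_eq[OF l]) (auto simp: is_weak_dx_def)
qed

lemma weak_dy_AE_eq:
  assumes l: "0 < l" and h: "h \<in> torus_L2 l" "is_weak_dy l f h"
  shows "AE p in torus l. weak_dy l f p = h p"
proof -
  have "weak_dy l f \<in> torus_L2 l \<and> is_weak_dy l f (weak_dy l f)"
    unfolding weak_dy_def by (rule someI[of _ h]) (use h in simp)
  then show ?thesis
    using h by (intro torus_L2_AE_eq[OF l]) (auto simp: is_weak_dy_def)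
qed

text \<open>A test function must have mean zero to possess a periodic primitive, so only
  \<open>\<psi> = \<theta> - \<mu>\<close> can enter the weak equation. This costs nothing when
  tested against \<open>q - c\<close>, which has mean zero itself.\<close>

lemma du_Bois_Reymond:
  assumes l: "0 < l" and q: "integrable (circ l) q"
    and weak: "is_weak_dx l (\<lambda>p. q (fst p)) (\<lambda>p. 0)"
  shows "\<exists>c. AE x in circ l. q x = c"
proof -
  define c where "c = (LINT x|circ l. q x) / (2 * l)"
  have ic: "integrable (circ l) (\<lambda>x. k :: real)" for k
    by (rule integrable_circ_continuous) simp
  have ck: "(LINT x|circ l. k) = 2 * l * k" for k :: real
    using l by (simp add: measure_circ_space)
  have iqc: "integrable (circ l) (\<lambda>x. q x - c)" using q ic by (rule Bochner_Integration.integrable_diff)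
  have mean: "(LINT x|circ l. q x - c) = 0"
    using q ic l by (simp add: c_def measure_circ_space)
  have "AE p in torus l. q (fst p) - c = 0"
  proof (rule torus_fundamental_lemma[OF l])
    show i: "integrable (torus l) (\<lambda>p. q (fst p) - c)"
      by (rule integral_torus_fst(1)[OF l iqc])
    fix \<theta> \<theta>' \<eta> \<eta>' assume \<theta>: "per_C1 l \<theta> \<theta>'" and \<eta>: "per_C1 l \<eta> \<eta>'"
    define \<mu> where "\<mu> = (LINT x|circ l. \<theta> x) / (2 * l)"
    define \<psi> where "\<psi> x = \<theta> x - \<mu>" for x
    have i\<theta>: "integrable (circ l) \<theta>" by (intro integrable_circ_continuous per_C1_continuous[OF \<theta>])
    have i\<psi>: "integrable (circ l) \<psi>" unfolding \<psi>_def using i\<theta> ic by (rule Bochner_Integration.integrable_diff)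
    have "(LINT x|circ l. \<psi> x) = 0"
      using i\<theta> ic l by (simp add: \<mu>_def \<psi>_def measure_circ_space)
    with integral_circ_HK[OF i\<psi>] have \<psi>0: "(\<psi> has_integral 0) {-l..-l + 2 * l}" by simp
    have \<psi>c: "continuous_on UNIV \<psi>" unfolding \<psi>_def by (intro continuous_intros per_C1_continuous[OF \<theta>])
    have \<psi>p: "\<psi> (x + 2 * l) = \<psi> x" for x using \<theta> by (simp add: per_C1_def \<psi>_def)
    obtain \<Psi> where \<Psi>: "per_C1 l \<Psi> \<psi>" by (rule per_C1_primitive[OF l \<psi>c \<psi>p \<psi>0])
    note T = torus_C1_product[OF \<Psi> per_C1_const[of l 1]]
    have iq\<theta>: "integrable (torus l) (\<lambda>p. (q (fst p) - c) * \<theta> (fst p))"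
      by (rule integrable_torus_times_continuous[OF _ i])
         (rule continuous_on_compose2[OF per_C1_continuous[OF \<theta>]], auto intro!: continuous_intros)
    have m: "(\<lambda>x. (q x - c) * \<theta> x) \<in> borel_measurable (circ l)"
      using iqc i\<theta> by (intro borel_measurable_times) auto
    have "(LINT p|torus l. q (fst p) * \<psi> (fst p)) = 0"
      using weak T(1) T(2) unfolding is_weak_dx_def by force
    moreover have "(LINT p|torus l. q (fst p) * \<psi> (fst p)) = (LINT p|torus l. (q (fst p) - c) * \<theta> (fst p))"
    proof -
      have iq: "integrable (torus l) (\<lambda>p. q (fst p))" "integrable (torus l) (\<lambda>p. \<psi> (fst p))"
        by (rule integral_torus_fst(1)[OF l q] integral_torus_fst(1)[OF l i\<psi>])+
      \<comment> \<open>Insert \<open>\<theta> = \<psi> + \<mu>\<close>; of the three resulting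
        terms the last two integrate to zero, because \<open>\<psi>\<close> and \<open>q - c\<close>
        have mean zero.\<close>
      have "(LINT p|torus l. (q (fst p) - c) * \<theta> (fst p))
         = (LINT p|torus l. q (fst p) * \<psi> (fst p) - c * \<psi> (fst p) + \<mu> * (q (fst p) - c))"
        by (rule Bochner_Integration.integral_cong) (auto simp: \<psi>_def algebra_simps)
      also have "\<dots> = (LINT p|torus l. q (fst p) * \<psi> (fst p)) - c * (LINT p|torus l. \<psi> (fst p))
          + \<mu> * (LINT p|torus l. q (fst p) - c)"
      proof -
        have "integrable (torus l) (\<lambda>p. q (fst p) * \<psi> (fst p))"
          by (rule integrable_torus_times_continuous[OF _ iq(1)])
             (rule continuous_on_compose2[OF \<psi>c], auto intro!: continuous_intros)
        then show ?thesis using iq(2) i by simp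
      qed
      also have "(LINT p|torus l. \<psi> (fst p)) = 0"
        using integral_torus_fst(2)[OF l i\<psi>] \<open>(LINT x|circ l. \<psi> x) = 0\<close> by simp
      also have "(LINT p|torus l. q (fst p) - c) = 0"
        using integral_torus_fst(2)[OF l iqc] mean by simp
      finally show ?thesis by simp
    qed
    ultimately have z: "(LINT p|torus l. (q (fst p) - c) * \<theta> (fst p)) = 0" by simp
    have i2: "integrable (torus l) (\<lambda>p. (q (fst p) - c) * (\<theta> (fst p) * \<eta> (snd p)))"
      by (rule integrable_torus_times_continuous[OF torus_C1_continuous[OF torus_C1_product(1)[OF \<theta> \<eta>]] i])
    have "(LINT x|circ l. (q x - c) * \<theta> x) = 0"
      using z l by (subst (asm) integral_torus_yx[OF iq\<theta>]) (simp add: measure_circ_space)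
    moreover have "(LINT x|circ l. (q x - c) * (\<theta> x * \<eta> y)) = (LINT x|circ l. (q x - c) * \<theta> x) * \<eta> y" for y
      by (simp only: mult.assoc[symmetric] integral_mult_left_zero)
    ultimately show "(LINT p|torus l. (q (fst p) - c) * (\<theta> (fst p) * \<eta> (snd p))) = 0"
      by (subst integral_torus_yx[OF i2]) simp
  qed
  then have "AE p in torus l. q (fst p) = c" by simp
  from AE_circ_of_torus[OF l this] show ?thesis by blast
qed

section \<open>The transition cost and the optimal profile\<close>

locale anisotropy =
  fixes \<sigma> :: real
  assumes \<sigma>: "0 < \<sigma>"
begin

lemma constA_bounds: "0 < constA \<sigma>" "constA \<sigma> < 1" "\<sigma> = 1 / constA \<sigma> - 1"
  using \<sigma> by (auto simp: constA_def field_simps)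

lemma constA_sq: "(constA \<sigma>)\<^sup>2 < 1"
  using constA_bounds by (simp add: power_less_one_iff)

lemma nbar1_bounds: "0 < nbar1 \<sigma>" "nbar1 \<sigma> < 1" "(nbar1 \<sigma>)\<^sup>2 = 1 - (constA \<sigma>)\<^sup>2"
  using constA_bounds constA_sq by (auto simp: nbar1_def intro!: real_sqrt_less_iff[THEN iffD2, of _ 1, simplified])

lemma sin_arccos_constA: "sin (arccos (constA \<sigma>)) = nbar1 \<sigma>"
  using constA_bounds by (simp add: nbar1_def sin_arccos_abs)

lemma arccos_constA_bounds: "0 < arccos (constA \<sigma>)" "arccos (constA \<sigma>) < pi / 2"
  using constA_bounds arccos_less_arccos[of "constA \<sigma>" 1] arccos_less_arccos[of 0 "constA \<sigma>"]
  by (auto simp: arccos_0)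

text \<open>The integral of \<open>(cos t - A) / sqrt A\<close> over
  \<open>-a \<le> t \<le> a\<close> for \<open>A = constA \<sigma>\<close> and
  \<open>a = arccos A\<close>: the cost of the great circle arc, on which \<open>sqrt W\<close>
  equals this integrand. Here \<open>sin a\<close> is \<open>nbar1 \<sigma>\<close>.\<close>

definition transition_cost :: real where
  "transition_cost = 2 * (nbar1 \<sigma> - constA \<sigma> * arccos (constA \<sigma>)) / sqrt (constA \<sigma>)"

lemma norm_sq_vec3: "(norm (v :: real^3))\<^sup>2 = (v $ 1)\<^sup>2 + (v $ 2)\<^sup>2 + (v $ 3)\<^sup>2"
  unfolding power2_norm_eq_inner inner_vec_def by (simp add: sum_3 power2_eq_square)

lemma W_nonneg: "0 \<le> W \<sigma> v"
  using \<sigma> constA_bounds by (simp add: W_def)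

lemma continuous_on_W: "continuous_on S (W \<sigma>)"
  unfolding W_def by (intro continuous_intros)

text \<open>Put \<open>r = sqrt (1 - u^2)\<close>. The point of the arc with first component
  \<open>u\<close> has \<open>sqrt W = (r - A) / sqrt A\<close>, and along the arc \<open>u\<close>
  changes at rate \<open>r\<close> per unit length, so \<open>(1 - A / r) / sqrt A\<close> is the
  density of the cost with respect to \<open>u\<close>. The \<open>max\<close> makes it vanish for
  \<open>r \<le> A\<close>, hence continuous on the whole line, also where competing curves leave
  the range of the arc.\<close>

definition calib :: "real \<Rightarrow> real" where
  "calib u = (1 - constA \<sigma> / sqrt (max ((constA \<sigma>)\<^sup>2) (1 - u\<^sup>2))) / sqrt (constA \<sigma>)"

lemma continuous_calib: "continuous_on S calib"
proof -
  have "max ((constA \<sigma>)\<^sup>2) (1 - u\<^sup>2) > 0" for u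
    using constA_bounds by (simp add: less_max_iff_disj)
  then have "sqrt (max ((constA \<sigma>)\<^sup>2) (1 - u\<^sup>2)) \<noteq> 0" for u by (metis less_irrefl real_sqrt_gt_zero)
  then show ?thesis
    unfolding calib_def using constA_bounds by (intro continuous_intros) auto
qed

text \<open>With \<open>r = sqrt (1 - n\<^sub>1\<^sup>2)\<close>, the inequality \<open>(r - A)\<^sup>2 / A \<le> W n\<close> on the sphere reduces to
  \<open>n\<^sub>2\<^sup>2 = (r - n\<^sub>3) (r + n\<^sub>3) \<le> 2 (r - n\<^sub>3)\<close>.\<close>

lemma calib_le:
  fixes v w :: "real^3"
  assumes v: "norm v = 1" and orth: "v \<bullet> w = 0"
  shows "calib (v $ 1) * w $ 1 \<le> sqrt (W \<sigma> v) * norm w"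
proof -
  define A where "A = constA \<sigma>"
  have A: "0 < A" "A < 1" and \<sigma>A: "\<sigma> = 1 / A - 1" using constA_bounds by (auto simp: A_def)
  define r where "r = sqrt (1 - (v $ 1)\<^sup>2)"
  have v1: "(v $ 1)\<^sup>2 + (v $ 2)\<^sup>2 + (v $ 3)\<^sup>2 = 1" using v norm_sq_vec3[of v] by simp
  then have r0: "0 \<le> 1 - (v $ 1)\<^sup>2" by (smt (verit) zero_le_power2)
  have r2: "r\<^sup>2 = 1 - (v $ 1)\<^sup>2" using r0 by (simp add: r_def)
  have r: "0 \<le> r" "r \<le> 1" using r0 by (auto simp: r_def)
  \<comment> \<open>Tangency expresses the first components through the other two, to which
    Cauchy-Schwarz applies; \<open>r\<close> is the length of \<open>v\<close> without its first
    component.\<close>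
  have w1: "\<bar>w $ 1\<bar> \<le> r * norm w"
  proof -
    have o: "v $ 1 * w $ 1 = - (v $ 2 * w $ 2 + v $ 3 * w $ 3)"
      using orth by (simp add: inner_vec_def sum_3)
    have "(v $ 2 * w $ 2 + v $ 3 * w $ 3)\<^sup>2 \<le> ((v $ 2)\<^sup>2 + (v $ 3)\<^sup>2) * ((w $ 2)\<^sup>2 + (w $ 3)\<^sup>2)"
      using zero_le_power2[of "v $ 2 * w $ 3 - v $ 3 * w $ 2"]
      by (simp add: power2_eq_square algebra_simps)
    moreover have "(v $ 1)\<^sup>2 * (w $ 1)\<^sup>2 = (v $ 2 * w $ 2 + v $ 3 * w $ 3)\<^sup>2"
      by (simp only: power_mult_distrib[symmetric] o power2_minus)
    moreover have "r\<^sup>2 = (v $ 2)\<^sup>2 + (v $ 3)\<^sup>2" "(norm w)\<^sup>2 - (w $ 1)\<^sup>2 = (w $ 2)\<^sup>2 + (w $ 3)\<^sup>2"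
      using v1 r2 norm_sq_vec3[of w] by auto
    ultimately have "(v $ 1)\<^sup>2 * (w $ 1)\<^sup>2 \<le> r\<^sup>2 * ((norm w)\<^sup>2 - (w $ 1)\<^sup>2)" by simp
    then have "(w $ 1)\<^sup>2 \<le> (r * norm w)\<^sup>2"
      unfolding power_mult_distrib r2 by (simp add: algebra_simps)
    then show ?thesis using r by (simp add: abs_le_square_iff[symmetric])
  qed
  show ?thesis
  proof (cases "r \<le> A")
    case True
    then have "1 - (v $ 1)\<^sup>2 \<le> A\<^sup>2" using r r2 by (metis power_mono)
    then have "calib (v $ 1) = 0" using A by (simp add: calib_def A_def[symmetric] max_def)
    then show ?thesis using W_nonneg by simp
  next
    case False
    then have rA: "0 < r" "A < r" using A by auto
    then have "A\<^sup>2 \<le> 1 - (v $ 1)\<^sup>2" using A r2 by (metis less_imp_le power_mono)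
    then have k: "calib (v $ 1) = (1 - A / r) / sqrt A"
      by (simp add: calib_def A_def[symmetric] r_def max_def)
    have k0: "0 \<le> calib (v $ 1)" using rA A by (simp add: k)
    \<comment> \<open>The comparison hinges on \<open>A * \<sigma> = 1 - A\<close>: with it,
      \<open>A * W - (r - A)^2\<close> becomes \<open>A\<close> times
      \<open>2 * (r - v3) - v2^2\<close>.\<close>
    have W: "A * W \<sigma> v = (1 - A) * (v $ 2)\<^sup>2 + (v $ 3 - A)\<^sup>2"
    proof -
      have "A * \<sigma> = 1 - A" using \<sigma>A A by (simp add: field_simps)
      then show ?thesis using A by (simp add: W_def A_def[symmetric] distrib_left mult.assoc[symmetric])
    qed
    have v3: "v $ 3 \<le> r" "v $ 3 \<le> 1"
    proof -
      have "(v $ 3)\<^sup>2 \<le> r\<^sup>2" using v1 r2 by (smt (verit) zero_le_power2)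
      then show "v $ 3 \<le> r" using r by (meson abs_le_square_iff abs_le_D1 abs_of_nonneg order_trans power2_le_imp_le)
      then show "v $ 3 \<le> 1" using r by simp
    qed
    have "(r - v $ 3) * (r + v $ 3) \<le> (r - v $ 3) * 2"
      using v3 r by (intro mult_left_mono) auto
    moreover have "(r - v $ 3) * (r + v $ 3) = (v $ 2)\<^sup>2"
      using v1 r2 by (simp add: algebra_simps power2_eq_square)
    ultimately have "A * (v $ 2)\<^sup>2 \<le> A * ((r - v $ 3) * 2)" using A by (intro mult_left_mono) auto
    moreover have "(r - A)\<^sup>2 = (v $ 2)\<^sup>2 + (v $ 3)\<^sup>2 - 2 * r * A + A\<^sup>2"
      using v1 r2 by (simp add: power2_diff)
    ultimately have "(r - A)\<^sup>2 \<le> A * W \<sigma> v"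
      unfolding W by (simp add: power2_diff algebra_simps)
    then have "((r - A) / sqrt A)\<^sup>2 \<le> W \<sigma> v"
      using A by (simp add: power_divide field_simps)
    then have "(r - A) / sqrt A \<le> sqrt (W \<sigma> v)" by (rule real_le_rsqrt)
    moreover have "calib (v $ 1) * r = (r - A) / sqrt A" using rA A by (simp add: k field_simps)
    ultimately have "calib (v $ 1) * (r * norm w) \<le> sqrt (W \<sigma> v) * norm w"
      using mult_right_mono[of "(r - A) / sqrt A" "sqrt (W \<sigma> v)" "norm w"] by (simp add: mult.assoc[symmetric])
    moreover have "calib (v $ 1) * w $ 1 \<le> calib (v $ 1) * (r * norm w)"
      using k0 w1 by (intro mult_left_mono) auto
    ultimately show ?thesis by simp
  qed
qed

lemma calib_integral: "(calib has_integral transition_cost) {- nbar1 \<sigma>..nbar1 \<sigma>}"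
proof -
  define A where "A = constA \<sigma>"
  have A: "0 < A" "A < 1" using constA_bounds by (auto simp: A_def)
  define G where "G u = (u - A * arcsin u) / sqrt A" for u
  have "(G has_real_derivative calib u) (at u)" if u: "u \<in> {- nbar1 \<sigma>..nbar1 \<sigma>}" for u
  proof -
    have u1: "-1 < u" "u < 1" using u nbar1_bounds by auto
    have "\<bar>u\<bar> \<le> \<bar>nbar1 \<sigma>\<bar>" using u nbar1_bounds by auto
    then have "u\<^sup>2 \<le> (nbar1 \<sigma>)\<^sup>2" by (simp only: abs_le_square_iff)
    then have "A\<^sup>2 \<le> 1 - u\<^sup>2" using nbar1_bounds by (simp add: A_def)
    then have k: "calib u = (1 - A * inverse (sqrt (1 - u\<^sup>2))) / sqrt A"
      by (simp add: calib_def A_def[symmetric] max_def field_simps)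
    have "((\<lambda>u. u - A * arcsin u) has_real_derivative 1 - A * inverse (sqrt (1 - u\<^sup>2))) (at u)"
      by (intro DERIV_diff DERIV_ident DERIV_cmult DERIV_arcsin u1)
    then show ?thesis unfolding G_def k by (rule DERIV_cdivide)
  qed
  then have "(calib has_integral (G (nbar1 \<sigma>) - G (- nbar1 \<sigma>))) {- nbar1 \<sigma>..nbar1 \<sigma>}"
    using nbar1_bounds
    by (intro fundamental_theorem_of_calculus)
       (auto simp: has_real_derivative_iff_has_vector_derivative intro: has_vector_derivative_at_within)
  moreover have "arcsin (nbar1 \<sigma>) = arccos A"
    using sin_arccos_constA arccos_constA_bounds arcsin_sin[of "arccos (constA \<sigma>)"] by (simp add: A_def)
  then have "G (nbar1 \<sigma>) - G (- nbar1 \<sigma>) = transition_cost"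
    using nbar1_bounds
    by (simp add: G_def transition_cost_def A_def[symmetric] arcsin_minus diff_divide_distrib[symmetric])
  ultimately show ?thesis by simp
qed

text \<open>Calibration: with \<open>K\<close> an antiderivative of \<open>calib\<close>, the
  integrand dominates the derivative of \<open>K (\<gamma> t $ 1)\<close>, whose integral depends on
  the end points only.\<close>

lemma transition_cost_le:
  fixes \<gamma> \<gamma>' :: "real \<Rightarrow> real^3"
  assumes d: "\<forall>t\<in>{0..1}. (\<gamma> has_vector_derivative \<gamma>' t) (at t within {0..1})"
    and c: "continuous_on {0..1} \<gamma>'" and S: "\<gamma> ` {0..1} \<subseteq> sphere 0 1"
    and e: "\<gamma> 0 = n_minus \<sigma>" "\<gamma> 1 = n_plus \<sigma>"
  shows "transition_cost \<le> (LBINT t:{0..1}. sqrt (W \<sigma> (\<gamma> t)) * norm (\<gamma>' t))"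
proof -
  obtain K where K: "\<And>u. (K has_real_derivative calib u) (at u)"
    by (rule continuous_antiderivative[OF continuous_calib]) blast
  have c\<gamma>: "continuous_on {0..1} \<gamma>"
    using d has_vector_derivative_continuous by (fastforce simp: continuous_on_eq_continuous_within)
  have 1: "((\<lambda>t. calib (\<gamma> t $ 1) * \<gamma>' t $ 1) has_integral K (\<gamma> 1 $ 1) - K (\<gamma> 0 $ 1)) {0..1}"
  proof (rule fundamental_theorem_of_calculus)
    fix t :: real assume t: "t \<in> {0..1}"
    have "((\<lambda>t. \<gamma> t $ 1) has_vector_derivative \<gamma>' t $ 1) (at t within {0..1})"
      using d t by (intro bounded_linear.has_vector_derivative[OF bounded_linear_vec_nth]) auto
    then have "((\<lambda>t. \<gamma> t $ 1) has_real_derivative \<gamma>' t $ 1) (at t within {0..1})"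
      by (simp add: has_real_derivative_iff_has_vector_derivative)
    from DERIV_chain2[OF K this]
    show "((\<lambda>t. K (\<gamma> t $ 1)) has_vector_derivative calib (\<gamma> t $ 1) * \<gamma>' t $ 1) (at t within {0..1})"
      by (simp add: has_real_derivative_iff_has_vector_derivative)
  qed simp
  have "(calib has_integral (K (nbar1 \<sigma>) - K (- nbar1 \<sigma>))) {- nbar1 \<sigma>..nbar1 \<sigma>}"
    using K nbar1_bounds
    by (intro fundamental_theorem_of_calculus)
       (auto simp: has_real_derivative_iff_has_vector_derivative intro: has_vector_derivative_at_within)
  then have "K (nbar1 \<sigma>) - K (- nbar1 \<sigma>) = transition_cost"
    using calib_integral has_integral_unique by blast
  with 1 have 2: "((\<lambda>t. calib (\<gamma> t $ 1) * \<gamma>' t $ 1) has_integral transition_cost) {0..1}"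
    by (simp add: e n_plus_def n_minus_def)
  have cont: "continuous_on {0..1} (\<lambda>t. sqrt (W \<sigma> (\<gamma> t)) * norm (\<gamma>' t))"
    by (intro continuous_intros c continuous_on_compose2[OF continuous_on_W c\<gamma>]) auto
  have si: "set_integrable lborel {0..1} (\<lambda>t. sqrt (W \<sigma> (\<gamma> t)) * norm (\<gamma>' t))"
    by (rule borel_integrable_atLeastAtMost'[OF cont])
  have "((\<lambda>t. sqrt (W \<sigma> (\<gamma> t)) * norm (\<gamma>' t)) has_integral
      (LBINT t:{0..1}. sqrt (W \<sigma> (\<gamma> t)) * norm (\<gamma>' t))) {0..1}"
    using set_borel_integral_eq_integral[OF si] by (simp add: has_integral_iff)
  from 2 this show ?thesis
  proof (rule has_integral_le)
    fix t :: real assume t: "t \<in> {0..1}"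
    have n: "norm (\<gamma> s) = 1" if "s \<in> {0..1}" for s using S that by (auto simp: image_subset_iff)
    \<comment> \<open>Differentiating the constant length of \<open>\<gamma>\<close> yields the
      orthogonality that \<open>calib_le\<close> asks for.\<close>
    have "((\<lambda>s. \<gamma> s \<bullet> \<gamma> s) has_vector_derivative (\<gamma> t \<bullet> \<gamma>' t + \<gamma>' t \<bullet> \<gamma> t)) (at t within {0..1})"
      using d t by (intro bounded_bilinear.has_vector_derivative[OF bounded_bilinear_inner]) auto
    moreover have "((\<lambda>s. \<gamma> s \<bullet> \<gamma> s) has_vector_derivative 0) (at t within {0..1})"
    proof (rule has_vector_derivative_transform[OF t])
      show "((\<lambda>s. 1 :: real) has_vector_derivative 0) (at t within {0..1})" by simp
      show "\<gamma> s \<bullet> \<gamma> s = 1" if "s \<in> {0..1}" for s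
        using n[OF that] by (simp add: power2_norm_eq_inner[symmetric])
    qed
    ultimately have "\<gamma> t \<bullet> \<gamma>' t + \<gamma>' t \<bullet> \<gamma> t = 0"
      by (rule vector_derivative_unique_within[rotated]) (use t in \<open>simp add: trivial_limit_within islimpt_Icc\<close>)
    then have "\<gamma> t \<bullet> \<gamma>' t = 0" by (simp add: inner_commute)
    then show "calib (\<gamma> t $ 1) * \<gamma>' t $ 1 \<le> sqrt (W \<sigma> (\<gamma> t)) * norm (\<gamma>' t)"
      by (rule calib_le[OF n[OF t]])
  qed
qed

text \<open>The arc from angle \<open>-a\<close> to \<open>a\<close>, traversed at constant speed
  \<open>2 * a\<close>, attains the bound of \<open>transition_cost_le\<close>, so the infimum is a
  minimum with an explicit value.\<close>

lemma c0_eq: "c0 \<sigma> = transition_cost"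
proof -
  define A a where "A = constA \<sigma>" and "a = arccos A"
  have A: "0 < A" "A < 1" using constA_bounds by (auto simp: A_def)
  have a: "0 < a" "a < pi / 2" using arccos_constA_bounds by (auto simp: a_def A_def)
  have sc: "sin a = nbar1 \<sigma>" "cos a = A" using sin_arccos_constA A by (auto simp: a_def A_def)
  define \<gamma> \<gamma>' :: "real \<Rightarrow> real^3" where
    "\<gamma> t = vector [sin (a * (2 * t - 1)), 0, cos (a * (2 * t - 1))]" and
    "\<gamma>' t = vector [2 * a * cos (a * (2 * t - 1)), 0, - 2 * a * sin (a * (2 * t - 1))]" for t
  have \<gamma>: "\<forall>t\<in>{0..1}. (\<gamma> has_vector_derivative \<gamma>' t) (at t within {0..1})"
    "continuous_on {0..1} \<gamma>'" "\<gamma> ` {0..1} \<subseteq> sphere 0 1" "\<gamma> 0 = n_minus \<sigma>" "\<gamma> 1 = n_plus \<sigma>"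
  proof -
    have "((\<lambda>t. \<gamma> t $ i) has_vector_derivative \<gamma>' t $ i) (at t within {0..1})" for t i
      using exhaust_3[of i] unfolding \<gamma>_def \<gamma>'_def
      by (auto simp: has_real_derivative_iff_has_vector_derivative[symmetric] intro!: derivative_eq_intros)
    then show "\<forall>t\<in>{0..1}. (\<gamma> has_vector_derivative \<gamma>' t) (at t within {0..1})"
      unfolding has_vector_derivative_def
      by (subst has_derivative_componentwise_within) (auto simp: Basis_vec_def inner_axis)
    have "continuous_on {0..1} (\<lambda>t. \<gamma>' t $ i)" for i
      using exhaust_3[of i] by (elim disjE; simp add: \<gamma>'_def; intro continuous_intros)
    then show "continuous_on {0..1} \<gamma>'" by (rule continuous_on_vec_lambda[of _ "\<lambda>i t. \<gamma>' t $ i", simplified])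
    have "(norm (\<gamma> t))\<^sup>2 = 1" for t by (simp add: norm_sq_vec3 \<gamma>_def)
    then have "norm (\<gamma> t) = 1" for t by (metis norm_ge_zero power2_eq_1_iff not_numeral_le_zero one_neq_neg_one zero_le_one power2_eq_iff_nonneg one_power2)
    then show "\<gamma> ` {0..1} \<subseteq> sphere 0 1" by auto
    show "\<gamma> 0 = n_minus \<sigma>" "\<gamma> 1 = n_plus \<sigma>"
      by (auto simp: \<gamma>_def n_minus_def n_plus_def sc A_def[symmetric])
  qed
  let ?S = "{(LBINT t:{0..1}. sqrt (W \<sigma> (\<gamma> t)) * norm (\<gamma>' t)) | \<gamma> \<gamma>'.
     (\<forall>t\<in>{0..1}. (\<gamma> has_vector_derivative \<gamma>' t) (at t within {0..1})) \<and>
     continuous_on {0..1} \<gamma>' \<and> \<gamma> ` {0..1} \<subseteq> sphere 0 1 \<and>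
     \<gamma> 0 = n_minus \<sigma> \<and> \<gamma> 1 = n_plus \<sigma>}"
  have "(LBINT t:{0..1}. sqrt (W \<sigma> (\<gamma> t)) * norm (\<gamma>' t)) = transition_cost"
  proof -
    have eq: "sqrt (W \<sigma> (\<gamma> t)) * norm (\<gamma>' t) = (cos (a * (2 * t - 1)) - A) / sqrt A * (2 * a)"
      if t: "t \<in> {0..1}" for t
    proof -
      \<comment> \<open>On the arc the cosine never drops below \<open>A\<close>, so the root of
        \<open>(cos - A)^2\<close> has the right sign.\<close>
      have "\<bar>2 * t - 1\<bar> \<le> 1" using t by auto
      then have "\<bar>a * (2 * t - 1)\<bar> \<le> a" using a by (simp add: abs_mult mult_left_le)
      then have "cos a \<le> cos \<bar>a * (2 * t - 1)\<bar>" using a by (intro cos_monotone_0_pi_le) auto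
      then have "A \<le> cos (a * (2 * t - 1))" using sc by (simp only: cos_abs_real)
      then have 1: "sqrt (W \<sigma> (\<gamma> t)) = (cos (a * (2 * t - 1)) - A) / sqrt A"
        using A by (simp add: W_def \<gamma>_def A_def[symmetric] real_sqrt_divide)
      have "(norm (\<gamma>' t))\<^sup>2 = (2 * a)\<^sup>2 * ((cos (a * (2 * t - 1)))\<^sup>2 + (sin (a * (2 * t - 1)))\<^sup>2)"
        by (simp only: norm_sq_vec3 \<gamma>'_def vector_3 power_mult_distrib distrib_left
            mult_minus_left power2_minus) simp
      then have "(norm (\<gamma>' t))\<^sup>2 = (2 * a)\<^sup>2" by simp
      then have "norm (\<gamma>' t) = 2 * a" using a by (simp only: power2_eq_iff_nonneg norm_ge_zero)
      with 1 show ?thesis by simp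
    qed
    define G where "G t = (sin (a * (2 * t - 1)) - A * (a * (2 * t - 1))) / sqrt A" for t
    have "((\<lambda>t. (cos (a * (2 * t - 1)) - A) / sqrt A * (2 * a)) has_integral (G 1 - G 0)) {0..1}"
    proof (rule fundamental_theorem_of_calculus)
      fix t :: real
      have "(G has_real_derivative (cos (a * (2 * t - 1)) - A) / sqrt A * (2 * a)) (at t)"
      proof -
        have "((\<lambda>t. sin (a * (2 * t - 1)) - A * (a * (2 * t - 1))) has_real_derivative
            (cos (a * (2 * t - 1)) - A) * (2 * a)) (at t)"
          by (auto intro!: derivative_eq_intros simp: algebra_simps)
        from DERIV_cdivide[OF this, of "sqrt A"] show ?thesis by (simp add: G_def[abs_def])
      qed
      then show "(G has_vector_derivative (cos (a * (2 * t - 1)) - A) / sqrt A * (2 * a)) (at t within {0..1})"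
        by (simp add: has_real_derivative_iff_has_vector_derivative has_vector_derivative_at_within)
    qed simp
    moreover have "G 1 - G 0 = transition_cost"
      by (simp add: G_def transition_cost_def sc a_def[symmetric] A_def[symmetric] diff_divide_distrib[symmetric])
    moreover have "(LBINT t:{0..1}. sqrt (W \<sigma> (\<gamma> t)) * norm (\<gamma>' t)) =
        (LBINT t:{0..1}. (cos (a * (2 * t - 1)) - A) / sqrt A * (2 * a))"
      by (rule set_lebesgue_integral_cong) (auto simp: eq)
    moreover have "set_integrable lborel {0..1} (\<lambda>t. (cos (a * (2 * t - 1)) - A) / sqrt A * (2 * a))"
      using A by (intro borel_integrable_atLeastAtMost' continuous_intros) auto
    note set_borel_integral_eq_integral(2)[OF this]
    ultimately show ?thesis by (simp only: integral_unique)
  qed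
  then have mem: "transition_cost \<in> ?S" using \<gamma> by (intro CollectI exI[of _ \<gamma>] exI[of _ \<gamma>']) auto
  have lb: "transition_cost \<le> x" if "x \<in> ?S" for x using that transition_cost_le by blast
  show ?thesis
    unfolding c0_def
    by (rule antisym[OF cInf_lower[OF mem] cInf_greatest]) (use mem lb in \<open>auto intro!: bdd_belowI\<close>)
qed

text \<open>The optimal profile solves \<open>\<vartheta>' = (cos \<vartheta> - A) / sqrt A\<close>; the substitution
  \<open>u = tan (\<vartheta> / 2)\<close> turns this into a Riccati equation, solved by a hyperbolic tangent.\<close>

lemma optimal_profile_exists:
  obtains \<theta> :: "real \<Rightarrow> real"
  where "\<And>t. (\<theta> has_real_derivative (cos (\<theta> t) - constA \<sigma>) / sqrt (constA \<sigma>)) (at t)"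
    and "\<And>t. \<theta> (- t) = - \<theta> t"
    and "\<And>t. 0 \<le> t \<Longrightarrow> 0 \<le> \<theta> t" and "\<And>t. 0 \<le> t \<Longrightarrow> \<theta> t < arccos (constA \<sigma>)"
proof -
  define A where "A = constA \<sigma>"
  have A: "0 < A" "A < 1" using constA_bounds by (auto simp: A_def)
  \<comment> \<open>\<open>\<alpha>\<close> is \<open>tan (a / 2)\<close> for
    \<open>a = arccos A\<close>, the positive equilibrium of the Riccati equation
    \<open>u' = ((1 - A) - (1 + A) * u^2) / (2 * sqrt A)\<close>; \<open>b\<close> is the rate for
    which \<open>\<alpha> * tanh (b * t)\<close> solves it.\<close>
  define \<alpha> where "\<alpha> = sqrt ((1 - A) / (1 + A))"
  define b where "b = (1 - A) / (2 * sqrt A * \<alpha>)"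
  have \<alpha>: "0 < \<alpha>" "\<alpha>\<^sup>2 = (1 - A) / (1 + A)" using A by (auto simp: \<alpha>_def)
  have b: "0 < b" using A \<alpha> by (simp add: b_def)
  define u where "u t = \<alpha> * tanh (b * t)" for t
  have u2: "(u t)\<^sup>2 < \<alpha>\<^sup>2" for t
  proof -
    have "\<bar>tanh (b * t)\<bar> < 1" using tanh_real_lt_1[of "b * t"] tanh_real_gt_neg1[of "b * t"] by (simp add: abs_less_iff)
    then have "(tanh (b * t))\<^sup>2 < 1" by (simp add: abs_square_less_1)
    with \<alpha>(1) have "\<alpha>\<^sup>2 * (tanh (b * t))\<^sup>2 < \<alpha>\<^sup>2 * 1" by (intro mult_strict_left_mono) auto
    then show ?thesis by (simp only: u_def power_mult_distrib mult_1_right)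
  qed
  have cosu: "cos (2 * arctan x) = (1 - x\<^sup>2) / (1 + x\<^sup>2)" for x :: real
  proof -
    have "1 + x\<^sup>2 > 0" by (simp add: add_pos_nonneg)
    then have "(cos (arctan x))\<^sup>2 = 1 / (1 + x\<^sup>2)"
      by (simp only: cos_arctan power_divide one_power2 real_sqrt_pow2[OF less_imp_le])
    then have "cos (2 * arctan x) = 2 * (1 / (1 + x\<^sup>2)) - 1" by (simp only: cos_double_cos)
    also have "\<dots> = (1 - x\<^sup>2) / (1 + x\<^sup>2)" using \<open>1 + x\<^sup>2 > 0\<close> by (simp add: field_simps)
    finally show ?thesis .
  qed
  have du: "(u has_real_derivative ((1 - A) - (1 + A) * (u t)\<^sup>2) / (2 * sqrt A)) (at t)" for t
  proof -
    have "(u has_real_derivative \<alpha> * ((1 - (tanh (b * t))\<^sup>2) * b)) (at t)"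
      unfolding u_def by (auto intro!: derivative_eq_intros)
    moreover have "\<alpha> * ((1 - (tanh (b * t))\<^sup>2) * b) = ((1 - A) - (1 + A) * (u t)\<^sup>2) / (2 * sqrt A)"
    proof -
      have "\<alpha> * b = (1 - A) / (2 * sqrt A)" using \<alpha> by (simp add: b_def)
      then have "\<alpha> * ((1 - (tanh (b * t))\<^sup>2) * b) = (1 - A) / (2 * sqrt A) * (1 - (tanh (b * t))\<^sup>2)"
        by (metis mult.assoc mult.commute)
      moreover have "(1 + A) * (u t)\<^sup>2 = (1 - A) * (tanh (b * t))\<^sup>2"
        using \<alpha> A by (simp add: u_def power_mult_distrib)
      ultimately show ?thesis by (simp add: algebra_simps)
    qed
    ultimately show ?thesis by simp
  qed
  define \<theta> where "\<theta> t = 2 * arctan (u t)" for t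
  show ?thesis
  proof (rule that[of \<theta>])
    fix t :: real
    have p: "1 + (u t)\<^sup>2 > 0" by (simp add: add_pos_nonneg)
    have "(\<theta> has_real_derivative 2 * (inverse (1 + (u t)\<^sup>2) * (((1 - A) - (1 + A) * (u t)\<^sup>2) / (2 * sqrt A)))) (at t)"
      unfolding \<theta>_def by (intro DERIV_cmult DERIV_chain2[OF DERIV_arctan du])
    moreover have "2 * (inverse (1 + (u t)\<^sup>2) * (((1 - A) - (1 + A) * (u t)\<^sup>2) / (2 * sqrt A))) = (cos (\<theta> t) - A) / sqrt A"
    proof -
      have e: "(1 - (u t)\<^sup>2) / (1 + (u t)\<^sup>2) - A = ((1 - A) - (1 + A) * (u t)\<^sup>2) / (1 + (u t)\<^sup>2)"
        using p by (simp add: field_simps)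
      have "2 * (inverse x * (y / (2 * z))) = y / x / z" if "x \<noteq> 0" "z \<noteq> 0" for x y z :: real
        using that by (simp add: field_simps)
      from this[of "1 + (u t)\<^sup>2" "sqrt A"] show ?thesis
        using p A by (simp only: \<theta>_def cosu e) simp
    qed
    ultimately have "(\<theta> has_real_derivative (cos (\<theta> t) - A) / sqrt A) (at t)" by (simp only:)
    then show "(\<theta> has_real_derivative (cos (\<theta> t) - constA \<sigma>) / sqrt (constA \<sigma>)) (at t)"
      by (simp only: A_def)
    show "\<theta> (- t) = - \<theta> t" by (simp add: \<theta>_def u_def arctan_minus)
    assume t: "0 \<le> t"
    then have "0 \<le> u t" using \<alpha> b by (simp add: u_def)
    then show 0: "0 \<le> \<theta> t" by (simp add: \<theta>_def)
    have pi: "\<theta> t < pi" using arctan_ubound[of "u t"] by (simp add: \<theta>_def)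
    have "(1 + A) * (u t)\<^sup>2 < 1 - A" using u2[of t] \<alpha> A by (simp add: field_simps)
    then have "A < cos (\<theta> t)" using p by (simp add: \<theta>_def cosu field_simps)
    then have "arccos (cos (\<theta> t)) < arccos A" using A by (intro arccos_less_arccos) auto
    then show "\<theta> t < arccos (constA \<sigma>)" using 0 pi by (simp add: arccos_cos A_def)
  qed
qed

end

text \<open>The rest relies on these four properties and never on the explicit solution. Oddness
  centres the transition at the jump; together with the bound it keeps the profile on the arc
  between the two wells.\<close>

locale optimal_profile = anisotropy +
  fixes \<theta> :: "real \<Rightarrow> real"
  assumes ode: "\<And>t. (\<theta> has_real_derivative (cos (\<theta> t) - constA \<sigma>) / sqrt (constA \<sigma>)) (at t)"
    and odd: "\<And>t. \<theta> (- t) = - \<theta> t"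
    and nonneg: "\<And>t. 0 \<le> t \<Longrightarrow> 0 \<le> \<theta> t"
    and less: "\<And>t. 0 \<le> t \<Longrightarrow> \<theta> t < arccos (constA \<sigma>)"
begin

text \<open>At once the derivative of the profile and, by \<open>W_profile\<close>, the value of
  \<open>sqrt W\<close> on it.\<close>

definition speed :: "real \<Rightarrow> real" where
  "speed t = (cos (\<theta> t) - constA \<sigma>) / sqrt (constA \<sigma>)"

lemma profile_continuous: "continuous_on S \<theta>"
  using ode by (meson DERIV_isCont continuous_at_imp_continuous_on)

lemma speed_continuous: "continuous_on S speed"
  unfolding speed_def using constA_bounds by (intro continuous_intros profile_continuous) auto

lemma speed_abs: "speed \<bar>t\<bar> = speed t"
  by (cases "0 \<le> t") (auto simp: speed_def odd)

lemma profile_0: "\<theta> 0 = 0"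
  using odd[of 0] by simp

lemma speed_pos: "0 < speed t"
proof -
  have "0 < speed t" if "0 \<le> t" for t
  proof -
    have "cos (arccos (constA \<sigma>)) < cos (\<theta> t)"
      using nonneg[OF that] less[OF that] arccos_constA_bounds by (intro cos_monotone_0_pi) auto
    then show ?thesis using constA_bounds by (simp add: speed_def)
  qed
  from this[of "\<bar>t\<bar>"] show ?thesis by (simp add: speed_abs)
qed

lemma speed_antimono:
  assumes "0 \<le> s" "s \<le> t" shows "speed t \<le> speed s"
proof -
  have "\<theta> s \<le> \<theta> t"
  proof (rule DERIV_nonneg_imp_nondecreasing[OF assms(2)])
    fix x
    show "\<exists>y. (\<theta> has_real_derivative y) (at x) \<and> 0 \<le> y"
      using ode[of x] speed_pos[of x] unfolding speed_def by (intro exI conjI) auto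
  qed
  then have "cos (\<theta> t) \<le> cos (\<theta> s)"
    using assms nonneg[of s] less[of t] arccos_constA_bounds by (intro cos_monotone_0_pi_le) auto
  then show ?thesis using constA_bounds by (simp add: speed_def divide_right_mono)
qed

lemma speed_integral: "0 \<le> T \<Longrightarrow> (speed has_integral \<theta> T) {0..T}"
  using fundamental_theorem_of_calculus[of 0 T \<theta> speed] ode
  by (simp add: profile_0 speed_def has_real_derivative_iff_has_vector_derivative has_vector_derivative_at_within)

text \<open>\<open>speed\<close> is nonincreasing on the positive axis and its integral over
  \<open>{0..T}\<close> is \<open>\<theta> T \<le> pi\<close>, so
  \<open>T * speed T \<le> pi\<close>. This crude rate suffices for all error terms below.\<close>

lemma speed_le:
  assumes "0 < T" shows "speed T \<le> pi / T"
proof -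
  have "((\<lambda>t. speed T) has_integral speed T * T) {0..T}"
    using has_integral_const_real[of "speed T" 0 T] assms by (simp add: mult.commute)
  from has_integral_le[OF this speed_integral]
  have "speed T * T \<le> \<theta> T" using assms speed_antimono by simp
  also have "\<dots> \<le> pi" using less[of T] arccos_constA_bounds assms by simp
  finally show ?thesis using assms by (simp add: field_simps)
qed

lemma speed_tendsto: "(speed \<longlongrightarrow> 0) at_top"
proof (rule real_tendsto_sandwich)
  show "\<forall>\<^sub>F t in at_top. 0 \<le> speed t" using speed_pos by (intro always_eventually) (auto intro: less_imp_le)
  show "\<forall>\<^sub>F t in at_top. speed t \<le> pi / t"
    using eventually_gt_at_top[of 0] by eventually_elim (rule speed_le)
  show "((\<lambda>t. pi / t) \<longlongrightarrow> 0) at_top"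
    by (intro tendsto_divide_0[OF tendsto_const] filterlim_at_top_imp_at_infinity filterlim_ident)
qed simp

lemma cos_profile: "cos (\<theta> t) = constA \<sigma> + sqrt (constA \<sigma>) * speed t"
  using constA_bounds by (simp add: speed_def)

text \<open>\<open>cos (\<theta> t) - A\<close> is a multiple of \<open>speed t\<close> and so tends
  to 0; \<open>arccos\<close> recovers the angle, which stays between 0 and \<open>pi\<close> for
  \<open>t \<ge> 0\<close>.\<close>

lemma profile_tendsto: "(\<theta> \<longlongrightarrow> arccos (constA \<sigma>)) at_top"
proof -
  have "((\<lambda>t. constA \<sigma> + sqrt (constA \<sigma>) * speed t) \<longlongrightarrow> constA \<sigma> + sqrt (constA \<sigma>) * 0) at_top"
    by (intro tendsto_intros speed_tendsto)
  then have "((\<lambda>t. cos (\<theta> t)) \<longlongrightarrow> constA \<sigma>) at_top" by (simp add: cos_profile)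
  then have "((\<lambda>t. arccos (cos (\<theta> t))) \<longlongrightarrow> arccos (constA \<sigma>)) at_top"
    using constA_bounds by (intro isCont_tendsto_compose[OF isCont_arccos]) auto
  moreover have "\<forall>\<^sub>F t in at_top. arccos (cos (\<theta> t)) = \<theta> t"
    using eventually_ge_at_top[of 0]
  proof eventually_elim
    case (elim t)
    then show ?case using nonneg[of t] less[of t] arccos_constA_bounds by (intro arccos_cos) auto
  qed
  ultimately show ?thesis by (rule Lim_transform_eventually)
qed

text \<open>An antiderivative of \<open>speed\<close> squared, so its increments measure the energy
  of a layer. Its limit is half the transition cost, the other half coming from negative
  arguments.\<close>

definition tension :: "real \<Rightarrow> real" where
  "tension t = (sin (\<theta> t) - constA \<sigma> * \<theta> t) / sqrt (constA \<sigma>)"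

lemma tension_derivative: "(tension has_real_derivative (speed t)\<^sup>2) (at t)"
proof -
  have d: "((\<lambda>t. sin (\<theta> t) - constA \<sigma> * \<theta> t) has_real_derivative
      cos (\<theta> t) * speed t - constA \<sigma> * speed t) (at t)"
    using ode unfolding speed_def by (intro DERIV_diff DERIV_cmult DERIV_chain2[OF DERIV_sin]) auto
  have e: "(cos (\<theta> t) * speed t - constA \<sigma> * speed t) / sqrt (constA \<sigma>) = (speed t)\<^sup>2"
    by (simp only: left_diff_distrib[symmetric]) (simp add: speed_def power2_eq_square)
  from DERIV_cdivide[OF d, of "sqrt (constA \<sigma>)"] show ?thesis
    unfolding tension_def[abs_def] by (simp only: e)
qed

lemma tension_odd: "tension (- t) = - tension t"
  by (simp add: tension_def odd diff_divide_distrib)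

lemma tension_tendsto: "(tension \<longlongrightarrow> transition_cost / 2) at_top"
proof -
  have "((\<lambda>T. (sin (\<theta> T) - constA \<sigma> * \<theta> T) / sqrt (constA \<sigma>)) \<longlongrightarrow>
     (sin (arccos (constA \<sigma>)) - constA \<sigma> * arccos (constA \<sigma>)) / sqrt (constA \<sigma>)) at_top"
    using constA_bounds by (intro tendsto_intros profile_tendsto) auto
  moreover have "transition_cost / 2 = (nbar1 \<sigma> - constA \<sigma> * arccos (constA \<sigma>)) / sqrt (constA \<sigma>)"
  proof -
    have "2 * x / s / 2 = x / s" for x s :: real by simp
    then show ?thesis unfolding transition_cost_def .
  qed
  ultimately show ?thesis unfolding tension_def[abs_def] by (simp only: sin_arccos_constA)
qed

text \<open>The last estimate comes from \<open>nbar1^2 - sin^2 = cos^2 - A^2\<close>: factor both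
  sides, bound \<open>cos + A\<close> from above by 2 and \<open>nbar1 + sin\<close> from below by
  \<open>nbar1\<close>.\<close>

lemma sin_profile_bounds:
  assumes "0 \<le> t"
  shows "0 \<le> sin (\<theta> t)" "sin (\<theta> t) \<le> nbar1 \<sigma>"
    and "nbar1 \<sigma> - sin (\<theta> t) \<le> 2 * sqrt (constA \<sigma>) / nbar1 \<sigma> * speed t"
proof -
  define A where "A = constA \<sigma>"
  have A: "0 < A" "A < 1" using constA_bounds by (auto simp: A_def)
  show s0: "0 \<le> sin (\<theta> t)"
    using nonneg[OF assms] less[OF assms] arccos_constA_bounds by (intro sin_ge_zero) auto
  show s1: "sin (\<theta> t) \<le> nbar1 \<sigma>"
    unfolding sin_arccos_constA[symmetric]
    using nonneg[OF assms] less[OF assms] arccos_constA_bounds by (intro sin_monotone_2pi_le) auto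
  have "(nbar1 \<sigma> - sin (\<theta> t)) * (nbar1 \<sigma> + sin (\<theta> t)) = (cos (\<theta> t) - A) * (cos (\<theta> t) + A)"
    using nbar1_bounds sin_cos_squared_add[of "\<theta> t"] by (simp add: A_def algebra_simps power2_eq_square)
  also have "\<dots> \<le> (cos (\<theta> t) - A) * 2"
    using speed_pos[of t] A add_mono[OF cos_le_one[of "\<theta> t"], of A 1]
    by (intro mult_left_mono) (auto simp: speed_def A_def[symmetric] zero_less_divide_iff)
  also have "\<dots> = 2 * sqrt A * speed t" using A by (simp add: speed_def A_def[symmetric])
  finally have "(nbar1 \<sigma> - sin (\<theta> t)) * nbar1 \<sigma> \<le> 2 * sqrt A * speed t"
    using mult_left_mono[of "nbar1 \<sigma>" "nbar1 \<sigma> + sin (\<theta> t)" "nbar1 \<sigma> - sin (\<theta> t)"] s0 s1 by simp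
  then show "nbar1 \<sigma> - sin (\<theta> t) \<le> 2 * sqrt (constA \<sigma>) / nbar1 \<sigma> * speed t"
    using nbar1_bounds(1) by (simp add: A_def field_simps)
qed

lemma W_profile:
  "W \<sigma> (vector [x, 0, cos (\<theta> t)]) = (speed t)\<^sup>2"
  using constA_bounds by (simp add: W_def speed_def power_divide)

end

section \<open>The essential boundary of a periodic set\<close>

lemma finite_separation:
  fixes c d :: real
  assumes "finite K" "K \<subseteq> {c<..<d}"
  obtains r where "0 < r" "\<And>b. b \<in> K \<Longrightarrow> c \<le> b - 2 * r \<and> b + 2 * r \<le> d"
    and "\<And>b b'. b \<in> K \<Longrightarrow> b' \<in> K \<Longrightarrow> b \<noteq> b' \<Longrightarrow> 2 * r \<le> \<bar>b - b'\<bar>"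
proof -
  define S where "S = (\<lambda>(x, y). \<bar>x - y\<bar>) ` {(x, y). x \<in> insert c (insert d K) \<and> y \<in> insert c (insert d K) \<and> x \<noteq> y}"
  have "{(x, y). x \<in> insert c (insert d K) \<and> y \<in> insert c (insert d K) \<and> x \<noteq> y}
      \<subseteq> insert c (insert d K) \<times> insert c (insert d K)" by auto
  then have fin: "finite S" unfolding S_def using assms(1) by (meson finite_imageI finite_SigmaI finite_insert finite_subset)
  have pos: "\<And>s. s \<in> S \<Longrightarrow> 0 < s" by (auto simp: S_def)
  \<comment> \<open>At most half of every gap between points of \<open>K\<close> and the ends
    \<open>c\<close>, \<open>d\<close>; the inserted 1 keeps \<open>Min\<close> meaningful for empty
    \<open>S\<close>.\<close>
  define r where "r = Min (insert 1 S) / 2"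
  have rS: "2 * r \<le> s" if "s \<in> S" for s using that fin by (simp add: r_def)
  show ?thesis
  proof
    show "0 < r" using fin pos by (simp add: r_def)
    fix b assume b: "b \<in> K"
    then have "c < b" "b < d" using assms(2) by auto
    then have "\<bar>b - c\<bar> \<in> S" "\<bar>d - b\<bar> \<in> S" using b unfolding S_def by force+
    then show "c \<le> b - 2 * r \<and> b + 2 * r \<le> d" using rS \<open>c < b\<close> \<open>b < d\<close> by force
    fix b' assume "b' \<in> K" "b \<noteq> b'"
    then have "\<bar>b - b'\<bar> \<in> S" using b unfolding S_def by force
    then show "2 * r \<le> \<bar>b - b'\<bar>" by (rule rS)
  qed
qed

lemma set_integrable_bounded:
  fixes f :: "real \<Rightarrow> real"
  assumes "f \<in> borel_measurable borel" "\<And>x. x \<in> {a..b} \<Longrightarrow> \<bar>f x\<bar> \<le> M" "A \<in> sets borel" "A \<subseteq> {a..b}"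
  shows "set_integrable lborel A f"
  unfolding set_integrable_def
proof (rule Bochner_Integration.integrable_bound)
  show "integrable lborel (\<lambda>x. indicator {a..b} x *\<^sub>R \<bar>M\<bar>)"
    using borel_integrable_atLeastAtMost'[of a b "\<lambda>_. \<bar>M\<bar>"] by (simp add: set_integrable_def)
  show "AE x in lborel. norm (indicator A x *\<^sub>R f x) \<le> norm (indicator {a..b} x *\<^sub>R \<bar>M\<bar>)"
    using assms(2,4) by (intro AE_I2) (force simp: indicator_def)
  show "(\<lambda>x. indicator A x *\<^sub>R f x) \<in> borel_measurable lborel"
    using assms(1,3) by simp
qed

text \<open>A jump may sit at the cut \<open>-l\<close>. Moving the window to a point
  \<open>c\<close> off the jumps brings all layers into its interior.\<close>

lemma integral_circ_shift:
  fixes f :: "real \<Rightarrow> real"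
  assumes l: "0 < l" and f: "f \<in> borel_measurable borel" and M: "\<And>x. \<bar>f x\<bar> \<le> M"
    and per: "\<And>x. f (x + 2 * l) = f x" and c: "-l \<le> c" "c \<le> l"
  shows "(LINT x|circ l. f x) = (LINT x:{c..<c + 2 * l}|lborel. f x)"
proof -
  have si: "set_integrable lborel {p..<q} f" for p q
    by (rule set_integrable_bounded[OF f M, of "{p..<q}" p q]) auto
  have split: "(LINT x:{p..<q}|lborel. f x) = (LINT x:{p..<m}|lborel. f x) + (LINT x:{m..<q}|lborel. f x)"
    if "p \<le> m" "m \<le> q" for p m q
  proof -
    have "{p..<q} = {p..<m} \<union> {m..<q}" using that by auto
    then show ?thesis using set_integral_Un[of "{p..<m}" "{m..<q}" lborel f] si by auto
  qed
  have "(LINT x:{l..<c + 2 * l}|lborel. f x) = (LINT x|lborel. indicator {l..<c + 2 * l} x * f x)"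
    by (simp add: set_lebesgue_integral_def)
  also have "\<dots> = (LINT x|lborel. indicator {l..<c + 2 * l} (2 * l + x) * f (2 * l + x))"
    using lborel_integral_real_affine[of 1 "\<lambda>x. indicator {l..<c + 2 * l} x * f x" "2 * l"] by simp
  also have "\<dots> = (LINT x:{-l..<c}|lborel. f x)"
    unfolding set_lebesgue_integral_def
    by (rule Bochner_Integration.integral_cong) (auto simp: indicator_def add.commute per)
  finally show ?thesis
    using split[of "-l" c l] split[of c l "c + 2 * l"] c l by (simp add: integral_circ_eq)
qed

section \<open>Interior and boundary of a set up to null sets\<close>

definition ess_interior :: "real set \<Rightarrow> real set" where
  "ess_interior E = {x. \<exists>r>0. AE y in lborel. y \<in> ball x r \<longrightarrow> y \<in> E}"

text \<open>Points all of whose neighbourhoods meet both \<open>E\<close> and its complement in sets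
  that are not null. Altering \<open>E\<close> on a null set leaves this set unchanged, in contrast
  to the topological boundary.\<close>

definition ess_boundary :: "real set \<Rightarrow> real set" where
  "ess_boundary E = - (ess_interior E \<union> ess_interior (- E))"

lemma open_ess_interior: "open (ess_interior E)"
  unfolding open_dist
proof
  fix x assume "x \<in> ess_interior E"
  then obtain r where r: "r > 0" "AE y in lborel. y \<in> ball x r \<longrightarrow> y \<in> E" by (auto simp: ess_interior_def)
  have "z \<in> ess_interior E" if "dist z x < r" for z
  proof -
    have "AE y in lborel. y \<in> ball z (r - dist z x) \<longrightarrow> y \<in> E"
      using r(2)
    proof eventually_elim
      case (elim y)
      have "dist x y \<le> dist z x + dist z y" by (rule dist_triangle3)
      then show ?case using elim by auto
    qed
    then show ?thesis using that by (auto simp: ess_interior_def intro!: exI[of _ "r - dist z x"])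
  qed
  then show "\<exists>e>0. \<forall>y. dist y x < e \<longrightarrow> y \<in> ess_interior E" using r(1) by blast
qed

text \<open>Every point brings its own exceptional null set; Lindelof's theorem leaves only
  countably many of them.\<close>

lemma AE_ess_interior: "AE x in lborel. x \<in> ess_interior E \<longrightarrow> x \<in> E"
proof -
  define F where "F = {ball x r | x r. AE y in lborel. y \<in> ball x r \<longrightarrow> y \<in> E}"
  have "\<And>S. S \<in> F \<Longrightarrow> open S" by (auto simp: F_def)
  then obtain F' where F': "F' \<subseteq> F" "countable F'" "\<Union>F' = \<Union>F" by (rule Lindelof) blast+
  have "AE y in lborel. \<forall>S\<in>F'. y \<in> S \<longrightarrow> y \<in> E"
    unfolding AE_ball_countable[OF F'(2)] using F'(1) by (auto simp: F_def)
  then show ?thesis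
  proof eventually_elim
    case (elim y)
    show ?case
    proof
      assume "y \<in> ess_interior E"
      then have "y \<in> \<Union>F" by (auto simp: ess_interior_def F_def) (metis (lifting) centre_in_ball)
      then show "y \<in> E" using elim F'(3) by blast
    qed
  qed
qed

lemma ess_interior_disjoint: "ess_interior E \<inter> ess_interior (- E) = {}"
proof (rule ccontr)
  assume "\<not> ?thesis"
  then obtain x r s where rs: "r > 0" "AE y in lborel. y \<in> ball x r \<longrightarrow> y \<in> E"
      "s > 0" "AE y in lborel. y \<in> ball x s \<longrightarrow> y \<in> - E"
    by (auto simp: ess_interior_def)
  have "AE y in lborel. y \<notin> ball x (min r s)"
    using rs(2,4) by eventually_elim auto
  then have "emeasure lborel (ball x (min r s)) = 0"
    by (subst (asm) AE_iff_measurable[OF _ refl]) (auto simp: ball_def)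
  moreover have "emeasure lborel (ball x (min r s)) = ennreal (2 * min r s)"
  proof -
    have "ball x (min r s) = {x - min r s<..<x + min r s}" by (simp add: ball_eq_greaterThanLessThan)
    then show ?thesis using rs by (simp only: emeasure_lborel_Ioo) (simp add: min_def)
  qed
  ultimately show False using rs by (simp add: ennreal_eq_0_iff)
qed

lemma AE_lborel_translate:
  assumes "AE y::real in lborel. P y" shows "AE y in lborel. P (t + y)"
proof -
  from assms obtain N where N: "{y. \<not> P y} \<subseteq> N" "N \<in> null_sets lborel" by (auto simp: eventually_ae_filter)
  have "emeasure lborel ((+) t -` N \<inter> space lborel) = emeasure (distr lborel borel ((+) t)) N"
    using N(2) by (subst emeasure_distr) auto
  then have "(+) t -` N \<in> null_sets lborel"
    using N(2) measurable_sets_borel[of "(+) t" borel N] by (auto simp: lborel_distr_plus null_sets_def)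
  then show ?thesis by (rule AE_I') (use N(1) in auto)
qed

lemma ess_interior_translate:
  assumes "\<And>x. t + x \<in> E \<longleftrightarrow> x \<in> E"
  shows "t + x \<in> ess_interior E \<longleftrightarrow> x \<in> ess_interior E"
proof -
  have 1: "s + x \<in> ess_interior E" if "\<And>x. s + x \<in> E \<longleftrightarrow> x \<in> E" "x \<in> ess_interior E" for s x
  proof -
    from that(2) obtain r where r: "r > 0" "AE y in lborel. y \<in> ball x r \<longrightarrow> y \<in> E" by (auto simp: ess_interior_def)
    have "AE y in lborel. y \<in> ball (s + x) r \<longrightarrow> y \<in> E"
      using AE_lborel_translate[OF r(2), of "- s"]
    proof eventually_elim
      case (elim y)
      then show ?case using that(1)[of "- s + y"] by (simp add: dist_real_def algebra_simps)
    qed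
    then show ?thesis using r(1) by (auto simp: ess_interior_def)
  qed
  have "- t + y \<in> E \<longleftrightarrow> y \<in> E" for y using assms[of "- t + y"] by simp
  from 1[OF this, of "t + x"] 1[of t x, OF assms] show ?thesis by auto
qed

lemma ess_boundary_translate:
  assumes "\<And>x. t + x \<in> E \<longleftrightarrow> x \<in> E"
  shows "t + x \<in> ess_boundary E \<longleftrightarrow> x \<in> ess_boundary E"
  using ess_interior_translate[of t E x] ess_interior_translate[of t "- E" x] assms
  by (simp add: ess_boundary_def)

text \<open>A weak form of the Lebesgue density theorem, obtained by covering \<open>E\<close> almost optimally
  by intervals.\<close>

lemma density_interval:
  assumes E: "E \<in> sets borel" and x: "x \<notin> ess_interior (- E)" and r: "0 < r" and \<eta>: "0 < \<eta>"
  obtains a h where "0 < h" "x - r < a - h" "a + h < x + r" "measure lborel ({a-h..a+h} - E) \<le> \<eta> * (2 * h)"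
proof -
  note found = that
  \<comment> \<open>Half the radius leaves room for the strict inequalities of the conclusion.
    \<open>S\<close> has positive measure, since otherwise \<open>- E\<close> would have full
    measure in \<open>ball x (r / 2)\<close>.\<close>
  define p q where "p = x - r / 2" and "q = x + r / 2"
  define S where "S = E \<inter> {p..q}"
  have Sm: "S \<in> sets borel" using E by (simp add: S_def)
  have S: "S \<in> lmeasurable"
    by (rule bounded_set_imp_lmeasurable) (use Sm in \<open>auto simp: S_def intro: bounded_subset[of "{p..q}"]\<close>)
  have pos: "0 < measure lebesgue S"
  proof (rule ccontr)
    assume "\<not> 0 < measure lebesgue S"
    then have "measure lebesgue S = 0" using zero_less_measure_iff by blast
    then have "emeasure lebesgue S = 0" using S by (simp add: emeasure_eq_measure2 fmeasurableD2)
    then have "emeasure lborel S = 0" using Sm by (simp add: emeasure_completion main_part_sets)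
    then have "S \<in> null_sets lborel" using Sm by auto
    then have "AE y in lborel. y \<in> ball x (r/2) \<longrightarrow> y \<in> - E"
      by (rule AE_I') (auto simp: S_def p_def q_def dist_real_def abs_if split: if_splits)
    moreover have "0 < r / 2" using r by simp
    ultimately show False using x unfolding ess_interior_def by blast
  qed
  show ?thesis
  proof (rule ccontr)
    assume neg: "\<not> thesis"
    \<comment> \<open>By assumption every subinterval misses \<open>E\<close> in at least this
      fraction; the cap at 1 keeps \<open>1 - \<kappa>\<close> nonnegative for the computation in
      \<open>ennreal\<close>.\<close>
    define \<kappa> where "\<kappa> = min \<eta> 1"
    have \<kappa>: "0 < \<kappa>" "\<kappa> \<le> 1" "\<kappa> \<le> \<eta>" using \<eta> by (auto simp: \<kappa>_def)
    have bad: "measure lebesgue ({u..v} \<inter> S) \<le> (1 - \<kappa>) * (v - u)" if uv: "u < v" "p \<le> u" "v \<le> q" for u v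
    proof -
      define a h where "a = (u + v) / 2" and "h = (v - u) / 2"
      have ah: "a - h = u" "a + h = v" "0 < h" using uv by (auto simp: a_def h_def field_simps)
      have big: "\<not> measure lborel ({u..v} - E) \<le> \<eta> * (v - u)"
      proof
        assume m: "measure lborel ({u..v} - E) \<le> \<eta> * (v - u)"
        have "measure lborel ({a-h..a+h} - E) \<le> \<eta> * (2 * h)"
        proof -
          have "2 * h = v - u" by (simp add: h_def)
          then show ?thesis using m by (simp only: ah)
        qed
        moreover have "x - r < a - h" "a + h < x + r" unfolding ah using uv r by (auto simp: p_def q_def)
        ultimately show False using found[OF ah(3)] neg by blast
      qed
      have 1: "\<kappa> * (v - u) \<le> measure lborel ({u..v} - E)"
      proof -
        have "\<kappa> * (v - u) \<le> \<eta> * (v - u)" using \<kappa> uv by (intro mult_right_mono) auto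
        with big show ?thesis by linarith
      qed
      have "{u..v} \<inter> S = {u..v} \<inter> E" using uv by (auto simp: S_def)
      then have "measure lebesgue ({u..v} \<inter> S) = measure lborel ({u..v} \<inter> E)"
        using E by (simp add: measure_completion)
      moreover have "measure lborel ({u..v} \<inter> E) = measure lborel {u..v} - measure lborel ({u..v} - E)"
        using E uv measure_Diff[of lborel "{u..v}" "{u..v} - E"]
        by (simp add: Diff_Diff_Int)
      ultimately show ?thesis using 1 uv by (simp add: left_diff_distrib)
    qed
    \<comment> \<open>Summing \<open>bad\<close> over a cover with excess \<open>e\<close> will give
      \<open>|S| \<le> (1 - \<kappa>) * (|S| + e)\<close>, hence
      \<open>\<kappa> * |S| \<le> e\<close>, which is absurd for this \<open>e\<close>.\<close>
    define e where "e = \<kappa> * measure lebesgue S / 2"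
    have e: "0 < e" using pos \<kappa> by (simp add: e_def)
    have sub: "S \<subseteq> cbox p q" by (auto simp: S_def)
    obtain D where D: "countable D"
      "\<And>K. K \<in> D \<Longrightarrow> K \<subseteq> cbox p q \<and> K \<noteq> {} \<and> (\<exists>c d. K = cbox c d)"
      "pairwise (\<lambda>A B. interior A \<inter> interior B = {}) D"
      "S \<subseteq> \<Union>D" "\<Union>D \<in> lmeasurable" "measure lebesgue (\<Union>D) \<le> measure lebesgue S + e"
      by (rule measurable_outer_intervals_bounded[OF S sub e]) blast
    have Dm: "K \<in> sets borel" if "K \<in> D" for K using D(2)[OF that] by auto
    have DU: "\<Union>D \<in> sets borel" using D(1) Dm by (intro sets.countable_Union) auto
    \<comment> \<open>The intervals of the cover may share end points. Their interiors are disjoint,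
      and only countably many points are lost.\<close>
    define U where "U = (\<Union>K\<in>D. interior K)"
    have Um: "U \<in> sets borel" unfolding U_def by (intro borel_open open_UN) auto
    have UD: "U \<subseteq> \<Union>D" unfolding U_def using interior_subset by blast
    have null: "\<Union>D - U \<in> null_sets lborel"
    proof (rule null_sets_subset)
      show "(\<Union>K\<in>D. K - interior K) \<in> null_sets lborel"
      proof (rule null_sets_UN'[OF D(1)])
        fix K assume "K \<in> D"
        then obtain u v where K: "K = {u..v}" "u \<le> v" using D(2) by force
        have "K - interior K \<subseteq> {u, v}" by (auto simp: K)
        moreover have "{u, v} \<in> null_sets lborel"
          using finite_imp_null_set_lborel[of "{u, v}"] by simp
        ultimately show "K - interior K \<in> null_sets lborel"
          by (rule null_sets_subset[rotated 2]) (simp add: K)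
      qed
      show "\<Union>D - U \<in> sets lborel" using DU Um by simp
      show "\<Union>D - U \<subseteq> (\<Union>K\<in>D. K - interior K)" unfolding U_def by auto
    qed
    have disj: "disjoint_family_on interior D"
      using D(3) by (auto simp: disjoint_family_on_def pairwise_def)
    have disj': "disjoint_family_on (\<lambda>K. S \<inter> interior K) D"
      using disj by (auto simp: disjoint_family_on_def)
    have "emeasure lborel S \<le> emeasure lborel (S \<inter> U \<union> (\<Union>D - U))"
      using D(4) Sm Um DU by (intro emeasure_mono) auto
    also have "\<dots> = emeasure lborel (S \<inter> U)"
      using Sm Um by (intro emeasure_Un_null_set null) auto
    also have "S \<inter> U = (\<Union>K\<in>D. S \<inter> interior K)" by (auto simp: U_def)
    also have "emeasure lborel \<dots> = (\<integral>\<^sup>+K. emeasure lborel (S \<inter> interior K) \<partial>count_space D)"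
      using Sm by (intro emeasure_UN_countable D(1) disj') auto
    also have "\<dots> \<le> (\<integral>\<^sup>+K. ennreal (1 - \<kappa>) * emeasure lborel (interior K) \<partial>count_space D)"
    proof (rule nn_integral_mono)
      fix K assume "K \<in> space (count_space D)"
      then obtain u v where K: "K = {u..v}" "u \<le> v" "p \<le> u" "v \<le> q" using D(2) by force
      show "emeasure lborel (S \<inter> interior K) \<le> ennreal (1 - \<kappa>) * emeasure lborel (interior K)"
      proof (cases "u < v")
        case True
        have "emeasure lborel (S \<inter> interior K) \<le> emeasure lborel (K \<inter> S)"
          using interior_subset Sm by (intro emeasure_mono) (auto simp: K)
        also have "\<dots> = ennreal (measure lborel (K \<inter> S))"
        proof (rule emeasure_eq_ennreal_measure)
          have "emeasure lborel (K \<inter> S) \<le> emeasure lborel {u..v}" by (intro emeasure_mono) (auto simp: K)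
          also have "\<dots> < top" by (simp add: K)
          finally show "emeasure lborel (K \<inter> S) \<noteq> top" by simp
        qed
        also have "\<dots> = ennreal (measure lebesgue (K \<inter> S))" using Sm by (simp add: K measure_completion)
        also have "\<dots> \<le> ennreal ((1 - \<kappa>) * (v - u))" using bad[of u v] True K by (intro ennreal_leI) auto
        also have "\<dots> = ennreal (1 - \<kappa>) * emeasure lborel (interior K)"
          using K \<kappa> by (simp add: ennreal_mult)
        finally show ?thesis .
      qed (use K in auto)
    qed
    also have "\<dots> = ennreal (1 - \<kappa>) * (\<integral>\<^sup>+K. emeasure lborel (interior K) \<partial>count_space D)"
      by (rule nn_integral_cmult) simp
    also have "(\<integral>\<^sup>+K. emeasure lborel (interior K) \<partial>count_space D) = emeasure lborel U"
      unfolding U_def by (intro emeasure_UN_countable[symmetric] D(1) disj) auto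
    also have "emeasure lborel U \<le> emeasure lborel (\<Union>D)"
      using UD DU by (intro emeasure_mono) auto
    also have "emeasure lborel (\<Union>D) = emeasure lebesgue (\<Union>D)" using DU by simp
    also have "\<dots> \<le> ennreal (measure lebesgue S + e)"
      using D(5,6) by (simp add: emeasure_eq_measure2 ennreal_leI)
    finally have "emeasure lborel S \<le> ennreal (1 - \<kappa>) * ennreal (measure lebesgue S + e)"
      by (simp add: mult_left_mono)
    moreover have "emeasure lborel S = ennreal (measure lebesgue S)"
    proof -
      have "emeasure lborel S = emeasure lebesgue S" using Sm by simp
      also have "\<dots> = ennreal (measure lebesgue S)" using S by (rule emeasure_eq_measure2)
      finally show ?thesis .
    qed
    ultimately have le: "measure lebesgue S \<le> (1 - \<kappa>) * (measure lebesgue S + e)"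
    proof -
      assume "emeasure lborel S \<le> ennreal (1 - \<kappa>) * ennreal (measure lebesgue S + e)"
        and "emeasure lborel S = ennreal (measure lebesgue S)"
      then have "ennreal (measure lebesgue S) \<le> ennreal ((1 - \<kappa>) * (measure lebesgue S + e))"
        using \<kappa> by (simp only: ennreal_mult' diff_ge_0_iff_ge)
      moreover have "0 \<le> (1 - \<kappa>) * (measure lebesgue S + e)" using \<kappa> e pos by (intro mult_nonneg_nonneg) auto
      ultimately show ?thesis by (simp only: ennreal_le_iff)
    qed
    have "(1 - \<kappa>) * e \<le> e" using \<kappa> e by simp
    then have "measure lebesgue S \<le> measure lebesgue S - \<kappa> * measure lebesgue S + e"
      using le by (simp add: algebra_simps)
    then show False using mult_pos_pos[OF \<kappa>(1) pos] by (simp add: e_def)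
  qed
qed

section \<open>Test functions that count boundary points\<close>

lemma per_C1_extend:
  assumes l: "0 < l" and pq: "c < p" "p \<le> q" "q < c + 2 * l"
    and f: "\<And>x. (f has_real_derivative f' x) (at x)" "continuous_on UNIV f'"
    and supp: "\<And>x. x \<notin> {p..q} \<Longrightarrow> f x = 0 \<and> f' x = 0"
  obtains \<phi> \<phi>' where "per_C1 l \<phi> \<phi>'" "\<And>x. x \<in> {c..<c + 2 * l} \<Longrightarrow> \<phi> x = f x \<and> \<phi>' x = f' x"
    and "\<And>x. \<exists>y. \<phi> x = f y"
proof -
  \<comment> \<open>\<open>x - s x\<close> is the representative of \<open>x\<close> in the window
    \<open>{c..<c + 2 * l}\<close>.\<close>
  define s where "s x = 2 * l * of_int \<lfloor>(x - c) / (2 * l)\<rfloor>" for x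
  have s_eq: "s y = 2 * l * of_int m" if "c + 2 * l * of_int m \<le> y" "y < c + 2 * l * of_int m + 2 * l" for y m
  proof -
    have "\<lfloor>(y - c) / (2 * l)\<rfloor> = m"
      using that l by (intro floor_unique) (simp_all add: field_simps)
    then show ?thesis by (simp add: s_def)
  qed
  have s_bounds: "c + s x \<le> x" "x < c + s x + 2 * l" for x
  proof -
    have "of_int \<lfloor>(x - c) / (2 * l)\<rfloor> \<le> (x - c) / (2 * l)" "(x - c) / (2 * l) < of_int \<lfloor>(x - c) / (2 * l)\<rfloor> + 1"
      by linarith+
    then have "of_int \<lfloor>(x - c) / (2 * l)\<rfloor> * (2 * l) \<le> x - c" "x - c < (of_int \<lfloor>(x - c) / (2 * l)\<rfloor> + 1) * (2 * l)"
      using l by (simp_all only: pos_le_divide_eq pos_divide_less_eq zero_less_mult_iff zero_less_numeral simp_thms)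
    then show "c + s x \<le> x" "x < c + s x + 2 * l"
      by (simp_all add: s_def algebra_simps)
  qed
  define \<phi> \<phi>' where "\<phi> x = f (x - s x)" and "\<phi>' x = f' (x - s x)" for x
  \<comment> \<open>The formula with the fixed shift \<open>s x\<close> stays valid some way to the
    left of its window, because \<open>f\<close> and its neighbouring translate both vanish there.
    Every point thus has a neighbourhood on which \<open>\<phi>\<close> is a single translate of
    \<open>f\<close>.\<close>
  have loc: "\<phi> y = f (y - s x) \<and> \<phi>' y = f' (y - s x)" if y: "s x - 2 * l + q < y" "y < c + s x + 2 * l" for x y
  proof (cases "c + s x \<le> y")
    case True
    then have "s y = s x" using y s_eq[of "\<lfloor>(x - c) / (2 * l)\<rfloor>" y] by (simp add: s_def)
    then show ?thesis by (simp add: \<phi>_def \<phi>'_def)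
  next
    case False
    then have "s y = s x - 2 * l"
      using y pq s_eq[of "\<lfloor>(x - c) / (2 * l)\<rfloor> - 1" y] by (simp add: s_def algebra_simps)
    then have "y - s y \<notin> {p..q}" "y - s x \<notin> {p..q}" using y False pq by auto
    from supp[OF this(1)] supp[OF this(2)] show ?thesis by (simp add: \<phi>_def \<phi>'_def)
  qed
  have ev: "\<forall>\<^sub>F y in nhds x. \<phi> y = f (y - s x) \<and> \<phi>' y = f' (y - s x)" for x
    using s_bounds[of x] pq
    by (intro eventually_mono[OF eventually_nhds_in_open[of "{s x - 2 * l + q<..<c + s x + 2 * l}"]])
       (auto intro!: loc)
  have "per_C1 l \<phi> \<phi>'"
    unfolding per_C1_def
  proof (intro conjI allI)
    fix x
    have "s (x + 2 * l) = s x + 2 * l"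
      using s_bounds[of x] s_eq[of "\<lfloor>(x - c) / (2 * l)\<rfloor> + 1" "x + 2 * l"] by (simp add: s_def algebra_simps)
    then show "\<phi> (x + 2 * l) = \<phi> x" by (simp add: \<phi>_def)
    have d: "((\<lambda>y. f (y + - s x)) has_real_derivative f' (x + - s x)) (at x)"
      using f(1)[of "x + - s x"] by (simp only: DERIV_shift)
    have e: "\<forall>\<^sub>F y in nhds x. \<phi> y = f (y + - s x)"
      by (rule eventually_mono[OF ev[of x]]) simp
    have "\<phi>' x = f' (x + - s x)" by (simp add: \<phi>'_def)
    with d show "(\<phi> has_real_derivative \<phi>' x) (at x)"
      by (simp only: DERIV_cong_ev[OF refl e refl])
  next
    have "isCont \<phi>' x" for x
    proof -
      have "isCont f' (x - s x)" using f(2) by (simp add: continuous_on_eq_continuous_at)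
      then have "isCont (\<lambda>y. f' (y - s x)) x"
        by (rule isCont_o2[rotated]) (intro continuous_intros)
      moreover have "\<forall>\<^sub>F y in nhds x. \<phi>' y = f' (y - s x)"
        by (rule eventually_mono[OF ev[of x]]) simp
      ultimately show ?thesis by (simp only: isCont_cong)
    qed
    then show "continuous_on UNIV \<phi>'" by (simp add: continuous_on_eq_continuous_at)
  qed
  moreover have "\<phi> x = f x \<and> \<phi>' x = f' x" if "x \<in> {c..<c + 2 * l}" for x
    using s_eq[of 0 x] that by (simp add: \<phi>_def \<phi>'_def)
  moreover have "\<exists>y. \<phi> x = f y" for x by (auto simp: \<phi>_def)
  ultimately show ?thesis by (rule that)
qed

text \<open>The antiderivative of the tent \<open>hat\<close>, written as a second difference of
  squared positive parts; it climbs from 0 at -1 to 1 at 1.\<close>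

definition smooth_step :: "real \<Rightarrow> real" where
  "smooth_step s = ((max 0 (s + 1))\<^sup>2 - 2 * (max 0 s)\<^sup>2 + (max 0 (s - 1))\<^sup>2) / 2"

definition hat :: "real \<Rightarrow> real" where
  "hat s = max 0 (s + 1) - 2 * max 0 s + max 0 (s - 1)"

lemma smooth_step_derivative: "(smooth_step has_real_derivative hat s) (at s)"
proof -
  have 1: "((\<lambda>s. (max 0 (s + 1))\<^sup>2) has_real_derivative 2 * max 0 (s + 1)) (at s)"
    using max0_sq_derivative[of "s + 1"] by (simp only: DERIV_shift)
  have 2: "((\<lambda>s. (max 0 (s + - 1))\<^sup>2) has_real_derivative 2 * max 0 (s + - 1)) (at s)"
    using max0_sq_derivative[of "s + - 1"] by (simp only: DERIV_shift)
  have "((\<lambda>s. ((max 0 (s + 1))\<^sup>2 - 2 * (max 0 s)\<^sup>2 + (max 0 (s + - 1))\<^sup>2) / 2) has_real_derivative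
      (2 * max 0 (s + 1) - 2 * (2 * max 0 s) + 2 * max 0 (s + - 1)) / 2) (at s)"
    by (intro DERIV_cdivide DERIV_add DERIV_diff DERIV_cmult 1 2 max0_sq_derivative)
  moreover have "(2 * max 0 (s + 1) - 2 * (2 * max 0 s) + 2 * max 0 (s + - 1)) / 2 = hat s"
    by (simp add: hat_def)
  ultimately show ?thesis by (simp add: smooth_step_def[abs_def])
qed

lemma continuous_hat: "continuous_on S hat"
  unfolding hat_def by (intro continuous_intros)

lemma smooth_step_low: "s \<le> -1 \<Longrightarrow> smooth_step s = 0"
  by (simp add: smooth_step_def)

lemma smooth_step_high: "1 \<le> s \<Longrightarrow> smooth_step s = 1"
  by (simp add: smooth_step_def power2_eq_square algebra_simps)

lemma hat_outside: "1 \<le> \<bar>s\<bar> \<Longrightarrow> hat s = 0"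
  by (auto simp: hat_def max_def)

lemma hat_bounds: "0 \<le> hat s" "hat s \<le> 1"
  by (auto simp: hat_def max_def)

lemma smooth_step_mono: "s \<le> t \<Longrightarrow> smooth_step s \<le> smooth_step t"
  by (erule DERIV_nonneg_imp_nondecreasing) (use smooth_step_derivative hat_bounds in blast)

lemma smooth_step_bounds: "0 \<le> smooth_step s" "smooth_step s \<le> 1"
  using smooth_step_mono[of "min s (-1)" s] smooth_step_mono[of s "max s 1"]
    smooth_step_low[of "min s (-1)"] smooth_step_high[of "max s 1"] by auto

definition bump :: "real \<Rightarrow> real \<Rightarrow> real \<Rightarrow> real" where
  "bump a h x = hat ((x - a) / h) / h"

lemma smooth_step_scaled_derivative:
  assumes "0 < h"
  shows "((\<lambda>x. smooth_step ((x - a) / h)) has_real_derivative bump a h x) (at x)"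
proof -
  have "((\<lambda>x. (x - a) / h) has_real_derivative 1 / h) (at x)"
    using assms by (auto intro!: derivative_eq_intros)
  from DERIV_chain2[OF smooth_step_derivative this] show ?thesis by (simp add: bump_def)
qed

lemma continuous_bump: "continuous_on S (bump a h)" if "h \<noteq> 0"
  unfolding bump_def[abs_def] using that by (intro continuous_intros continuous_on_compose2[OF continuous_hat[of UNIV]]) auto

text \<open>The bump has mass 1, is at most \<open>1 / h\<close> and lives on
  \<open>{a-h..a+h}\<close>. Its mass on \<open>F\<close> is thus at most twice the fraction of that
  interval occupied by \<open>F\<close>.\<close>

lemma bump_mass:
  assumes h: "0 < h" "c \<le> a - h" "a + h \<le> d" and F: "F \<in> sets borel"
  shows "set_integrable lborel {c..<d} (\<lambda>x. indicator F x * bump a h x)"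
    and "(LINT x:{c..<d}|lborel. bump a h x) = 1"
    and "(LINT x:{c..<d}|lborel. indicator F x * bump a h x)
      \<le> measure lborel ({a-h..a+h} \<inter> F) / h"
proof -
  let ?g = "\<lambda>x. bump a h x"
  have gm: "?g \<in> borel_measurable borel"
    using h by (intro borel_measurable_continuous_onI continuous_bump) auto
  have gb: "0 \<le> ?g x" "?g x \<le> 1 / h" for x using hat_bounds h by (auto simp: bump_def intro: divide_right_mono)
  have g0: "?g x = 0" if "x \<notin> {a-h..a+h}" for x
  proof -
    have "1 \<le> \<bar>(x - a) / h\<bar>" using that h by (auto simp: abs_if field_simps)
    then show ?thesis using hat_outside by (simp add: bump_def)
  qed
  show si: "set_integrable lborel {c..<d} (\<lambda>x. indicator F x * ?g x)"
  proof (rule set_integrable_bounded[of _ c d "1 / h"])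
    show "\<bar>indicator F x * ?g x\<bar> \<le> 1 / h" for x
      using gb[of x] h by (auto simp: indicator_def)
    show "(\<lambda>x. indicator F x * ?g x) \<in> borel_measurable borel"
      using F by (intro borel_measurable_times borel_measurable_indicator gm) simp
  qed auto
  have "(?g has_integral (smooth_step ((d - a) / h) - smooth_step ((c - a) / h))) {c..d}"
    using h smooth_step_scaled_derivative[OF h(1)]
    by (intro fundamental_theorem_of_calculus)
       (auto simp: has_real_derivative_iff_has_vector_derivative[symmetric] intro: has_field_derivative_at_within)
  moreover have "smooth_step ((d - a) / h) = 1" "smooth_step ((c - a) / h) = 0"
    using h by (auto intro!: smooth_step_low smooth_step_high simp: field_simps)
  ultimately have "(?g has_integral 1) {c..d}" by simp
  moreover have "set_integrable lborel {c..d} ?g"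
    using h by (intro borel_integrable_atLeastAtMost' continuous_bump) auto
  ultimately have "(LINT x:{c..d}|lborel. ?g x) = 1"
    using set_borel_integral_eq_integral(2) by (metis integral_unique)
  moreover have "(LINT x:{c..<d}|lborel. ?g x) = (LINT x:{c..d}|lborel. ?g x)"
    unfolding set_lebesgue_integral_def
  proof (rule integral_cong_AE)
    show "AE x in lborel. indicator {c..<d} x *\<^sub>R ?g x = indicator {c..d} x *\<^sub>R ?g x"
      using AE_lborel_singleton[of d] by eventually_elim (auto simp: indicator_def)
    have "(\<lambda>x. indicator A x *\<^sub>R ?g x) \<in> borel_measurable lborel" if "A \<in> sets borel" for A
    proof (rule borel_measurable_scaleR)
      show "indicator A \<in> borel_measurable lborel" using that by (intro borel_measurable_indicator) simp
      show "?g \<in> borel_measurable lborel" using gm by simp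
    qed
    from this[of "{c..<d}"] this[of "{c..d}"]
    show "(\<lambda>x. indicator {c..<d} x *\<^sub>R ?g x) \<in> borel_measurable lborel"
      "(\<lambda>x. indicator {c..d} x *\<^sub>R ?g x) \<in> borel_measurable lborel"
      by simp_all
  qed
  ultimately show "(LINT x:{c..<d}|lborel. ?g x) = 1" by simp
  have "(LINT x:{c..<d}|lborel. indicator F x * ?g x) \<le> (LINT x|lborel. indicator ({a-h..a+h} \<inter> F) x * (1 / h))"
    unfolding set_lebesgue_integral_def
  proof (rule integral_mono)
    show "integrable lborel (\<lambda>x. indicator {c..<d} x *\<^sub>R (indicator F x * ?g x))"
      using si by (simp add: set_integrable_def)
    show "integrable lborel (\<lambda>x. indicator ({a-h..a+h} \<inter> F) x * (1 / h))"
    proof (intro integrable_mult_left integrable_real_indicator)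
      show "{a-h..a+h} \<inter> F \<in> sets lborel" using F by simp
      have "emeasure lborel ({a-h..a+h} \<inter> F) \<le> emeasure lborel {a-h..a+h}" by (intro emeasure_mono) auto
      also have "\<dots> < \<infinity>" using h by simp
      finally show "emeasure lborel ({a-h..a+h} \<inter> F) < \<infinity>" .
    qed
    show "indicator {c..<d} x *\<^sub>R (indicator F x * ?g x) \<le> indicator ({a-h..a+h} \<inter> F) x * (1 / h)" for x
      using gb[of x] g0[of x] h by (auto simp: indicator_def)
  qed
  also have "\<dots> = measure lborel ({a-h..a+h} \<inter> F) / h" using F by simp
  finally show "(LINT x:{c..<d}|lborel. indicator F x * ?g x) \<le> measure lborel ({a-h..a+h} \<inter> F) / h" .
qed

text \<open>Near every \<open>b\<close> in \<open>K\<close> both \<open>E\<close> and its complement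
  nearly fill some small interval. A test function whose derivative is a bump on the first minus a
  bump on the second gains almost 1 from \<open>E\<close>. The supports for different
  \<open>b\<close> are disjoint, so the sum over \<open>K\<close> still has sup norm at most
  1.\<close>

lemma card_ess_boundary_le:
  assumes l: "0 < l" and E: "E \<in> sets borel" and per: "\<And>x. x + 2 * l \<in> E \<longleftrightarrow> x \<in> E"
    and c: "-l \<le> c" "c \<le> l" and K: "finite K" "K \<subseteq> ess_boundary E \<inter> {c<..<c + 2 * l}"
    and M: "\<And>\<phi> \<phi>'. per_C1 l \<phi> \<phi>' \<Longrightarrow> (\<And>x. \<bar>\<phi> x\<bar> \<le> 1) \<Longrightarrow> (LINT x|circ l. indicator E x * \<phi>' x) \<le> M"
  shows "real (card K) \<le> M"
proof -
  define d where "d = c + 2 * l"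
  obtain r where r: "0 < r" "\<And>b. b \<in> K \<Longrightarrow> c \<le> b - 2 * r \<and> b + 2 * r \<le> d"
      "\<And>b b'. b \<in> K \<Longrightarrow> b' \<in> K \<Longrightarrow> b \<noteq> b' \<Longrightarrow> 2 * r \<le> \<bar>b - b'\<bar>"
    using finite_separation[of K c d] K by (auto simp: d_def)
  have bound: "real (card K) * (1 - 4 * \<eta>) \<le> M" if \<eta>: "0 < \<eta>" for \<eta>
  proof -
    have "\<exists>a h. 0 < h \<and> b - r < a - h \<and> a + h < b + r \<and> measure lborel ({a-h..a+h} - E) \<le> \<eta> * (2 * h)"
      if "b \<in> K" for b
    proof -
      have "b \<notin> ess_interior (- E)" using that K(2) by (auto simp: ess_boundary_def)
      from density_interval[OF E this r(1) \<eta>] show ?thesis by metis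
    qed
    then obtain a1 h1 where 1: "\<And>b. b \<in> K \<Longrightarrow> 0 < h1 b \<and> b - r < a1 b - h1 b \<and> a1 b + h1 b < b + r
        \<and> measure lborel ({a1 b - h1 b..a1 b + h1 b} - E) \<le> \<eta> * (2 * h1 b)" by metis
    have "\<exists>a h. 0 < h \<and> b - r < a - h \<and> a + h < b + r \<and> measure lborel ({a-h..a+h} - (- E)) \<le> \<eta> * (2 * h)"
      if "b \<in> K" for b
    proof -
      have "b \<notin> ess_interior (- (- E))" using that K(2) by (auto simp: ess_boundary_def)
      from density_interval[OF _ this r(1) \<eta>] show ?thesis using E by (metis borel_comp)
    qed
    then obtain a0 h0 where 0: "\<And>b. b \<in> K \<Longrightarrow> 0 < h0 b \<and> b - r < a0 b - h0 b \<and> a0 b + h0 b < b + r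
        \<and> measure lborel ({a0 b - h0 b..a0 b + h0 b} - (- E)) \<le> \<eta> * (2 * h0 b)" by metis
    \<comment> \<open>Both steps run from 0 to 1, so the difference stays between -1 and 1 and
      vanishes away from \<open>b\<close>, whichever of the two intervals lies to the left.\<close>
    define t where "t b x = smooth_step ((x - a1 b) / h1 b) - smooth_step ((x - a0 b) / h0 b)" for b x
    define t' where "t' b x = bump (a1 b) (h1 b) x - bump (a0 b) (h0 b) x" for b x
    have t_out: "t b x = 0 \<and> t' b x = 0" if b: "b \<in> K" and x: "x \<notin> {b - r<..<b + r}" for b x
    proof (cases "x \<le> b - r")
      case True
      then have "(x - a1 b) / h1 b \<le> -1" "(x - a0 b) / h0 b \<le> -1"
        using 1[OF b] 0[OF b] by (auto simp: field_simps)
      moreover from this have "hat ((x - a1 b) / h1 b) = 0" "hat ((x - a0 b) / h0 b) = 0"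
        by (intro hat_outside; linarith)+
      ultimately show ?thesis by (simp add: t_def t'_def bump_def smooth_step_low)
    next
      case False
      then have "1 \<le> (x - a1 b) / h1 b" "1 \<le> (x - a0 b) / h0 b"
        using 1[OF b] 0[OF b] x by (auto simp: field_simps)
      moreover from this have "hat ((x - a1 b) / h1 b) = 0" "hat ((x - a0 b) / h0 b) = 0"
        by (intro hat_outside; linarith)+
      ultimately show ?thesis by (simp add: t_def t'_def bump_def smooth_step_high)
    qed
    have t_le: "\<bar>t b x\<bar> \<le> 1" for b x
      using smooth_step_bounds[of "(x - a1 b) / h1 b"] smooth_step_bounds[of "(x - a0 b) / h0 b"]
      by (simp add: t_def)
    define f f' where "f x = (\<Sum>b\<in>K. t b x)" and "f' x = (\<Sum>b\<in>K. t' b x)" for x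
    have fd: "(f has_real_derivative f' x) (at x)" for x
      unfolding f_def f'_def t_def t'_def
      using 1 0 by (intro DERIV_sum DERIV_diff smooth_step_scaled_derivative) auto
    have fc: "continuous_on UNIV f'"
      unfolding f'_def t'_def using 1 0
      by (intro continuous_on_sum continuous_on_diff continuous_bump) force+
    have supp: "f x = 0 \<and> f' x = 0" if "x \<notin> {c + r..d - r}" for x
    proof -
      have "x \<notin> {b - r<..<b + r}" if "b \<in> K" for b
        using r(2)[OF that] \<open>x \<notin> {c + r..d - r}\<close> by auto
      then show ?thesis using t_out by (simp add: f_def f'_def)
    qed
    have f_le: "\<bar>f x\<bar> \<le> 1" for x
    proof (cases "\<exists>b\<in>K. x \<in> {b - r<..<b + r}")
      case True
      then obtain b where b: "b \<in> K" "x \<in> {b - r<..<b + r}" by auto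
      have "x \<notin> {b' - r<..<b' + r}" if "b' \<in> K - {b}" for b'
        using r(3)[OF b(1), of b'] that b by auto
      then have "f x = t b x"
        unfolding f_def using K(1) b(1) t_out by (subst sum.remove[of K b]) auto
      then show ?thesis using t_le by simp
    next
      case False
      then have "f x = 0" unfolding f_def using t_out by (intro sum.neutral) auto
      then show ?thesis by simp
    qed
    show ?thesis
    proof (cases "K = {}")
      case True
      \<comment> \<open>The zero test function shows \<open>0 \<le> M\<close>.\<close>
      have "(LINT x|circ l. indicator E x * (0 :: real)) \<le> M"
        by (rule M[OF per_C1_const[of l 0]]) simp
      then show ?thesis using True by simp
    next
      case False
      then obtain b0 where "b0 \<in> K" by auto
      from r(2)[OF this] r(1) have cd: "c + r \<le> d - r" by auto
      obtain \<phi> \<phi>' where \<phi>: "per_C1 l \<phi> \<phi>'" "\<And>x. x \<in> {c..<d} \<Longrightarrow> \<phi> x = f x \<and> \<phi>' x = f' x"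
          "\<And>x. \<exists>y. \<phi> x = f y"
        by (rule per_C1_extend[OF l _ cd _ fd fc supp, of c]) (use r(1) in \<open>auto simp: d_def\<close>)
      have \<phi>'c: "continuous_on UNIV \<phi>'" using \<phi>(1) by (simp add: per_C1_def)
      have \<phi>'per: "\<phi>' (x + 2 * l) = \<phi>' x" for x
      proof -
        have "((\<lambda>y. \<phi> (y + 2 * l)) has_real_derivative \<phi>' (x + 2 * l)) (at x)"
          using \<phi>(1) unfolding per_C1_def by (metis DERIV_shift)
        moreover have "(\<lambda>y. \<phi> (y + 2 * l)) = \<phi>" using \<phi>(1) by (auto simp: per_C1_def)
        moreover have "(\<phi> has_real_derivative \<phi>' x) (at x)" using \<phi>(1) by (simp add: per_C1_def)
        ultimately show ?thesis by (metis DERIV_unique)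
      qed
      obtain C where C: "\<And>x. \<bar>f' x\<bar> \<le> C"
      proof -
        have "bounded (f' ` {c + r..d - r})"
          by (intro compact_imp_bounded compact_continuous_image continuous_on_subset[OF fc]) auto
        then obtain B where B: "0 < B" "\<And>x. x \<in> {c + r..d - r} \<Longrightarrow> \<bar>f' x\<bar> \<le> B" by (auto simp: bounded_pos)
        have "\<bar>f' x\<bar> \<le> B" for x using B supp[of x] by (cases "x \<in> {c + r..d - r}") auto
        then show ?thesis by (rule that)
      qed
      have \<phi>'b: "\<bar>\<phi>' x\<bar> \<le> C" for x
      proof -
        have "of_int \<lfloor>(x - c) / (2 * l)\<rfloor> \<le> (x - c) / (2 * l)" "(x - c) / (2 * l) < of_int \<lfloor>(x - c) / (2 * l)\<rfloor> + 1"
          by linarith+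
        then have "of_int \<lfloor>(x - c) / (2 * l)\<rfloor> * (2 * l) \<le> x - c" "x - c < (of_int \<lfloor>(x - c) / (2 * l)\<rfloor> + 1) * (2 * l)"
          using l by (simp_all only: pos_le_divide_eq pos_divide_less_eq zero_less_mult_iff zero_less_numeral simp_thms)
        then have s: "c \<le> x - 2 * l * of_int \<lfloor>(x - c) / (2 * l)\<rfloor>" "x - 2 * l * of_int \<lfloor>(x - c) / (2 * l)\<rfloor> < c + 2 * l"
          by (simp_all add: algebra_simps)
        interpret periodic_fun_simple \<phi>' "2 * l" by unfold_locales (rule \<phi>'per)
        have "\<phi>' x = \<phi>' (x - 2 * l * of_int \<lfloor>(x - c) / (2 * l)\<rfloor>)"
          using minus_of_int[of x "\<lfloor>(x - c) / (2 * l)\<rfloor>"] by (simp add: mult.commute)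
        also have "\<dots> = f' (x - 2 * l * of_int \<lfloor>(x - c) / (2 * l)\<rfloor>)" using s \<phi>(2) by (simp add: d_def)
        finally show ?thesis using C by simp
      qed
      have "(LINT x|circ l. indicator E x * \<phi>' x) = (LINT x:{c..<d}|lborel. indicator E x * \<phi>' x)"
        unfolding d_def
      proof (rule integral_circ_shift[OF l _ _ _ c])
        show "(\<lambda>x. indicator E x * \<phi>' x) \<in> borel_measurable borel"
          using E by (intro borel_measurable_times borel_measurable_indicator borel_measurable_continuous_onI \<phi>'c) auto
        show "\<bar>indicator E x * \<phi>' x\<bar> \<le> C" for x using \<phi>'b[of x] by (auto simp: indicator_def)
        show "indicator E (x + 2 * l) * \<phi>' (x + 2 * l) = indicator E x * \<phi>' x" for x
          using per \<phi>'per by (simp add: indicator_def)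
      qed
      also have "\<dots> = (LINT x:{c..<d}|lborel. \<Sum>b\<in>K. indicator E x * bump (a1 b) (h1 b) x
          - indicator E x * bump (a0 b) (h0 b) x)"
        by (rule set_lebesgue_integral_cong)
           (auto simp: \<phi>(2) f'_def t'_def sum_distrib_left right_diff_distrib)
      also have "\<dots> = (\<Sum>b\<in>K. (LINT x:{c..<d}|lborel. indicator E x * bump (a1 b) (h1 b) x)
          - (LINT x:{c..<d}|lborel. indicator E x * bump (a0 b) (h0 b) x))"
      proof -
        have i1: "set_integrable lborel {c..<d} (\<lambda>x. indicator E x * bump (a1 b) (h1 b) x)" if "b \<in> K" for b
          using 1[OF that] r(2)[OF that] r(1) by (intro bump_mass(1) E) auto
        have i0: "set_integrable lborel {c..<d} (\<lambda>x. indicator E x * bump (a0 b) (h0 b) x)" if "b \<in> K" for b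
          using 0[OF that] r(2)[OF that] r(1) by (intro bump_mass(1) E) auto
        show ?thesis
        proof -
          have "set_integrable lborel {c..<d} (\<lambda>x. indicator E x * bump (a1 b) (h1 b) x
              - indicator E x * bump (a0 b) (h0 b) x)" if "b \<in> K" for b
            by (intro set_integral_diff(1) i1 i0 that)
          then have "(LINT x:{c..<d}|lborel. \<Sum>b\<in>K. indicator E x * bump (a1 b) (h1 b) x
              - indicator E x * bump (a0 b) (h0 b) x)
            = (\<Sum>b\<in>K. (LINT x:{c..<d}|lborel. indicator E x * bump (a1 b) (h1 b) x
              - indicator E x * bump (a0 b) (h0 b) x))"
            unfolding set_lebesgue_integral_def set_integrable_def scaleR_sum_right
            by (rule Bochner_Integration.integral_sum)
          also have "\<dots> = (\<Sum>b\<in>K. (LINT x:{c..<d}|lborel. indicator E x * bump (a1 b) (h1 b) x)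
              - (LINT x:{c..<d}|lborel. indicator E x * bump (a0 b) (h0 b) x))"
            by (intro sum.cong refl set_integral_diff(2) i1 i0)
          finally show ?thesis .
        qed
      qed
      \<comment> \<open>The positive bump loses at most \<open>2 * \<eta>\<close> to the complement
        of \<open>E\<close>, and the negative one catches at most \<open>2 * \<eta>\<close> of
        \<open>E\<close>.\<close>
      also have "\<dots> \<ge> (\<Sum>b\<in>K. 1 - 4 * \<eta>)"
      proof (rule sum_mono)
        fix b assume b: "b \<in> K"
        have w1: "0 < h1 b" "c \<le> a1 b - h1 b" "a1 b + h1 b \<le> d" using 1[OF b] r(2)[OF b] r(1) by auto
        have w0: "0 < h0 b" "c \<le> a0 b - h0 b" "a0 b + h0 b \<le> d" using 0[OF b] r(2)[OF b] r(1) by auto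
        have E': "- E \<in> sets borel" using E by auto
        have "(LINT x:{c..<d}|lborel. bump (a1 b) (h1 b) x)
          = (LINT x:{c..<d}|lborel. indicator E x * bump (a1 b) (h1 b) x
              + indicator (- E) x * bump (a1 b) (h1 b) x)"
          by (rule set_lebesgue_integral_cong) (auto simp: indicator_def)
        also have "\<dots> = (LINT x:{c..<d}|lborel. indicator E x * bump (a1 b) (h1 b) x)
             + (LINT x:{c..<d}|lborel. indicator (- E) x * bump (a1 b) (h1 b) x)"
          by (intro set_integral_add bump_mass(1) w1 E E')
        also have "(LINT x:{c..<d}|lborel. indicator (- E) x * bump (a1 b) (h1 b) x)
            \<le> measure lborel ({a1 b - h1 b..a1 b + h1 b} - E) / h1 b"
          using bump_mass(3)[OF w1 E'] by (simp add: Diff_eq)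
        also have "\<dots> \<le> 2 * \<eta>" using 1[OF b] by (simp add: field_simps)
        finally have "1 - 2 * \<eta> \<le> (LINT x:{c..<d}|lborel. indicator E x * bump (a1 b) (h1 b) x)"
          using bump_mass(2)[OF w1 E] by simp
        moreover have "(LINT x:{c..<d}|lborel. indicator E x * bump (a0 b) (h0 b) x) \<le> 2 * \<eta>"
        proof -
          have "measure lborel ({a0 b - h0 b..a0 b + h0 b} \<inter> E) / h0 b \<le> 2 * \<eta>"
            using 0[OF b] by (simp add: field_simps Diff_eq)
          with bump_mass(3)[OF w0 E] show ?thesis by linarith
        qed
        ultimately show "1 - 4 * \<eta> \<le> (LINT x:{c..<d}|lborel. indicator E x * bump (a1 b) (h1 b) x)
          - (LINT x:{c..<d}|lborel. indicator E x * bump (a0 b) (h0 b) x)" by simp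
      qed
      finally have "real (card K) * (1 - 4 * \<eta>) \<le> (LINT x|circ l. indicator E x * \<phi>' x)" by simp
      also have "\<dots> \<le> M" by (rule M[OF \<phi>(1)]) (metis \<phi>(3) f_le)
      finally show ?thesis .
    qed
  qed
  show ?thesis
  proof (rule field_le_epsilon)
    fix e :: real assume e: "0 < e"
    \<comment> \<open>Makes the total loss \<open>4 * \<eta> * card K\<close> at most
      \<open>e\<close>; the added 1 covers an empty \<open>K\<close>.\<close>
    define \<eta> where "\<eta> = e / (4 * (real (card K) + 1))"
    have "0 < \<eta>" using e by (simp add: \<eta>_def add_pos_nonneg)
    from bound[OF this] have "real (card K) \<le> M + real (card K) * (4 * \<eta>)" by (simp add: algebra_simps)
    also have "real (card K) * (4 * \<eta>) \<le> e"
      using e by (simp add: \<eta>_def field_simps add_pos_nonneg)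
    finally show "real (card K) \<le> M + e" by simp
  qed
qed

section \<open>The signed distance to the jumps\<close>

text \<open>A cell of length \<open>r\<close> contains at most one point, and only finitely many
  cells meet \<open>{p..q}\<close>.\<close>

lemma finite_separated_bounded:
  fixes B :: "real set"
  assumes "0 < r" "\<And>b b'. b \<in> B \<Longrightarrow> b' \<in> B \<Longrightarrow> b \<noteq> b' \<Longrightarrow> r \<le> \<bar>b - b'\<bar>" "B \<subseteq> {p..q}"
  shows "finite B"
proof (rule finite_imageD)
  have "(\<lambda>b. \<lfloor>b / r\<rfloor>) ` B \<subseteq> {\<lfloor>p / r\<rfloor>..\<lfloor>q / r\<rfloor>}"
    using assms(1,3) by (auto simp: subset_iff intro!: floor_mono divide_right_mono)
  then show "finite ((\<lambda>b. \<lfloor>b / r\<rfloor>) ` B)" by (rule finite_subset) simp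
  show "inj_on (\<lambda>b. \<lfloor>b / r\<rfloor>) B"
  proof (rule inj_onI, rule ccontr)
    fix b b' assume b: "b \<in> B" "b' \<in> B" "\<lfloor>b / r\<rfloor> = \<lfloor>b' / r\<rfloor>" "b \<noteq> b'"
    then have "\<bar>b / r - b' / r\<bar> < 1" by linarith
    then have "\<bar>b - b'\<bar> < r" using assms(1) by (simp add: diff_divide_distrib[symmetric])
    then show False using assms(2)[OF b(1,2,4)] by simp
  qed
qed

text \<open>\<open>r\<close> is a common half-width: the balls of radius \<open>r\<close> around
  different jumps are disjoint, and those around the jumps of the window starting at
  \<open>c\<close> stay inside it. The boundary must be nonempty because \<open>infdist\<close> to
  the empty set is 0 by convention.\<close>

locale jump_set =
  fixes l c r :: real and E :: "real set"
  assumes l_pos: "0 < l" and E_borel: "E \<in> sets borel" and E_per: "\<And>x. x + 2 * l \<in> E \<longleftrightarrow> x \<in> E"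
    and jumps: "ess_boundary E \<noteq> {}" and r_pos: "0 < r"
    and separated: "\<And>b b'. b \<in> ess_boundary E \<Longrightarrow> b' \<in> ess_boundary E \<Longrightarrow> b \<noteq> b' \<Longrightarrow> 2 * r \<le> \<bar>b - b'\<bar>"
    and c_bounds: "-l \<le> c" "c \<le> l" and c_far: "\<And>b. b \<in> ess_boundary E \<Longrightarrow> r \<le> \<bar>b - c\<bar>"
begin

abbreviation B :: "real set" where "B \<equiv> ess_boundary E"

definition jdist :: "real \<Rightarrow> real" where "jdist x = infdist x B"

text \<open>The sign is taken from \<open>ess_interior E\<close> and not from \<open>E\<close>,
  which makes it locally constant off the jumps and \<open>sdist\<close> continuous. Truncation at
  \<open>r\<close> makes each layer depend on a single jump.\<close>

definition sdist :: "real \<Rightarrow> real" where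
  "sdist x = (if x \<in> ess_interior E then - min (jdist x) r else min (jdist x) r)"

lemma closed_B: "closed B"
  unfolding ess_boundary_def by (intro closed_Compl open_Un open_ess_interior)

lemma B_per: "x + 2 * l \<in> B \<longleftrightarrow> x \<in> B"
  using ess_boundary_translate[of "2 * l" E x] E_per by (simp add: add.commute)

text \<open>Any other jump is at distance at least \<open>2 * r - r\<close> from \<open>x\<close>,
  hence not nearer than \<open>b\<close>.\<close>

lemma jdist_eq: "b \<in> B \<Longrightarrow> \<bar>x - b\<bar> \<le> r \<Longrightarrow> jdist x = \<bar>x - b\<bar>"
proof -
  assume b: "b \<in> B" "\<bar>x - b\<bar> \<le> r"
  obtain b' where b': "b' \<in> B" "jdist x = \<bar>x - b'\<bar>"
    using infdist_attains_inf[OF closed_B jumps, of x] by (auto simp: jdist_def dist_real_def)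
  have "jdist x \<le> \<bar>x - b\<bar>" using infdist_le[OF b(1), of x] by (simp add: jdist_def dist_real_def)
  then show ?thesis using separated[OF b(1) b'(1)] b b' by (cases "b = b'") auto
qed

lemma jdist_attained: obtains b where "b \<in> B" "jdist x = \<bar>x - b\<bar>"
  using infdist_attains_inf[OF closed_B jumps, of x] by (auto simp: jdist_def dist_real_def)

lemma jdist_nonneg: "0 \<le> jdist x" by (simp add: jdist_def infdist_nonneg)

lemma jdist_0: "jdist x = 0 \<longleftrightarrow> x \<in> B"
  using in_closed_iff_infdist_zero[OF closed_B jumps] by (simp add: jdist_def)

lemma jdist_continuous: "continuous_on S jdist"
  unfolding jdist_def by (intro continuous_intros)

lemma jdist_per: "jdist (x + 2 * l) = jdist x"
proof (rule antisym)
  obtain b where "b \<in> B" "jdist x = \<bar>x - b\<bar>" by (rule jdist_attained)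
  then show "jdist (x + 2 * l) \<le> jdist x"
    using infdist_le[of "b + 2 * l" B "x + 2 * l"] B_per by (simp add: jdist_def dist_real_def)
  obtain b where b: "b \<in> B" "jdist (x + 2 * l) = \<bar>x + 2 * l - b\<bar>" by (rule jdist_attained)
  then have "b - 2 * l \<in> B" using B_per[of "b - 2 * l"] by simp
  then show "jdist x \<le> jdist (x + 2 * l)"
    using infdist_le[of "b - 2 * l" B x] b by (simp add: jdist_def dist_real_def algebra_simps)
qed

lemma sdist_per: "sdist (x + 2 * l) = sdist x"
  using ess_interior_translate[of "2 * l" E x] E_per by (simp add: sdist_def jdist_per add.commute)

lemma sdist_abs: "\<bar>sdist x\<bar> = min (jdist x) r"
  using jdist_nonneg[of x] r_pos by (auto simp: sdist_def)

lemma sdist_sign: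
  "x \<in> ess_interior E \<Longrightarrow> sdist x < 0" "x \<in> ess_interior (- E) \<Longrightarrow> 0 < sdist x" "x \<in> B \<Longrightarrow> sdist x = 0"
proof -
  have pos: "0 < min (jdist x) r" if "x \<notin> B"
    using that jdist_0[of x] jdist_nonneg[of x] r_pos by simp
  show "x \<in> ess_interior E \<Longrightarrow> sdist x < 0" using pos by (auto simp: sdist_def ess_boundary_def)
  show "x \<in> ess_interior (- E) \<Longrightarrow> 0 < sdist x"
    using pos ess_interior_disjoint[of E] by (auto simp: sdist_def ess_boundary_def)
  show "x \<in> B \<Longrightarrow> sdist x = 0" using jdist_0[of x] r_pos by (simp add: sdist_def)
qed

text \<open>\<open>B\<close> is the complement of two disjoint open sets, so the sign cannot change
  near a point outside \<open>B\<close>.\<close>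

lemma sdist_locally:
  assumes "x \<notin> B"
  obtains g where "g = 1 \<or> g = (-1 :: real)" "\<forall>\<^sub>F y in nhds x. sdist y = g * min (jdist y) r"
proof (cases "x \<in> ess_interior E")
  case True
  have "\<forall>\<^sub>F y in nhds x. sdist y = -1 * min (jdist y) r"
    by (rule eventually_mono[OF eventually_nhds_in_open[OF open_ess_interior True]]) (simp add: sdist_def)
  then show ?thesis using that by blast
next
  case False
  then have "x \<in> ess_interior (- E)" using assms by (simp add: ess_boundary_def)
  from eventually_nhds_in_open[OF open_ess_interior this]
  have "\<forall>\<^sub>F y in nhds x. sdist y = 1 * min (jdist y) r"
    by (rule eventually_mono) (use ess_interior_disjoint[of E] in \<open>auto simp: sdist_def\<close>)
  then show ?thesis using that by blast
qed

lemma sdist_continuous: "continuous_on S sdist"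
proof -
  have "isCont sdist x" for x
  proof (cases "x \<in> B")
    case True
    have "(sdist \<longlongrightarrow> 0) (at x)"
    proof (rule Lim_null_comparison)
      show "\<forall>\<^sub>F y in at x. norm (sdist y) \<le> \<bar>y - x\<bar>"
      proof (rule always_eventually, rule allI)
        fix y
        have "jdist y \<le> \<bar>y - x\<bar>" using infdist_le[OF True, of y] by (simp add: jdist_def dist_real_def)
        then show "norm (sdist y) \<le> \<bar>y - x\<bar>" using sdist_abs[of y] by simp
      qed
      show "((\<lambda>y. \<bar>y - x\<bar>) \<longlongrightarrow> 0) (at x)" by (auto intro!: tendsto_eq_intros)
    qed
    then show ?thesis using sdist_sign(3)[OF True] by (simp add: isCont_def)
  next
    case False
    obtain g where g: "\<forall>\<^sub>F y in nhds x. sdist y = g * min (jdist y) r" by (rule sdist_locally[OF False])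
    have "isCont jdist x" using jdist_continuous[of UNIV] by (simp add: continuous_on_eq_continuous_at)
    then have "isCont (\<lambda>y. g * min (jdist y) r) x" by (intro continuous_intros)
    then show ?thesis using isCont_cong[OF g] by simp
  qed
  then show ?thesis by (meson continuous_at_imp_continuous_on)
qed

text \<open>A representative of the derivative that is Borel on the whole line, being a limit of
  difference quotients along a fixed sequence. Clamping keeps it bounded also where
  \<open>lim\<close> has an arbitrary value.\<close>

definition sslope :: "real \<Rightarrow> real" where
  "sslope x = max (-1) (min 1 (lim (\<lambda>k. (sdist (x + 1 / real (Suc k)) - sdist x) / (1 / real (Suc k)))))"

lemma sdist_borel: "sdist \<in> borel_measurable borel"
  by (rule borel_measurable_continuous_onI[OF sdist_continuous])

lemma sslope_borel: "sslope \<in> borel_measurable borel"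
proof -
  have "(\<lambda>x. sdist (x + t)) \<in> borel_measurable borel" for t
    by (rule measurable_compose[OF _ sdist_borel]) simp
  then have "(\<lambda>x. (sdist (x + 1 / real (Suc k)) - sdist x) / (1 / real (Suc k))) \<in> borel_measurable borel" for k
    by (intro borel_measurable_divide borel_measurable_diff sdist_borel borel_measurable_const)
  then show ?thesis
    unfolding sslope_def by (intro borel_measurable_max borel_measurable_min borel_measurable_const borel_measurable_lim_metric)
qed

lemma sslope_bound: "\<bar>sslope x\<bar> \<le> 1"
  by (auto simp: sslope_def)

lemma sslope_eq:
  assumes "(sdist has_real_derivative D) (at x)" "\<bar>D\<bar> \<le> 1"
  shows "sslope x = D"
proof -
  have "filterlim (\<lambda>k. 1 / real (Suc k)) (at 0) sequentially"
    unfolding filterlim_at using LIMSEQ_Suc[OF lim_1_over_n] by (auto simp: eventually_sequentially)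
  from filterlim_compose[OF assms(1)[unfolded DERIV_def] this]
  have "(\<lambda>k. (sdist (x + 1 / real (Suc k)) - sdist x) / (1 / real (Suc k))) \<longlonglongrightarrow> D" .
  from limI[OF this] show ?thesis using assms(2) by (simp only: sslope_def)
qed

text \<open>Contains the jumps themselves, so that differentiability of \<open>sdist\<close> there
  never has to be discussed.\<close>

definition kinks :: "real set" where
  "kinks = {-l<..<l} \<inter> (B \<union> {x. jdist x = r})"

lemma finite_B_interval: "finite (B \<inter> {p..q})"
  by (rule finite_separated_bounded[of "2 * r"]) (use r_pos separated in auto)

lemma finite_kinks: "finite kinks"
proof (rule finite_subset)
  let ?F = "B \<inter> {-l - r..l + r}"
  show "finite (?F \<union> (\<lambda>b. b + r) ` ?F \<union> (\<lambda>b. b - r) ` ?F)"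
    using finite_B_interval by simp
  show "kinks \<subseteq> ?F \<union> (\<lambda>b. b + r) ` ?F \<union> (\<lambda>b. b - r) ` ?F"
  proof
    fix x assume x: "x \<in> kinks"
    show "x \<in> ?F \<union> (\<lambda>b. b + r) ` ?F \<union> (\<lambda>b. b - r) ` ?F"
    proof (cases "x \<in> B")
      case True then show ?thesis using x r_pos by (auto simp: kinks_def)
    next
      case False
      then have xr: "jdist x = r" "-l < x" "x < l" using x by (auto simp: kinks_def)
      obtain b where b: "b \<in> B" "jdist x = \<bar>x - b\<bar>" by (rule jdist_attained)
      then have "b \<in> ?F" "x = b + r \<or> x = b - r" using xr by (auto simp: abs_if split: if_splits)
      then show ?thesis by blast
    qed
  qed
qed

lemma sdist_derivative:
  assumes "x \<notin> B" "jdist x \<noteq> r"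
  shows "(sdist has_real_derivative sslope x) (at x)"
    and "(sslope x)\<^sup>2 = (if jdist x < r then 1 else 0)"
proof -
  obtain g where g: "g = 1 \<or> g = (-1 :: real)" "\<forall>\<^sub>F y in nhds x. sdist y = g * min (jdist y) r"
    by (rule sdist_locally[OF assms(1)]) blast
  have cont: "isCont jdist x" using jdist_continuous[of UNIV] by (simp add: continuous_on_eq_continuous_at)
  have "\<exists>D. (sdist has_real_derivative D) (at x) \<and> D\<^sup>2 = (if jdist x < r then 1 else 0)"
  proof (cases "jdist x < r")
    case True
    obtain b where b: "b \<in> B" "jdist x = \<bar>x - b\<bar>" by (rule jdist_attained)
    have xb: "x \<noteq> b" using assms(1) b by auto
    have "\<forall>\<^sub>F y in nhds x. \<bar>y - b\<bar> < r"
      using True b by (intro eventually_nhds_in_open[of "{y. \<bar>y - b\<bar> < r}", simplified] open_Collect_less continuous_intros) auto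
    moreover have "\<forall>\<^sub>F y in nhds x. y - b \<noteq> 0 \<and> sgn (y - b) = sgn (x - b)"
    proof (cases "b < x")
      case True
      then show ?thesis by (intro eventually_mono[OF eventually_nhds_in_open[of "{b<..}"]]) (auto simp: sgn_if)
    next
      case False
      then show ?thesis using xb by (intro eventually_mono[OF eventually_nhds_in_open[of "{..<b}"]]) (auto simp: sgn_if)
    qed
    ultimately have ev: "\<forall>\<^sub>F y in nhds x. sdist y = g * (sgn (x - b) * (y - b))"
      using g(2)
    proof eventually_elim
      case (elim y)
      have "jdist y = \<bar>y - b\<bar>" using elim(1) by (intro jdist_eq b) simp
      then show ?case using elim by (simp add: abs_sgn mult.commute)
    qed
    have "((\<lambda>y. g * (sgn (x - b) * (y - b))) has_real_derivative g * sgn (x - b)) (at x)"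
      by (auto intro!: derivative_eq_intros)
    then have "(sdist has_real_derivative g * sgn (x - b)) (at x)"
      by (simp only: DERIV_cong_ev[OF refl ev refl])
    moreover have "(g * sgn (x - b))\<^sup>2 = 1" using g(1) xb by (auto simp: sgn_if)
    ultimately show ?thesis using True by auto
  next
    case False
    then have "r < jdist x" using assms(2) by simp
    then have "\<forall>\<^sub>F y in nhds x. r < jdist y"
      using cont unfolding isCont_def by (intro order_tendstoD(1)[of jdist "jdist x"]) (simp_all add: tendsto_at_iff_tendsto_nhds[symmetric])
    then have ev: "\<forall>\<^sub>F y in nhds x. sdist y = g * r"
      using g(2) by eventually_elim simp
    have "((\<lambda>y. g * r) has_real_derivative 0) (at x)" by simp
    then have "(sdist has_real_derivative 0) (at x)"
      by (simp only: DERIV_cong_ev[OF refl ev refl])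
    then show ?thesis using False by auto
  qed
  then obtain D where D: "(sdist has_real_derivative D) (at x)" "D\<^sup>2 = (if jdist x < r then 1 else 0)" by blast
  have "D\<^sup>2 \<le> 1" using D(2) by (simp split: if_splits)
  then have "\<bar>D\<bar> \<le> 1" by (simp only: abs_square_le_1)
  from sslope_eq[OF D(1) this] D show "(sdist has_real_derivative sslope x) (at x)"
    "(sslope x)\<^sup>2 = (if jdist x < r then 1 else 0)" by auto
qed

lemma AE_circ_finite:
  assumes "finite K" "\<And>x. -l < x \<Longrightarrow> x < l \<Longrightarrow> x \<notin> K \<Longrightarrow> P x"
  shows "AE x in circ l. P x"
proof -
  have "insert (-l) K \<in> null_sets lborel" using assms(1) by (intro finite_imp_null_set_lborel) simp
  then have "AE x in lborel. x \<notin> insert (-l) K" by (rule AE_not_in)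
  then show ?thesis
    unfolding AE_circ_iff by eventually_elim (use assms(2) in force)
qed

lemma AE_sslope_sq: "AE x in circ l. (sslope x)\<^sup>2 = (if jdist x < r then 1 else 0)"
  by (rule AE_circ_finite[OF finite_kinks]) (use sdist_derivative in \<open>auto simp: kinks_def\<close>)

text \<open>Here \<open>E\<close> itself returns: off the jumps the essential interiors decide the
  sign, and up to a null set they agree with membership in \<open>E\<close> and its
  complement.\<close>

lemma AE_sdist_sign: "AE x in circ l. (if x \<in> E then sdist x < 0 else 0 < sdist x)"
proof -
  have 1: "AE x in circ l. x \<notin> B"
    by (rule AE_circ_finite[OF finite_kinks]) (auto simp: kinks_def)
  have 2: "AE x in circ l. x \<in> ess_interior E \<longrightarrow> x \<in> E" "AE x in circ l. x \<in> ess_interior (- E) \<longrightarrow> x \<in> - E"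
    unfolding AE_circ_iff using AE_ess_interior[of E] AE_ess_interior[of "- E"] by auto
  show ?thesis
    using 1 2
  proof eventually_elim
    case (elim x)
    then show ?case using sdist_sign[of x] by (auto simp: ess_boundary_def)
  qed
qed

lemma sdist_compose_derivative:
  assumes "\<And>t. (f has_real_derivative f' t) (at t)" "x \<in> {-l<..<l} - kinks"
  shows "((\<lambda>x. f (sdist x)) has_real_derivative f' (sdist x) * sslope x) (at x)"
  using assms sdist_derivative(1)[of x] by (intro DERIV_chain2[of f]) (auto simp: kinks_def)

text \<open>On each of the disjoint intervals \<open>ball b r\<close> around the jumps of one period, \<open>jdist\<close> is the
  distance to \<open>b\<close>.\<close>

lemma layer_integral:
  assumes g: "continuous_on UNIV g" "\<And>t. g (- t) = g t" and \<Phi>: "\<And>t. (\<Phi> has_real_derivative g t) (at t)"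
  shows "integrable (circ l) (\<lambda>x. if jdist x < r then g (jdist x) else 0)"
    and "(LINT x|circ l. (if jdist x < r then g (jdist x) else 0))
      = real (card (B \<inter> {c<..<c + 2 * l})) * (\<Phi> r - \<Phi> (- r))"
proof -
  define d where "d = c + 2 * l"
  define K where "K = B \<inter> {c<..<d}"
  have finK: "finite K"
    unfolding K_def by (rule finite_subset[OF _ finite_B_interval[of c d]]) auto
  define F where "F x = (if jdist x < r then g (jdist x) else 0)" for x
  obtain M where M: "0 < M" "\<And>t. t \<in> {0..r} \<Longrightarrow> \<bar>g t\<bar> \<le> M"
  proof -
    have "bounded (g ` {0..r})"
      by (intro compact_imp_bounded compact_continuous_image continuous_on_subset[OF g(1)]) auto
    then show ?thesis using that by (auto simp: bounded_pos)
  qed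
  have FM: "\<bar>F x\<bar> \<le> M" for x using M jdist_nonneg[of x] by (auto simp: F_def)
  have jm: "jdist \<in> borel_measurable borel" by (rule borel_measurable_continuous_onI[OF jdist_continuous])
  have gm: "g \<in> borel_measurable borel" by (rule borel_measurable_continuous_onI[OF g(1)])
  have Fm: "F \<in> borel_measurable borel"
    unfolding F_def using jm measurable_compose[OF jm gm] by measurable
  show "integrable (circ l) (\<lambda>x. if jdist x < r then g (jdist x) else 0)"
    unfolding F_def[symmetric] by (rule integrable_circ_bounded[OF borel_measurable_circ[OF Fm] FM])
  \<comment> \<open>The right end of the window is its left end one period later, so
    \<open>c_far\<close> applies to the translated jump.\<close>
  have d_far: "r \<le> \<bar>b - d\<bar>" if "b \<in> B" for b
    using c_far[of "b - 2 * l"] B_per[of "b - 2 * l"] that by (simp add: d_def algebra_simps)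
  have Kc: "b - r \<ge> c \<and> b + r \<le> d" if "b \<in> K" for b
    using that c_far[of b] d_far[of b] by (auto simp: K_def)
  have piece: "set_integrable lborel {c..<d} (\<lambda>x. indicator {b - r<..<b + r} x * g (x - b))"
    "(LINT x:{c..<d}|lborel. indicator {b - r<..<b + r} x * g (x - b)) = \<Phi> r - \<Phi> (- r)" if b: "b \<in> K" for b
  proof -
    have gb: "continuous_on S (\<lambda>x. g (x - b))" for S
      by (rule continuous_on_compose2[OF g(1)]) (auto intro!: continuous_intros)
    have si: "set_integrable lborel {b - r..b + r} (\<lambda>x. g (x - b))"
      by (rule borel_integrable_atLeastAtMost'[OF gb])
    have eq: "indicator {c..<d} x *\<^sub>R (indicator {b - r<..<b + r} x * g (x - b)) = indicator {b - r<..<b + r} x *\<^sub>R g (x - b)" for x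
      using Kc[OF b] by (auto simp: indicator_def)
    have si': "set_integrable lborel {b - r<..<b + r} (\<lambda>x. g (x - b))"
      by (rule set_integrable_subset[OF si]) auto
    then show "set_integrable lborel {c..<d} (\<lambda>x. indicator {b - r<..<b + r} x * g (x - b))"
      unfolding set_integrable_def eq .
    have "((\<lambda>x. g (x - b)) has_integral (\<Phi> (b + r - b) - \<Phi> (b - r - b))) {b - r..b + r}"
    proof (rule fundamental_theorem_of_calculus)
      fix x
      have "((\<lambda>x. \<Phi> (x + - b)) has_real_derivative g (x + - b)) (at x)"
        using \<Phi>[of "x + - b"] by (simp only: DERIV_shift)
      then show "((\<lambda>x. \<Phi> (x - b)) has_vector_derivative g (x - b)) (at x within {b - r..b + r})"
        by (simp add: has_real_derivative_iff_has_vector_derivative has_vector_derivative_at_within)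
    qed (use r_pos in simp)
    then have "integral {b - r..b + r} (\<lambda>x. g (x - b)) = \<Phi> r - \<Phi> (- r)" by (simp add: integral_unique)
    then have "(LINT x:{b - r<..<b + r}|lborel. g (x - b)) = \<Phi> r - \<Phi> (- r)"
      using set_borel_integral_eq_integral(2)[OF si'] integral_open_interval_real[of "b - r" "b + r"] by metis
    then show "(LINT x:{c..<d}|lborel. indicator {b - r<..<b + r} x * g (x - b)) = \<Phi> r - \<Phi> (- r)"
      unfolding set_lebesgue_integral_def eq .
  qed
  \<comment> \<open>In a layer exactly one ball contains \<open>x\<close>; its centre lies in the
    window because no jump is closer than \<open>r\<close> to \<open>c\<close> or \<open>d\<close>.
    Evenness of \<open>g\<close> replaces the distance by \<open>x - b\<close>.\<close>
  have Fsum: "F x = (\<Sum>b\<in>K. indicator {b - r<..<b + r} x * g (x - b))" if x: "x \<in> {c..<d}" for x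
  proof (cases "jdist x < r")
    case True
    obtain b where b: "b \<in> B" "jdist x = \<bar>x - b\<bar>" by (rule jdist_attained)
    then have bK: "b \<in> K" using True x c_far[of b] d_far[of b] by (auto simp: K_def abs_if split: if_splits)
    have "x \<notin> {b' - r<..<b' + r}" if "b' \<in> K - {b}" for b'
      using separated[OF b(1), of b'] that b True by (auto simp: K_def abs_if split: if_splits)
    then have "(\<Sum>b\<in>K. indicator {b - r<..<b + r} x * g (x - b)) = indicator {b - r<..<b + r} x * g (x - b)"
      using bK by (subst sum.remove[OF finK bK]) (auto simp: sum.neutral)
    also have "\<dots> = g (x - b)" using True b by (auto simp: indicator_def abs_if split: if_splits)
    also have "\<dots> = g \<bar>x - b\<bar>" using g(2)[of "x - b"] by (auto simp: abs_if)
    finally show ?thesis using True b by (simp add: F_def)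
  next
    case False
    have "x \<notin> {b - r<..<b + r}" if "b \<in> K" for b
      using infdist_le[of b B x] that False by (auto simp: K_def jdist_def dist_real_def)
    then show ?thesis using False by (simp add: F_def)
  qed
  have "(LINT x|circ l. F x) = (LINT x:{c..<d}|lborel. F x)"
    unfolding d_def
    by (rule integral_circ_shift[OF l_pos Fm FM _ c_bounds]) (simp add: F_def jdist_per)
  also have "\<dots> = (LINT x:{c..<d}|lborel. \<Sum>b\<in>K. indicator {b - r<..<b + r} x * g (x - b))"
    by (rule set_lebesgue_integral_cong) (auto simp: Fsum)
  also have "\<dots> = (\<Sum>b\<in>K. LINT x:{c..<d}|lborel. indicator {b - r<..<b + r} x * g (x - b))"
    using piece(1) unfolding set_lebesgue_integral_def set_integrable_def scaleR_sum_right
    by (rule Bochner_Integration.integral_sum)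
  also have "\<dots> = real (card K) * (\<Phi> r - \<Phi> (- r))" using piece(2) by simp
  finally show "(LINT x|circ l. (if jdist x < r then g (jdist x) else 0))
      = real (card (B \<inter> {c<..<c + 2 * l})) * (\<Phi> r - \<Phi> (- r))"
    by (simp add: F_def K_def d_def)
qed

end

section \<open>Perimeter and number of jumps\<close>

lemma periodic_mem_int:
  fixes E :: "real set"
  assumes "\<And>x. x + p \<in> E \<longleftrightarrow> x \<in> E"
  shows "x + p * of_int m \<in> E \<longleftrightarrow> x \<in> E"
proof -
  interpret periodic_fun_simple "\<lambda>x. x \<in> E" p by unfold_locales (use assms in simp)
  show ?thesis using plus_of_int[of x m] by (simp add: mult.commute)
qed

lemma period_representative:
  fixes l c x :: real
  assumes "0 < l"
  obtains m :: int where "c \<le> x + 2 * l * of_int m" "x + 2 * l * of_int m < c + 2 * l"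
proof
  define m where "m = \<lfloor>(x - c) / (2 * l)\<rfloor>"
  have "of_int m \<le> (x - c) / (2 * l)" "(x - c) / (2 * l) < of_int m + 1" unfolding m_def by linarith+
  then have "of_int m * (2 * l) \<le> x - c" "x - c < (of_int m + 1) * (2 * l)"
    using assms by (simp_all only: pos_le_divide_eq pos_divide_less_eq zero_less_mult_iff zero_less_numeral simp_thms)
  then show "c \<le> x + 2 * l * of_int (- m)" "x + 2 * l * of_int (- m) < c + 2 * l"
    by (simp_all add: algebra_simps)
qed

text \<open>The bound \<open>M\<close> leaves finitely many jumps in each window, so
  \<open>c\<close> can be picked off the jumps and those of its window separated. Periodicity
  carries the separation and the distance from \<open>c\<close> over to the whole line.\<close>

lemma jump_set_exists:
  assumes l: "0 < l" and E: "E \<in> sets borel" and per: "\<And>x. x + 2 * l \<in> E \<longleftrightarrow> x \<in> E"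
    and ne: "ess_boundary E \<noteq> {}"
    and M: "\<And>\<phi> \<phi>'. per_C1 l \<phi> \<phi>' \<Longrightarrow> (\<And>x. \<bar>\<phi> x\<bar> \<le> 1) \<Longrightarrow> (LINT x|circ l. indicator E x * \<phi>' x) \<le> M"
  obtains c r where "jump_set l c r E"
proof -
  let ?B = "ess_boundary E"
  have fin: "finite (?B \<inter> {c<..<c + 2 * l})" if "-l \<le> c" "c \<le> l" for c
  proof (rule ccontr)
    assume "infinite (?B \<inter> {c<..<c + 2 * l})"
    then obtain K where K: "K \<subseteq> ?B \<inter> {c<..<c + 2 * l}" "finite K" "card K = nat \<lceil>M\<rceil> + 1"
      by (metis infinite_arbitrarily_large)
    have "real (card K) \<le> M" by (rule card_ess_boundary_le[OF l E per that K(2,1) M])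
    then show False using K(3) by linarith
  qed
  have "infinite {-l<..<l}" using l by (simp add: infinite_Ioo)
  moreover have "finite (?B \<inter> {-l<..<l})" using fin[of "-l"] l by simp
  ultimately have "{-l<..<l} \<noteq> ?B \<inter> {-l<..<l}" by metis
  then obtain c where "c \<in> {-l<..<l}" "c \<notin> ?B" by blast
  then have c: "-l < c" "c < l" "c \<notin> ?B" by auto
  define K where "K = ?B \<inter> {c<..<c + 2 * l}"
  have K: "finite K" "K \<subseteq> {c<..<c + 2 * l}" using fin[of c] c by (auto simp: K_def)
  obtain r where r: "0 < r" "\<And>b. b \<in> K \<Longrightarrow> c \<le> b - 2 * r \<and> b + 2 * r \<le> c + 2 * l"
      "\<And>b b'. b \<in> K \<Longrightarrow> b' \<in> K \<Longrightarrow> b \<noteq> b' \<Longrightarrow> 2 * r \<le> \<bar>b - b'\<bar>"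
    using finite_separation[OF K] by metis
  have B_per: "x + 2 * l * of_int m \<in> ?B \<longleftrightarrow> x \<in> ?B" for x m
    by (rule periodic_mem_int) (use ess_boundary_translate[of "2 * l" E] per in \<open>simp add: add.commute\<close>)
  have rep: "\<exists>m. b + 2 * l * of_int m \<in> K" if "b \<in> ?B" for b
  proof -
    obtain m where m: "c \<le> b + 2 * l * of_int m" "b + 2 * l * of_int m < c + 2 * l"
      by (rule period_representative[OF l])
    moreover have "b + 2 * l * of_int m \<noteq> c" using B_per that c(3) by metis
    ultimately show ?thesis using that B_per unfolding K_def by force
  qed
  have "jump_set l c r E"
  proof
    show "0 < l" "E \<in> sets borel" "x + 2 * l \<in> E \<longleftrightarrow> x \<in> E" "?B \<noteq> {}" "0 < r" "-l \<le> c" "c \<le> l" for x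
      using l E per ne r(1) c by auto
    show "2 * r \<le> \<bar>b - b'\<bar>" if b: "b \<in> ?B" "b' \<in> ?B" "b \<noteq> b'" for b b'
    proof -
      obtain m where m: "b + 2 * l * of_int m \<in> K" using rep[OF b(1)] by blast
      have b': "b' + 2 * l * of_int m \<in> ?B" using B_per b by simp
      then have ne: "b' + 2 * l * of_int m \<noteq> c" using c(3) by auto
      have "2 * r \<le> \<bar>(b + 2 * l * of_int m) - (b' + 2 * l * of_int m)\<bar>"
      proof (cases "b' + 2 * l * of_int m \<in> K")
        case True
        show ?thesis by (rule r(3)[OF m True]) (use b in simp)
      next
        case False
        \<comment> \<open>The translate of \<open>b'\<close> lies outside the window, from whose
          ends the translate of \<open>b\<close> keeps distance \<open>2 * r\<close>.\<close>
        then have "b' + 2 * l * of_int m < c \<or> c + 2 * l \<le> b' + 2 * l * of_int m"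
          using b' ne by (auto simp: K_def)
        then show ?thesis using r(2)[OF m] by linarith
      qed
      then show ?thesis by simp
    qed
    show "r \<le> \<bar>b - c\<bar>" if b: "b \<in> ?B" for b
    proof -
      obtain m where m: "b + 2 * l * of_int m \<in> K" using rep[OF b] by blast
      then have bm: "c \<le> b + 2 * l * of_int m - 2 * r" "b + 2 * l * of_int m + 2 * r \<le> c + 2 * l" using r(2) by auto
      \<comment> \<open>If \<open>b\<close> lies in another window, it still has distance at least
        \<open>2 * r\<close> from the end of that window which is nearest to
        \<open>c\<close>.\<close>
      consider "m \<le> -1" | "m = 0" | "1 \<le> m" by linarith
      then show ?thesis
      proof cases
        case 1
        then have "2 * l * of_int m \<le> 2 * l * (-1)" using l by (intro mult_left_mono) auto
        then show ?thesis using bm r(1) l by linarith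
      next
        case 2
        then show ?thesis using bm r(1) by simp
      next
        case 3
        then have "2 * l * 1 \<le> 2 * l * of_int m" using l by (intro mult_left_mono) auto
        then show ?thesis using bm r(1) by linarith
      qed
    qed
  qed
  then show ?thesis by (rule that)
qed

text \<open>The variation is tested with the field \<open>(\<phi> x, 0)\<close>; integration over
  \<open>y\<close> contributes the factor \<open>2 * l\<close>.\<close>

lemma torus_variation_ge:
  assumes l: "0 < l" and F: "integrable (circ l) F" and f: "f \<in> borel_measurable (torus l)"
    and eq: "AE p in torus l. f p = F (fst p)"
    and \<phi>: "per_C1 l \<phi> \<phi>'" "\<And>x. \<bar>\<phi> x\<bar> \<le> 1"
  shows "ennreal (2 * l * (LINT x|circ l. F x * \<phi>' x)) \<le> torus_variation l f"
proof -
  \<comment> \<open>The factor 1 gives the component the product form of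
    \<open>torus_C1_product\<close>.\<close>
  define \<xi> where "\<xi> p = (\<phi> (fst p) * 1, 0 :: real)" for p :: "real \<times> real"
  have c: "fst \<circ> \<xi> = (\<lambda>p. \<phi> (fst p) * 1)" "snd \<circ> \<xi> = (\<lambda>p. 0 * 1)" by (auto simp: \<xi>_def)
  note T1 = torus_C1_product[OF \<phi>(1) per_C1_const[of l 1]]
  note T2 = torus_C1_product[OF per_C1_const[of l 0] per_C1_const[of l 1]]
  have \<phi>'c: "continuous_on UNIV \<phi>'" using \<phi>(1) by (simp add: per_C1_def)
  have \<xi>: "\<xi> \<in> {\<phi>. fst \<circ> \<phi> \<in> torus_C1 l \<and> snd \<circ> \<phi> \<in> torus_C1 l \<and> (\<forall>p. norm (\<phi> p) \<le> 1)}"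
  proof (intro CollectI conjI allI)
    show "fst \<circ> \<xi> \<in> torus_C1 l" unfolding c by (rule T1(1))
    show "snd \<circ> \<xi> \<in> torus_C1 l" unfolding c by (rule T2(1))
    show "norm (\<xi> p) \<le> 1" for p using \<phi>(2) by (simp add: \<xi>_def norm_Pair)
  qed
  have i: "integrable (circ l) (\<lambda>x. F x * \<phi>' x)"
  proof -
    obtain C where C: "\<And>x. x \<in> {-l..l} \<Longrightarrow> \<bar>\<phi>' x\<bar> \<le> C"
      by (rule continuous_bounded_interval[OF continuous_on_subset[OF \<phi>'c], of "-l" l]) auto
    show ?thesis
    proof (rule Bochner_Integration.integrable_bound[OF integrable_mult_right[OF F, of C]])
      show "(\<lambda>x. F x * \<phi>' x) \<in> borel_measurable (circ l)"
        by (rule borel_measurable_times[OF borel_measurable_integrable[OF F]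
              borel_measurable_circ[OF borel_measurable_continuous_onI[OF \<phi>'c]]])
      show "AE x in circ l. norm (F x * \<phi>' x) \<le> norm (C * F x)"
      proof (rule AE_I2)
        fix x assume "x \<in> space (circ l)"
        then have "\<bar>\<phi>' x\<bar> \<le> \<bar>C\<bar>" using C[of x] by auto
        then have "\<bar>F x\<bar> * \<bar>\<phi>' x\<bar> \<le> \<bar>F x\<bar> * \<bar>C\<bar>" by (rule mult_left_mono) simp
        then show "norm (F x * \<phi>' x) \<le> norm (C * F x)" by (simp add: abs_mult mult.commute)
      qed
    qed
  qed
  have "(LINT p|torus l. f p * (part_x (fst \<circ> \<xi>) p + part_y (snd \<circ> \<xi>) p)) = (LINT p|torus l. F (fst p) * \<phi>' (fst p))"
  proof (rule integral_cong_AE)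
    have m: "(\<lambda>p. \<phi>' (fst p)) \<in> borel_measurable (torus l)"
      by (intro borel_measurable_torus borel_measurable_continuous_onI continuous_on_compose2[OF \<phi>'c])
         (auto intro!: continuous_intros)
    have Fm: "(\<lambda>p. F (fst p)) \<in> borel_measurable (torus l)"
      using integral_torus_fst(1)[OF l F] by simp
    have p: "part_x (fst \<circ> \<xi>) p + part_y (snd \<circ> \<xi>) p = \<phi>' (fst p)" for p
      unfolding c T1(2) T2(3) by simp
    show "(\<lambda>p. f p * (part_x (fst \<circ> \<xi>) p + part_y (snd \<circ> \<xi>) p)) \<in> borel_measurable (torus l)"
      unfolding p by (intro borel_measurable_times f m)
    show "(\<lambda>p. F (fst p) * \<phi>' (fst p)) \<in> borel_measurable (torus l)"
      by (intro borel_measurable_times Fm m)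
    show "AE p in torus l. f p * (part_x (fst \<circ> \<xi>) p + part_y (snd \<circ> \<xi>) p) = F (fst p) * \<phi>' (fst p)"
      using eq unfolding p by eventually_elim simp
  qed
  also have "\<dots> = 2 * l * (LINT x|circ l. F x * \<phi>' x)"
    by (rule integral_torus_fst(2)[OF l i])
  finally show ?thesis
    unfolding torus_variation_def using \<xi> by (intro SUP_upper2[OF \<xi>]) simp
qed

lemma tanh_tendsto_sgn: "(\<lambda>k. tanh (real k * t)) \<longlonglongrightarrow> sgn (t :: real)"
proof -
  have pos: "(\<lambda>k. tanh (real k * t)) \<longlonglongrightarrow> 1" if "0 < t" for t :: real
  proof (rule filterlim_compose[OF tanh_real_at_top])
    show "filterlim (\<lambda>k. real k * t) at_top sequentially"
      using filterlim_tendsto_pos_mult_at_top[OF tendsto_const that filterlim_real_sequentially]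
      by (simp add: mult.commute)
  qed
  show ?thesis
  proof (cases t "0 :: real" rule: linorder_cases)
    case less
    then have "(\<lambda>k. - tanh (real k * (- t))) \<longlonglongrightarrow> - 1" by (intro tendsto_minus pos) simp
    then show ?thesis using less by simp
  qed (use pos in auto)
qed

context jump_set begin

text \<open>Jumps in one period. The open window misses none of them, since its ends are at distance
  at least \<open>r\<close> from every jump.\<close>

definition njumps :: nat where
  "njumps = card (B \<inter> {c<..<c + 2 * l})"

lemma finite_window: "finite (B \<inter> {c<..<c + 2 * l})"
  by (rule finite_subset[OF _ finite_B_interval[of c "c + 2 * l"]]) auto

lemma sgn_sdist_borel: "(\<lambda>x. sgn (sdist x)) \<in> borel_measurable borel"
  by (rule measurable_compose[OF sdist_borel]) simp

lemma integrable_sgn_sdist: "integrable (circ l) (\<lambda>x. sgn (sdist x))"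
  by (rule integrable_circ_bounded[OF borel_measurable_circ[OF sgn_sdist_borel], of _ 1]) (simp add: sgn_if)

text \<open>One chain rule for all functions of \<open>sdist\<close> used below:
  \<open>tanh (k * t)\<close> for the upper bound on the perimeter, sine and cosine of the scaled
  profile for the recovery sequence.\<close>

lemma sdist_compose_weak_dx:
  assumes f: "\<And>t. (f has_real_derivative f' t) (at t)" and f': "continuous_on UNIV f'"
  obtains M where "\<And>x. \<bar>f' (sdist x) * sslope x\<bar> \<le> M"
    and "(\<lambda>x. f (sdist x)) \<in> borel_measurable borel" "(\<lambda>x. f' (sdist x) * sslope x) \<in> borel_measurable borel"
    and "continuous_on UNIV (\<lambda>x. f (sdist x))"
    and "is_weak_dx l (\<lambda>p. f (sdist (fst p))) (\<lambda>p. f' (sdist (fst p)) * sslope (fst p))"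
proof -
  have fc: "continuous_on UNIV f" using f by (meson DERIV_isCont continuous_at_imp_continuous_on)
  obtain M where M: "\<And>t. t \<in> {-r..r} \<Longrightarrow> \<bar>f' t\<bar> \<le> M"
    by (rule continuous_bounded_interval[OF continuous_on_subset[OF f'], of "-r" r]) auto
  have "\<bar>sdist x\<bar> \<le> r" for x using sdist_abs[of x] by simp
  then have sr: "sdist x \<in> {-r..r}" for x by (metis abs_le_iff atLeastAtMost_iff minus_le_iff)
  have bound: "\<bar>f' (sdist x) * sslope x\<bar> \<le> M" for x
    using mult_mono[OF M[OF sr[of x]] sslope_bound[of x]] M[OF sr[of x]] by (simp add: abs_mult)
  have cf: "continuous_on S (\<lambda>x. f (sdist x))" for S
    by (rule continuous_on_compose2[OF fc sdist_continuous]) simp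
  have m: "(\<lambda>x. f (sdist x)) \<in> borel_measurable borel" by (rule borel_measurable_continuous_onI[OF cf])
  have m': "(\<lambda>x. f' (sdist x) * sslope x) \<in> borel_measurable borel"
    by (intro borel_measurable_times sslope_borel measurable_compose[OF sdist_borel]
        borel_measurable_continuous_onI f')
  have "is_weak_dx l (\<lambda>p. f (sdist (fst p))) (\<lambda>p. f' (sdist (fst p)) * sslope (fst p))"
  proof (rule is_weak_dx_fst[OF l_pos finite_kinks m' bound cf])
    show "f (sdist (-l)) = f (sdist l)" using sdist_per[of "-l"] by simp
    show "((\<lambda>x. f (sdist x)) has_real_derivative f' (sdist x) * sslope x) (at x)"
      if "x \<in> {-l<..<l} - kinks" for x by (rule sdist_compose_derivative[OF f that])
  qed
  then show ?thesis using that[OF bound m m' cf] by blast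
qed

text \<open>For the upper bound, \<open>sgn sdist\<close> is the limit of \<open>tanh (k sdist)\<close>, whose gradient has mass
  at most 2 at every jump.\<close>

lemma torus_variation_le:
  assumes f: "f \<in> borel_measurable (torus l)" "AE p in torus l. f p = indicator E (fst p)"
  shows "torus_variation l f \<le> ennreal (2 * l * real njumps)"
  unfolding torus_variation_def
proof (rule SUP_least, rule ennreal_leI)
  fix \<xi> :: "real \<times> real \<Rightarrow> real \<times> real"
  assume "\<xi> \<in> {\<phi>. fst \<circ> \<phi> \<in> torus_C1 l \<and> snd \<circ> \<phi> \<in> torus_C1 l \<and> (\<forall>p. norm (\<phi> p) \<le> 1)}"
  then have \<xi>: "fst \<circ> \<xi> \<in> torus_C1 l" "snd \<circ> \<xi> \<in> torus_C1 l" "\<And>p. norm (\<xi> p) \<le> 1" by auto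
  define a b where "a = part_x (fst \<circ> \<xi>)" and "b = part_y (snd \<circ> \<xi>)"
  have ab: "continuous_on UNIV a" "continuous_on UNIV b"
    unfolding a_def b_def by (rule continuous_part_x[OF \<xi>(1)] continuous_part_y[OF \<xi>(2)])+
  have \<xi>1: "\<bar>(fst \<circ> \<xi>) p\<bar> \<le> 1" for p
    using norm_fst_le[of "fst (\<xi> p)" "snd (\<xi> p)"] \<xi>(3)[of p] by simp
  let ?s = "\<lambda>p::real \<times> real. sgn (sdist (fst p))"
  have i1: "integrable (torus l) (\<lambda>p. 1 :: real)"
    by (rule finite_measure.integrable_const[OF finite_measure_torus])
  have isg: "integrable (torus l) ?s"
    by (rule integral_torus_fst(1)[OF l_pos integrable_sgn_sdist])
  have ia: "integrable (torus l) a" "integrable (torus l) b"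
    using integrable_torus_times_continuous[OF ab(1) i1] integrable_torus_times_continuous[OF ab(2) i1] by simp_all
  have isa: "integrable (torus l) (\<lambda>p. ?s p * a p)" "integrable (torus l) (\<lambda>p. ?s p * b p)"
    by (rule integrable_torus_times_continuous[OF ab(1) isg] integrable_torus_times_continuous[OF ab(2) isg])+
  have a0: "(LINT p|torus l. a p) = 0"
  proof -
    have "is_weak_dx l (\<lambda>p. 1) (\<lambda>p. 0)"
      by (rule is_weak_dx_fst[OF l_pos, where K = "{}" and M = 0]) auto
    then show ?thesis using \<xi>(1) unfolding is_weak_dx_def a_def by force
  qed
  have b0: "(LINT p|torus l. b p) = 0"
  proof -
    have "is_weak_dy l (\<lambda>p. 1) (\<lambda>p. 0)"
      using is_weak_dy_fst[OF l_pos, of "\<lambda>_. 1"] integrable_circ_continuous[of l "\<lambda>_. 1"] by simp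
    then show ?thesis using \<xi>(2) unfolding is_weak_dy_def b_def by force
  qed
  have sb0: "(LINT p|torus l. ?s p * b p) = 0"
    using is_weak_dy_fst[OF l_pos integrable_sgn_sdist] \<xi>(2) unfolding is_weak_dy_def b_def by force
  \<comment> \<open>The factor 4 is the mass at most 2 of the slope at each jump times the length
    \<open>2 * l\<close> of the jump line.\<close>
  have sa: "- (4 * l * real njumps) \<le> (LINT p|torus l. ?s p * a p)"
  proof (rule LIMSEQ_le_const)
    show "(\<lambda>k. LINT p|torus l. tanh (real k * sdist (fst p)) * a p) \<longlonglongrightarrow> (LINT p|torus l. ?s p * a p)"
    proof (rule integral_dominated_convergence[where w="\<lambda>p. \<bar>a p\<bar>"])
      show "(\<lambda>p. ?s p * a p) \<in> borel_measurable (torus l)" using isa by simp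
      have "continuous_on UNIV (\<lambda>p::real\<times>real. tanh (real k * sdist (fst p)) * a p)" for k
        by (intro continuous_intros ab continuous_on_compose2[OF sdist_continuous[of UNIV]]) auto
      then show "(\<lambda>p. tanh (real k * sdist (fst p)) * a p) \<in> borel_measurable (torus l)" for k
        by (intro borel_measurable_torus borel_measurable_continuous_onI)
      show "integrable (torus l) (\<lambda>p. \<bar>a p\<bar>)" using ia by simp
      show "AE p in torus l. (\<lambda>k. tanh (real k * sdist (fst p)) * a p) \<longlonglongrightarrow> ?s p * a p"
        by (intro AE_I2 tendsto_mult tanh_tendsto_sgn tendsto_const)
      show "AE p in torus l. norm (tanh (real k * sdist (fst p)) * a p) \<le> \<bar>a p\<bar>" for k
      proof (rule AE_I2)
        fix p :: "real \<times> real"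
        have "\<bar>tanh (real k * sdist (fst p))\<bar> \<le> 1"
          using tanh_real_bounds[of "real k * sdist (fst p)"] by (auto simp: abs_le_iff)
        from mult_right_mono[OF this, of "\<bar>a p\<bar>"]
        show "norm (tanh (real k * sdist (fst p)) * a p) \<le> \<bar>a p\<bar>" by (simp add: abs_mult)
      qed
    qed
    show "\<exists>K. \<forall>k\<ge>K. - (4 * l * real njumps) \<le> (LINT p|torus l. tanh (real k * sdist (fst p)) * a p)"
    proof (intro exI allI impI)
      fix k :: nat
      define g where "g t = real k * (1 - (tanh (real k * t))\<^sup>2)" for t
      have gd: "((\<lambda>t. tanh (real k * t)) has_real_derivative g t) (at t)" for t
        unfolding g_def by (auto intro!: derivative_eq_intros)
      have gc: "continuous_on UNIV g" unfolding g_def by (intro continuous_intros) auto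
      have ge: "g (- t) = g t" for t by (simp add: g_def)
      have g0: "0 \<le> g t" for t
      proof -
        have "\<bar>tanh (real k * t)\<bar> \<le> 1" using tanh_real_bounds[of "real k * t"] by (auto simp: abs_le_iff)
        then have "(tanh (real k * t))\<^sup>2 \<le> 1" by (simp add: abs_square_le_1)
        then show ?thesis by (simp add: g_def)
      qed
      obtain M where M: "\<And>x. \<bar>g (sdist x) * sslope x\<bar> \<le> M"
        and gm: "(\<lambda>x. g (sdist x) * sslope x) \<in> borel_measurable borel"
        and w: "is_weak_dx l (\<lambda>p. tanh (real k * sdist (fst p))) (\<lambda>p. g (sdist (fst p)) * sslope (fst p))"
        by (rule sdist_compose_weak_dx[OF gd gc], rule that)
      have ig: "integrable (circ l) (\<lambda>x. g (sdist x) * sslope x)"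
        by (rule integrable_circ_bounded[OF borel_measurable_circ[OF gm] M])
      have igt: "integrable (torus l) (\<lambda>p. \<bar>g (sdist (fst p)) * sslope (fst p)\<bar>)"
        using integral_torus_fst(1)[OF l_pos ig] by simp
      have "(LINT p|torus l. g (sdist (fst p)) * sslope (fst p) * (fst \<circ> \<xi>) p)
          \<le> (LINT p|torus l. \<bar>g (sdist (fst p)) * sslope (fst p)\<bar>)"
      proof (rule integral_mono_AE[OF _ igt])
        show "integrable (torus l) (\<lambda>p. g (sdist (fst p)) * sslope (fst p) * (fst \<circ> \<xi>) p)"
          by (rule integrable_torus_times_continuous[OF torus_C1_continuous[OF \<xi>(1)] integral_torus_fst(1)[OF l_pos ig]])
        show "AE p in torus l. g (sdist (fst p)) * sslope (fst p) * (fst \<circ> \<xi>) p \<le> \<bar>g (sdist (fst p)) * sslope (fst p)\<bar>"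
        proof (rule AE_I2)
          fix p
          have "\<bar>g (sdist (fst p)) * sslope (fst p)\<bar> * \<bar>(fst \<circ> \<xi>) p\<bar> \<le> \<bar>g (sdist (fst p)) * sslope (fst p)\<bar> * 1"
            by (intro mult_left_mono \<xi>1) simp
          then show "g (sdist (fst p)) * sslope (fst p) * (fst \<circ> \<xi>) p \<le> \<bar>g (sdist (fst p)) * sslope (fst p)\<bar>"
            by (simp only: abs_mult[symmetric] mult_1_right)
        qed
      qed
      also have "\<dots> = 2 * l * (LINT x|circ l. \<bar>g (sdist x) * sslope x\<bar>)"
        using ig by (intro integral_torus_fst(2)[OF l_pos]) simp
      also have "(LINT x|circ l. \<bar>g (sdist x) * sslope x\<bar>) = (LINT x|circ l. (if jdist x < r then g (jdist x) else 0))"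
      proof (rule integral_cong_AE)
        show "(\<lambda>x. \<bar>g (sdist x) * sslope x\<bar>) \<in> borel_measurable (circ l)" using ig by simp
        show "(\<lambda>x. if jdist x < r then g (jdist x) else 0) \<in> borel_measurable (circ l)"
          using layer_integral(1)[OF gc ge gd] by simp
        show "AE x in circ l. \<bar>g (sdist x) * sslope x\<bar> = (if jdist x < r then g (jdist x) else 0)"
          using AE_sslope_sq
        proof eventually_elim
          case (elim x)
          show ?case
          proof (cases "jdist x < r")
            case True
            then have "sslope x = 1 \<or> sslope x = -1" using elim by (simp add: power2_eq_1_iff)
            then have "\<bar>sslope x\<bar> = 1" by auto
            moreover have "g (sdist x) = g (jdist x)" using True ge by (simp add: sdist_def)
            ultimately show ?thesis using True g0 by (simp add: abs_mult)
          next
            case False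
            then show ?thesis using elim by simp
          qed
        qed
      qed
      also have "\<dots> = real njumps * (tanh (real k * r) - tanh (real k * (- r)))"
        unfolding njumps_def by (rule layer_integral(2)[OF gc ge gd])
      also have "\<dots> \<le> real njumps * 2"
        using tanh_real_lt_1[of "real k * r"] by (intro mult_left_mono) auto
      finally have "(LINT p|torus l. g (sdist (fst p)) * sslope (fst p) * (fst \<circ> \<xi>) p) \<le> 4 * l * real njumps"
        using l_pos by (simp add: mult_left_mono)
      moreover have "(LINT p|torus l. tanh (real k * sdist (fst p)) * a p)
          = - (LINT p|torus l. g (sdist (fst p)) * sslope (fst p) * (fst \<circ> \<xi>) p)"
        using w \<xi>(1) unfolding is_weak_dx_def a_def by blast
      ultimately show "- (4 * l * real njumps) \<le> (LINT p|torus l. tanh (real k * sdist (fst p)) * a p)"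
        by simp
    qed
  qed
  \<comment> \<open>Almost everywhere the indicator of \<open>E\<close> is
    \<open>(1 - sgn (sdist x)) / 2\<close>; the halving turns the factor 4 into 2.\<close>
  have "(LINT p|torus l. f p * (part_x (fst \<circ> \<xi>) p + part_y (snd \<circ> \<xi>) p))
      = (LINT p|torus l. (a p + b p - ?s p * a p - ?s p * b p) / 2)"
  proof (rule integral_cong_AE)
    show "(\<lambda>p. f p * (part_x (fst \<circ> \<xi>) p + part_y (snd \<circ> \<xi>) p)) \<in> borel_measurable (torus l)"
      unfolding a_def[symmetric] b_def[symmetric] using ia f(1) by simp
    show "(\<lambda>p. (a p + b p - ?s p * a p - ?s p * b p) / 2) \<in> borel_measurable (torus l)"
      using ia isa by simp
    show "AE p in torus l. f p * (part_x (fst \<circ> \<xi>) p + part_y (snd \<circ> \<xi>) p) = (a p + b p - ?s p * a p - ?s p * b p) / 2"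
      using f(2) AE_torus_fst[OF AE_sdist_sign]
      by eventually_elim (auto simp: a_def b_def split: if_splits)
  qed
  also have "\<dots> = - (LINT p|torus l. ?s p * a p) / 2"
    using ia isa a0 b0 sb0 by simp
  also have "\<dots> \<le> 2 * l * real njumps" using sa by simp
  finally show "(LINT p|torus l. f p * (part_x (fst \<circ> \<xi>) p + part_y (snd \<circ> \<xi>) p)) \<le> 2 * l * real njumps" .
qed

text \<open>For the lower bound the variation itself, divided by the length \<open>2 * l\<close>,
  serves as the bound \<open>M\<close> of \<open>card_ess_boundary_le\<close>; the upper bound
  guarantees that it is finite.\<close>

lemma torus_variation_eq:
  assumes f: "f \<in> borel_measurable (torus l)" "AE p in torus l. f p = indicator E (fst p)"
  shows "torus_variation l f = ennreal (2 * l * real njumps)"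
proof (rule antisym[OF torus_variation_le[OF f]])
  have "torus_variation l f \<noteq> \<infinity>" using torus_variation_le[OF f] by (auto simp: top_unique)
  then obtain V where V: "torus_variation l f = ennreal V" "0 \<le> V" by (cases "torus_variation l f") auto
  have iE: "integrable (circ l) (indicator E :: real \<Rightarrow> real)"
    using E_borel by (intro integrable_circ_bounded[of _ _ 1] borel_measurable_circ) (auto simp: indicator_def)
  have "real (card (B \<inter> {c<..<c + 2 * l})) \<le> V / (2 * l)"
  proof (rule card_ess_boundary_le[OF l_pos E_borel E_per c_bounds finite_window order_refl])
    fix \<phi> \<phi>' assume "per_C1 l \<phi> \<phi>'" "\<And>x. \<bar>\<phi> x\<bar> \<le> 1"
    from torus_variation_ge[OF l_pos iE f this]
    show "(LINT x|circ l. indicator E x * \<phi>' x) \<le> V / (2 * l)"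
      using V l_pos by (simp add: field_simps)
  qed
  then show "ennreal (2 * l * real njumps) \<le> torus_variation l f"
    using l_pos unfolding V njumps_def by (intro ennreal_leI) (simp add: field_simps)
qed

end

section \<open>The structure of the limit class\<close>

lemma is_weak_dx_cong_AE:
  assumes "is_weak_dx l f h" "AE p in torus l. f p = f' p" "AE p in torus l. h p = h' p"
    and m: "f \<in> borel_measurable (torus l)" "f' \<in> borel_measurable (torus l)"
      "h \<in> borel_measurable (torus l)" "h' \<in> borel_measurable (torus l)"
  shows "is_weak_dx l f' h'"
  unfolding is_weak_dx_def
proof
  fix \<phi> assume \<phi>: "\<phi> \<in> torus_C1 l"
  have \<phi>m: "\<phi> \<in> borel_measurable (torus l)" "part_x \<phi> \<in> borel_measurable (torus l)"
    by (intro borel_measurable_torus borel_measurable_continuous_onI torus_C1_continuous[OF \<phi>] continuous_part_x[OF \<phi>])+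
  have "(LINT p|torus l. f' p * part_x \<phi> p) = (LINT p|torus l. f p * part_x \<phi> p)"
    using assms(2) by (intro integral_cong_AE borel_measurable_times m \<phi>m) auto
  moreover have "(LINT p|torus l. h' p * \<phi> p) = (LINT p|torus l. h p * \<phi> p)"
    using assms(3) by (intro integral_cong_AE borel_measurable_times m \<phi>m) auto
  ultimately show "(LINT p|torus l. f' p * part_x \<phi> p) = - (LINT p|torus l. h' p * \<phi> p)"
    using assms(1) \<phi> by (simp add: is_weak_dx_def)
qed

lemma integrable_circ_of_torus:
  fixes f :: "real \<Rightarrow> real"
  assumes "0 < l" "integrable (torus l) (\<lambda>p. f (fst p))"
  shows "integrable (circ l) f"
proof -
  interpret pair_sigma_finite "circ l" "circ l" by (rule pair_sigma_finite_circ)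
  have "AE y in circ l. integrable (circ l) (\<lambda>x. f x)"
    using AE_integrable_snd[of "\<lambda>x y. f x"] assms(2) by (simp add: torus_eq_pair split_beta')
  then show ?thesis using AE_circ_const[OF assms(1)] by simp
qed

lemma torus_W12_weak_dx:
  assumes "g \<in> torus_W12 l"
  shows "weak_dx l g \<in> torus_L2 l" "is_weak_dx l g (weak_dx l g)"
proof -
  obtain h where "h \<in> torus_L2 l \<and> is_weak_dx l g h" using assms by (auto simp: torus_W12_def)
  then have "weak_dx l g \<in> torus_L2 l \<and> is_weak_dx l g (weak_dx l g)"
    unfolding weak_dx_def by (rule someI[where P = "\<lambda>h. h \<in> torus_L2 l \<and> is_weak_dx l g h"])
  then show "weak_dx l g \<in> torus_L2 l" "is_weak_dx l g (weak_dx l g)" by auto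
qed

text \<open>The almost-everywhere clauses are turned into a genuinely periodic Borel set
  \<open>E\<close> and a function \<open>v\<close> of \<open>x\<close> alone. The BV clause for the
  first component bounds the number of jumps, and the mean-zero clause forces at least one.\<close>

lemma class_A_structure:
  assumes \<sigma>: "0 < \<sigma>" and l: "0 < l" and A: "(n, g) \<in> class_A \<sigma> l"
  obtains c r E v where "jump_set l c r E"
    and "AE p in torus l. n p = (if fst p \<in> E then n_minus \<sigma> else n_plus \<sigma>)"
    and "(LINT x|circ l. (if x \<in> E then -1 else 1 :: real)) = 0"
    and "AE p in torus l. g p = v (fst p)" "integrable (circ l) v"
    and "is_weak_dx l (\<lambda>p. v (fst p)) (\<lambda>p. nbar1 \<sigma> * (if fst p \<in> E then 1 else -1))"
proof -
  interpret anisotropy \<sigma> by unfold_locales (rule \<sigma>)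
  have A': "\<And>i. (\<lambda>p. n p $ i) \<in> torus_BV l" "AE p in torus l. n p \<in> {n_plus \<sigma>, n_minus \<sigma>}"
    "g \<in> torus_W12 l" "depends_on_x_only l g" "depends_on_x_only l n"
    "AE p in torus l. weak_dx l g p + n p $ 1 = 0" "(LINT p|torus l. n p $ 1) = 0"
    using A by (auto simp: class_A_def)
  obtain u where u: "u \<in> borel_measurable borel" "AE p in torus l. n p = u (fst p)"
    using A'(5) by (auto simp: depends_on_x_only_def)
  obtain v where v: "v \<in> borel_measurable borel" "AE p in torus l. g p = v (fst p)"
    using A'(4) by (auto simp: depends_on_x_only_def)
  \<comment> \<open>Reduction to the fundamental domain: nothing is known about \<open>u\<close>
    outside \<open>{-l..<l}\<close>, so only its values there may enter \<open>E\<close>.\<close>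
  define \<rho> where "\<rho> x = x - 2 * l * of_int \<lfloor>(x + l) / (2 * l)\<rfloor>" for x
  define E where "E = {x. u (\<rho> x) = n_minus \<sigma>}"
  have \<rho>_id: "\<rho> x = x" if "x \<in> {-l..<l}" for x
  proof -
    have "\<lfloor>(x + l) / (2 * l)\<rfloor> = 0" using that l by (intro floor_unique) (simp_all add: field_simps)
    then show ?thesis by (simp add: \<rho>_def)
  qed
  have \<rho>_per: "\<rho> (x + 2 * l) = \<rho> x" for x
  proof -
    have "(x + 2 * l + l) / (2 * l) = (x + l) / (2 * l) + 1" using l by (simp add: field_simps)
    then have "\<lfloor>(x + 2 * l + l) / (2 * l)\<rfloor> = \<lfloor>(x + l) / (2 * l)\<rfloor> + 1" by simp
    then show ?thesis by (simp add: \<rho>_def algebra_simps)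
  qed
  have "\<rho> \<in> borel_measurable borel"
    unfolding \<rho>_def by measurable
  then have "(\<lambda>x. u (\<rho> x)) \<in> borel_measurable borel" using u(1) by (rule measurable_compose)
  from measurable_sets_borel[OF this, of "{n_minus \<sigma>}"] have E: "E \<in> sets borel"
    by (simp add: E_def vimage_def)
  have E_per: "x + 2 * l \<in> E \<longleftrightarrow> x \<in> E" for x by (simp add: E_def \<rho>_per)
  have E_n: "AE p in torus l. n p = (if fst p \<in> E then n_minus \<sigma> else n_plus \<sigma>)"
    using u(2) A'(2) AE_space
  proof eventually_elim
    case (elim p)
    then have "fst p \<in> {-l..<l}" by auto
    then show ?case using elim \<rho>_id[of "fst p"] by (auto simp: E_def)
  qed
  define F where "F x = nbar1 \<sigma> * (if x \<in> E then -1 else 1)" for x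
  have Fm: "F \<in> borel_measurable borel" unfolding F_def using E by measurable
  have iF: "integrable (circ l) F"
    by (rule integrable_circ_bounded[OF borel_measurable_circ[OF Fm], of _ "nbar1 \<sigma>"])
       (use nbar1_bounds in \<open>auto simp: F_def\<close>)
  have n1: "AE p in torus l. n p $ 1 = F (fst p)"
    using E_n by eventually_elim (simp add: F_def n_plus_def n_minus_def)
  have n1m: "(\<lambda>p. n p $ 1) \<in> borel_measurable (torus l)"
    using A'(1)[of 1] by (auto simp: torus_BV_def torus_L1_def)
  have Ftm: "(\<lambda>p. F (fst p)) \<in> borel_measurable (torus l)"
    using integral_torus_fst(1)[OF l iF] by simp
  have "(LINT p|torus l. n p $ 1) = (LINT p|torus l. F (fst p))"
    by (rule integral_cong_AE[OF n1m Ftm n1])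
  then have "(LINT x|circ l. F x) = 0"
    using A'(7) l by (simp add: integral_torus_fst(2)[OF l iF])
  moreover have "(LINT x|circ l. F x) = nbar1 \<sigma> * (LINT x|circ l. (if x \<in> E then -1 else 1))"
    by (simp add: F_def)
  ultimately have mean: "(LINT x|circ l. (if x \<in> E then -1 else 1 :: real)) = 0"
    using nbar1_bounds by simp
  \<comment> \<open>Without a boundary the connected line would be covered by two disjoint open
    sets; one phase would fill it up to a null set, and the mean could not vanish.\<close>
  have ne: "ess_boundary E \<noteq> {}"
  proof
    assume "ess_boundary E = {}"
    then have "UNIV \<subseteq> ess_interior E \<union> ess_interior (- E)" by (auto simp: ess_boundary_def)
    from connectedD[OF connected_UNIV open_ess_interior open_ess_interior _ this]
    have "ess_interior E = {} \<or> ess_interior (- E) = {}" using ess_interior_disjoint[of E] by simp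
    then have "ess_interior (- E) = UNIV \<or> ess_interior E = UNIV"
      using \<open>UNIV \<subseteq> _\<close> by auto
    then have "(AE x in lborel. x \<in> - E) \<or> (AE x in lborel. x \<in> E)"
    proof
      assume "ess_interior (- E) = UNIV"
      then show ?thesis using AE_ess_interior[of "- E"] by (intro disjI1) simp
    next
      assume "ess_interior E = UNIV"
      then show ?thesis using AE_ess_interior[of E] by (intro disjI2) simp
    qed
    then have "\<exists>k\<in>{-1, 1::real}. AE x in circ l. (if x \<in> E then -1 else 1) = k"
    proof
      assume "AE x in lborel. x \<in> - E"
      then have "AE x in circ l. (if x \<in> E then -1 else 1) = (1 :: real)" unfolding AE_circ_iff by eventually_elim auto
      then show ?thesis by blast
    next
      assume "AE x in lborel. x \<in> E"
      then have "AE x in circ l. (if x \<in> E then -1 else 1) = (-1 :: real)" unfolding AE_circ_iff by eventually_elim auto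
      then show ?thesis by blast
    qed
    then obtain k where k: "k \<in> {-1, 1::real}" "AE x in circ l. (if x \<in> E then -1 else 1) = k" by blast
    have "(LINT x|circ l. (if x \<in> E then -1 else 1 :: real)) = (LINT x|circ l. k)"
    proof (rule integral_cong_AE[OF _ _ k(2)])
      have "(\<lambda>x. if x \<in> E then -1 else 1 :: real) \<in> borel_measurable borel" using E by measurable
      then show "(\<lambda>x. if x \<in> E then -1 else 1 :: real) \<in> borel_measurable (circ l)"
        by (rule borel_measurable_circ)
    qed simp
    also have "\<dots> = 2 * l * k" using l by (simp add: measure_circ_space)
    finally show False using mean k(1) l by auto
  qed
  define V where "V = torus_variation l (\<lambda>p. n p $ 1)"
  have V: "V < \<infinity>" using A'(1)[of 1] by (auto simp: V_def torus_BV_def)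
  \<comment> \<open>Since \<open>F = nbar1 * (1 - 2 * indicator E)\<close> and
    \<open>\<phi>'\<close> has integral zero, testing with \<open>- \<phi>\<close> yields
    \<open>2 * nbar1\<close> times the integral over \<open>E\<close>; the length
    \<open>2 * l\<close> completes the constant.\<close>
  have M: "(LINT x|circ l. indicator E x * \<phi>' x) \<le> enn2real V / (4 * l * nbar1 \<sigma>)"
    if \<phi>: "per_C1 l \<phi> \<phi>'" "\<And>x. \<bar>\<phi> x\<bar> \<le> 1" for \<phi> \<phi>'
  proof -
    have \<phi>'c: "continuous_on UNIV \<phi>'" using \<phi>(1) by (simp add: per_C1_def)
    have i': "integrable (circ l) \<phi>'"
      by (rule integrable_circ_continuous) (rule continuous_on_subset[OF \<phi>'c], simp)
    have iE: "integrable (circ l) (\<lambda>x. indicator E x * \<phi>' x)"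
    proof (rule Bochner_Integration.integrable_bound[OF i'])
      show "(\<lambda>x. indicator E x * \<phi>' x) \<in> borel_measurable (circ l)"
        using E by (intro borel_measurable_circ borel_measurable_times borel_measurable_indicator
          borel_measurable_continuous_onI \<phi>'c) simp
      show "AE x in circ l. norm (indicator E x * \<phi>' x) \<le> norm (\<phi>' x)"
        by (rule AE_I2) (simp add: indicator_def)
    qed
    have i0: "(LINT x|circ l. \<phi>' x) = 0"
    proof -
      have "(LINT x|circ l. \<phi>' x) = \<phi> l - \<phi> (-l)"
        using \<phi>(1) per_C1_continuous[OF \<phi>(1)] by (intro FTC_circ[OF l, of "{}"] i') (auto simp: per_C1_def)
      moreover have "\<phi> (-l + 2 * l) = \<phi> (-l)" using \<phi>(1) unfolding per_C1_def by blast
      ultimately show ?thesis by simp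
    qed
    have neg: "per_C1 l (\<lambda>x. - \<phi> x) (\<lambda>x. - \<phi>' x)"
      using \<phi>(1) by (auto simp: per_C1_def intro!: continuous_intros DERIV_minus)
    have 1: "ennreal (2 * l * (LINT x|circ l. F x * - \<phi>' x)) \<le> V"
      unfolding V_def by (rule torus_variation_ge[OF l iF n1m n1 neg]) (use \<phi>(2) in simp)
    have 2: "(LINT x|circ l. F x * - \<phi>' x) = 2 * nbar1 \<sigma> * (LINT x|circ l. indicator E x * \<phi>' x)"
    proof -
      have "(LINT x|circ l. F x * - \<phi>' x) = (LINT x|circ l. 2 * nbar1 \<sigma> * (indicator E x * \<phi>' x) - nbar1 \<sigma> * \<phi>' x)"
        by (rule Bochner_Integration.integral_cong) (auto simp: F_def indicator_def)
      also have "\<dots> = 2 * nbar1 \<sigma> * (LINT x|circ l. indicator E x * \<phi>' x) - nbar1 \<sigma> * (LINT x|circ l. \<phi>' x)"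
        using iE i' by simp
      finally show ?thesis using i0 by simp
    qed
    have "ennreal (2 * l * (2 * nbar1 \<sigma> * (LINT x|circ l. indicator E x * \<phi>' x))) \<le> ennreal (enn2real V)"
      using 1 V unfolding 2 by simp
    then have "2 * l * (2 * nbar1 \<sigma> * (LINT x|circ l. indicator E x * \<phi>' x)) \<le> enn2real V"
      by (simp only: ennreal_le_iff[OF enn2real_nonneg])
    then show ?thesis using l nbar1_bounds by (simp add: field_simps)
  qed
  obtain c r where jump: "jump_set l c r E"
  proof (rule jump_set_exists[OF l E E_per ne])
    show "(LINT x|circ l. indicator E x * \<phi>' x) \<le> enn2real V / (4 * l * nbar1 \<sigma>)"
      if "per_C1 l \<phi> \<phi>'" "\<And>x. \<bar>\<phi> x\<bar> \<le> 1" for \<phi> \<phi>'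
      using that by (rule M)
  qed blast
  have g2: "g \<in> torus_L2 l" using A'(3) by (simp add: torus_W12_def)
  have vm: "(\<lambda>p. v (fst p)) \<in> borel_measurable (torus l)"
    by (rule borel_measurable_torus_fst[OF v(1)])
  have iv: "integrable (circ l) v"
    by (rule integrable_circ_of_torus[OF l])
       (use integrable_cong_AE[OF _ vm v(2)] torus_L2_integrable[OF g2] in auto)
  have weak: "is_weak_dx l (\<lambda>p. v (fst p)) (\<lambda>p. - F (fst p))"
  proof (rule is_weak_dx_cong_AE[OF torus_W12_weak_dx(2)[OF A'(3)] v(2)])
    show "AE p in torus l. weak_dx l g p = - F (fst p)"
      using A'(6) n1 by eventually_elim simp
  qed (use vm g2 Ftm torus_W12_weak_dx(1)[OF A'(3)] in \<open>auto simp: torus_L2_def\<close>)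
  moreover have "(\<lambda>p::real\<times>real. - F (fst p)) = (\<lambda>p. nbar1 \<sigma> * (if fst p \<in> E then 1 else -1))"
    by (rule ext) (simp add: F_def)
  ultimately have "is_weak_dx l (\<lambda>p. v (fst p)) (\<lambda>p. nbar1 \<sigma> * (if fst p \<in> E then 1 else -1))" by simp
  from that[OF jump E_n mean v(2) iv this] show ?thesis .
qed

section \<open>The recovery sequence\<close>

context jump_set begin

lemma sdist_compose_W12:
  assumes f: "\<And>t. (f has_real_derivative f' t) (at t)" and f': "continuous_on UNIV f'"
  shows "(\<lambda>p. f (sdist (fst p))) \<in> torus_W12 l"
    and "AE p in torus l. weak_dx l (\<lambda>p. f (sdist (fst p))) p = f' (sdist (fst p)) * sslope (fst p)"
    and "AE p in torus l. weak_dy l (\<lambda>p. f (sdist (fst p))) p = 0"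
proof -
  obtain M where M: "\<And>x. \<bar>f' (sdist x) * sslope x\<bar> \<le> M"
    and m: "(\<lambda>x. f (sdist x)) \<in> borel_measurable borel" "(\<lambda>x. f' (sdist x) * sslope x) \<in> borel_measurable borel"
    and cont: "continuous_on UNIV (\<lambda>x. f (sdist x))"
    and w: "is_weak_dx l (\<lambda>p. f (sdist (fst p))) (\<lambda>p. f' (sdist (fst p)) * sslope (fst p))"
    by (rule sdist_compose_weak_dx[OF f f'], rule that)
  have d2: "(\<lambda>p. f' (sdist (fst p)) * sslope (fst p)) \<in> torus_L2 l"
    by (rule torus_L2_bounded[OF borel_measurable_torus_fst[OF m(2)], of M]) (use M in simp)
  have z2: "(\<lambda>p. 0) \<in> torus_L2 l"
    by (rule torus_L2_bounded[of _ _ 0]) auto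
  obtain C where C: "\<And>x. x \<in> {-l..l} \<Longrightarrow> \<bar>f (sdist x)\<bar> \<le> C"
    by (rule continuous_bounded_interval[OF continuous_on_subset[OF cont], of "-l" l]) auto
  have f2: "(\<lambda>p. f (sdist (fst p))) \<in> torus_L2 l"
    by (rule torus_L2_bounded[OF borel_measurable_torus_fst[OF m(1)], of C], rule AE_I2) (use C in force)
  have wy: "is_weak_dy l (\<lambda>p. f (sdist (fst p))) (\<lambda>p. 0)"
    by (rule is_weak_dy_fst[OF l_pos integrable_circ_continuous]) (rule continuous_on_subset[OF cont], simp)
  show "(\<lambda>p. f (sdist (fst p))) \<in> torus_W12 l"
    unfolding torus_W12_def using f2 d2 z2 w wy by blast
  show "AE p in torus l. weak_dx l (\<lambda>p. f (sdist (fst p))) p = f' (sdist (fst p)) * sslope (fst p)"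
    by (rule weak_dx_AE_eq[OF l_pos d2 w])
  show "AE p in torus l. weak_dy l (\<lambda>p. f (sdist (fst p))) p = 0"
    by (rule weak_dy_AE_eq[OF l_pos z2 wy])
qed

lemma AE_sgn_sdist: "AE x in circ l. sgn (sdist x) = (if x \<in> E then -1 else 1)"
  using AE_sdist_sign by eventually_elim (auto split: if_splits)

end

locale recovery = jump_set l c r E + optimal_profile \<sigma> \<theta>
  for l c r :: real and E :: "real set" and \<sigma> :: real and \<theta> :: "real \<Rightarrow> real" +
  assumes mean_zero: "(LINT x|circ l. (if x \<in> E then -1 else 1 :: real)) = 0"
begin

definition n_rec :: "real \<Rightarrow> real \<times> real \<Rightarrow> real^3" where
  "n_rec \<epsilon> p = vector [sin (\<theta> (sdist (fst p) / \<epsilon>)), 0, cos (\<theta> (sdist (fst p) / \<epsilon>))]"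

definition mean_rec :: "real \<Rightarrow> real" where
  "mean_rec \<epsilon> = (LINT x|circ l. sin (\<theta> (sdist x / \<epsilon>))) / (2 * l)"

text \<open>The derivative of the recovery potential. Adding the constant mean to
  \<open>- n1\<close> is what makes the primitive periodic; \<open>g_x + n1\<close> is then this
  constant.\<close>

definition slope_rec :: "real \<Rightarrow> real \<Rightarrow> real" where
  "slope_rec \<epsilon> x = mean_rec \<epsilon> - sin (\<theta> (sdist x / \<epsilon>))"

text \<open>Bounds the integral of \<open>speed (sdist x / \<epsilon>)\<close> in units of
  \<open>\<epsilon>\<close>: at most \<open>2 * pi\<close> from each layer, plus the tail
  \<open>pi / r\<close> on the length \<open>2 * l\<close>.\<close>

definition layer_const :: real where
  "layer_const = real njumps * (2 * pi) + 2 * l * (pi / r)"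

text \<open>The factor in \<open>sin_profile_bounds\<close>, with which \<open>speed\<close>
  controls the deviation of the first component from its limit.\<close>

definition dev_const :: real where
  "dev_const = 2 * sqrt (constA \<sigma>) / nbar1 \<sigma>"

lemma layer_const_nonneg: "0 \<le> layer_const"
  using l_pos r_pos by (simp add: layer_const_def)

lemma dev_const_nonneg: "0 \<le> dev_const"
  using nbar1_bounds constA_bounds by (simp add: dev_const_def)

lemma profile_scaled_derivative:
  assumes "0 < \<epsilon>"
  shows "((\<lambda>t. \<theta> (t / \<epsilon>)) has_real_derivative speed (t / \<epsilon>) / \<epsilon>) (at t)"
proof -
  have "((\<lambda>t. t / \<epsilon>) has_real_derivative 1 / \<epsilon>) (at t)"
    using assms by (auto intro!: derivative_eq_intros)
  from DERIV_chain2[OF ode this] show ?thesis by (simp add: speed_def)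
qed

lemma tension_scaled_derivative:
  assumes "0 < \<epsilon>"
  shows "((\<lambda>t. tension (t / \<epsilon>)) has_real_derivative (speed (t / \<epsilon>))\<^sup>2 / \<epsilon>) (at t)"
proof -
  have "((\<lambda>t. t / \<epsilon>) has_real_derivative 1 / \<epsilon>) (at t)"
    using assms by (auto intro!: derivative_eq_intros)
  from DERIV_chain2[OF tension_derivative this] show ?thesis by simp
qed

lemma speed_scaled_continuous: "\<epsilon> \<noteq> 0 \<Longrightarrow> continuous_on S (\<lambda>t. speed (t / \<epsilon>))"
  by (intro continuous_on_compose2[OF speed_continuous[of UNIV]] continuous_intros) auto

lemma profile_scaled_continuous: "\<epsilon> \<noteq> 0 \<Longrightarrow> continuous_on S (\<lambda>t. \<theta> (t / \<epsilon>))"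
  by (intro continuous_on_compose2[OF profile_continuous[of UNIV]] continuous_intros) auto

lemma speed_even: "speed (- t) = speed t"
  by (simp add: speed_def odd)

lemma speed_sdist:
  assumes "0 < \<epsilon>"
  shows "speed (sdist x / \<epsilon>) = (if jdist x < r then speed (jdist x / \<epsilon>) else speed (r / \<epsilon>))"
  using speed_even[of "jdist x / \<epsilon>"] speed_even[of "r / \<epsilon>"] by (auto simp: sdist_def min_def)

lemma speed_r_le:
  assumes "0 < \<epsilon>" shows "speed (r / \<epsilon>) \<le> pi / r * \<epsilon>"
  using speed_le[of "r / \<epsilon>"] assms r_pos by simp

lemma speed_sdist_continuous: "0 < \<epsilon> \<Longrightarrow> continuous_on S (\<lambda>x. speed (sdist x / \<epsilon>))"
  by (intro continuous_on_compose2[OF speed_scaled_continuous[of \<epsilon> UNIV] sdist_continuous]) auto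

lemma integral_const_circ: "(LINT x|circ l. k) = 2 * l * (k :: real)"
  using l_pos by (simp add: measure_circ_space)

text \<open>Controls the \<open>L1\<close> error, the mean and the error of the potential at once,
  since all deviations are bounded by multiples of \<open>speed\<close>.\<close>

lemma integral_speed_le:
  assumes \<epsilon>: "0 < \<epsilon>"
  shows "integrable (circ l) (\<lambda>x. speed (sdist x / \<epsilon>))"
    and "(LINT x|circ l. speed (sdist x / \<epsilon>)) \<le> layer_const * \<epsilon>"
proof -
  show i: "integrable (circ l) (\<lambda>x. speed (sdist x / \<epsilon>))"
    by (intro integrable_circ_continuous speed_sdist_continuous \<epsilon>)
  have g: "continuous_on UNIV (\<lambda>t. speed (t / \<epsilon>))" using \<epsilon> by (intro speed_scaled_continuous) simp
  have ge: "speed (- t / \<epsilon>) = speed (t / \<epsilon>)" for t using speed_even[of "t / \<epsilon>"] by simp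
  have \<Phi>: "((\<lambda>t. \<epsilon> * \<theta> (t / \<epsilon>)) has_real_derivative speed (t / \<epsilon>)) (at t)" for t
    using DERIV_cmult[OF profile_scaled_derivative[OF \<epsilon>], of \<epsilon> t] \<epsilon> by simp
  note layer = layer_integral[OF g ge \<Phi>]
  have ic: "integrable (circ l) (\<lambda>x. speed (r / \<epsilon>))" by (rule integrable_circ_continuous) simp
  \<comment> \<open>Outside the layers the argument is frozen at distance \<open>r\<close>; adding
    its speed on the whole circle is a crude but sufficient majorant.\<close>
  have "(LINT x|circ l. speed (sdist x / \<epsilon>)) \<le>
      (LINT x|circ l. (if jdist x < r then speed (jdist x / \<epsilon>) else 0) + speed (r / \<epsilon>))"
    using speed_pos by (intro integral_mono i Bochner_Integration.integrable_add layer(1) ic)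
      (auto simp: speed_sdist[OF \<epsilon>] intro: less_imp_le)
  also have "\<dots> = real njumps * (\<epsilon> * \<theta> (r / \<epsilon>) - \<epsilon> * \<theta> (- r / \<epsilon>)) + 2 * l * speed (r / \<epsilon>)"
    using layer ic by (simp only: Bochner_Integration.integral_add integral_const_circ njumps_def)
  also have "\<epsilon> * \<theta> (r / \<epsilon>) - \<epsilon> * \<theta> (- r / \<epsilon>) = 2 * \<theta> (r / \<epsilon>) * \<epsilon>" using odd[of "r / \<epsilon>"] by simp
  also have "real njumps * (2 * \<theta> (r / \<epsilon>) * \<epsilon>) + 2 * l * speed (r / \<epsilon>)
      \<le> real njumps * (2 * pi * \<epsilon>) + 2 * l * (pi / r * \<epsilon>)"
  proof -
    have "\<theta> (r / \<epsilon>) \<le> pi" using less[of "r / \<epsilon>"] arccos_constA_bounds r_pos \<epsilon> by simp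
    then show ?thesis using \<epsilon> l_pos speed_r_le[OF \<epsilon>] by (intro add_mono mult_left_mono mult_right_mono) auto
  qed
  also have "\<dots> = layer_const * \<epsilon>" by (simp add: layer_const_def algebra_simps)
  finally show "(LINT x|circ l. speed (sdist x / \<epsilon>)) \<le> layer_const * \<epsilon>" .
qed

lemma sin_profile_dev:
  "\<bar>sin (\<theta> t) - nbar1 \<sigma> * sgn t\<bar> \<le> dev_const * speed t"
proof -
  have pos: "\<bar>sin (\<theta> t) - nbar1 \<sigma> * sgn t\<bar> \<le> dev_const * speed t" if "0 < t" for t
    using sin_profile_bounds[of t] that by (simp add: dev_const_def)
  show ?thesis
  proof (cases t "0 :: real" rule: linorder_cases)
    case less
    then show ?thesis using pos[of "- t"] by (simp add: odd speed_even sgn_if abs_minus_commute)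
  next
    case equal
    then show ?thesis using dev_const_nonneg speed_pos[of 0] by (simp add: profile_0)
  qed (rule pos)
qed

lemma sin_sdist_dev:
  assumes "0 < \<epsilon>"
  shows "\<bar>sin (\<theta> (sdist x / \<epsilon>)) - nbar1 \<sigma> * sgn (sdist x)\<bar> \<le> dev_const * speed (sdist x / \<epsilon>)"
proof -
  have e: "sgn (sdist x / \<epsilon>) = sgn (sdist x)" using assms by (simp add: sgn_divide)
  show ?thesis using sin_profile_dev[of "sdist x / \<epsilon>"] unfolding e .
qed

lemma sin_sdist_continuous: "0 < \<epsilon> \<Longrightarrow> continuous_on S (\<lambda>x. sin (\<theta> (sdist x / \<epsilon>)))"
  by (intro continuous_on_sin continuous_on_compose2[OF profile_scaled_continuous[of \<epsilon> UNIV] sdist_continuous]) auto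

lemma integral_sgn_sdist: "(LINT x|circ l. sgn (sdist x)) = 0"
proof -
  have "(\<lambda>x. if x \<in> E then -1 else 1 :: real) \<in> borel_measurable borel" using E_borel by measurable
  then have "(LINT x|circ l. sgn (sdist x)) = (LINT x|circ l. (if x \<in> E then -1 else 1 :: real))"
    by (intro integral_cong_AE AE_sgn_sdist borel_measurable_circ sgn_sdist_borel)
  then show ?thesis using mean_zero by simp
qed

text \<open>The limit \<open>nbar1 \<sigma> * sgn (sdist x)\<close> has mean zero, so only the
  deviation from it contributes.\<close>

lemma mean_rec_le:
  assumes \<epsilon>: "0 < \<epsilon>"
  shows "2 * l * \<bar>mean_rec \<epsilon>\<bar> \<le> dev_const * layer_const * \<epsilon>"
proof -
  have i: "integrable (circ l) (\<lambda>x. sin (\<theta> (sdist x / \<epsilon>)))"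
    by (intro integrable_circ_continuous sin_sdist_continuous \<epsilon>)
  have z: "(LINT x|circ l. nbar1 \<sigma> * sgn (sdist x)) = 0" using integral_sgn_sdist by simp
  have i2: "integrable (circ l) (\<lambda>x. nbar1 \<sigma> * sgn (sdist x))"
    by (rule integrable_mult_right[OF integrable_sgn_sdist])
  have "2 * l * mean_rec \<epsilon> = (LINT x|circ l. sin (\<theta> (sdist x / \<epsilon>)) - nbar1 \<sigma> * sgn (sdist x))"
    using i i2 z l_pos by (simp add: mean_rec_def)
  then have "2 * l * \<bar>mean_rec \<epsilon>\<bar> = \<bar>LINT x|circ l. sin (\<theta> (sdist x / \<epsilon>)) - nbar1 \<sigma> * sgn (sdist x)\<bar>"
    using l_pos by (metis abs_mult abs_of_pos mult_pos_pos zero_less_numeral)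
  also have "\<dots> \<le> (LINT x|circ l. \<bar>sin (\<theta> (sdist x / \<epsilon>)) - nbar1 \<sigma> * sgn (sdist x)\<bar>)"
    by (rule integral_abs_bound)
  also have "\<dots> \<le> (LINT x|circ l. dev_const * speed (sdist x / \<epsilon>))"
    using i i2 integral_speed_le(1)[OF \<epsilon>] sin_sdist_dev[OF \<epsilon>]
    by (intro integral_mono integrable_abs Bochner_Integration.integrable_diff integrable_mult_right) auto
  also have "\<dots> = dev_const * (LINT x|circ l. speed (sdist x / \<epsilon>))" by simp
  also have "\<dots> \<le> dev_const * (layer_const * \<epsilon>)"
    by (intro mult_left_mono integral_speed_le(2)[OF \<epsilon>] dev_const_nonneg)
  finally show ?thesis by (simp add: mult.assoc)
qed

lemma slope_rec_primitive:
  assumes \<epsilon>: "0 < \<epsilon>"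
  obtains G where "per_C1 l G (slope_rec \<epsilon>)" "G (- l) = 0"
proof -
  have cont: "continuous_on S (slope_rec \<epsilon>)" for S
    unfolding slope_rec_def[abs_def] by (intro continuous_intros sin_sdist_continuous \<epsilon>)
  have per: "slope_rec \<epsilon> (x + 2 * l) = slope_rec \<epsilon> x" for x by (simp add: slope_rec_def sdist_per)
  have i: "integrable (circ l) (slope_rec \<epsilon>)" by (intro integrable_circ_continuous cont)
  have "integrable (circ l) (\<lambda>x. sin (\<theta> (sdist x / \<epsilon>)))" "integrable (circ l) (\<lambda>x. mean_rec \<epsilon>)"
    by (intro integrable_circ_continuous sin_sdist_continuous \<epsilon> continuous_on_const)+
  then have "(LINT x|circ l. slope_rec \<epsilon> x) = 0"
    using l_pos unfolding slope_rec_def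
    by (subst Bochner_Integration.integral_diff) (auto simp: integral_const_circ mean_rec_def measure_circ_space)
  with integral_circ_HK[OF i] have "(slope_rec \<epsilon> has_integral 0) {-l..-l + 2 * l}" by simp
  from per_C1_primitive[OF l_pos cont per this] show ?thesis using that by blast
qed

text \<open>The potential of the limit configuration, normalised to vanish at \<open>-l\<close> like
  the primitives \<open>G\<close> of \<open>slope_rec\<close>.\<close>

definition g_lim :: "real \<Rightarrow> real" where
  "g_lim x = integral {-l..x} (\<lambda>y. - nbar1 \<sigma> * sgn (sdist y))"

lemma g_lim_weak_dx:
  shows "continuous_on {-l..l} g_lim"
    and "is_weak_dx l (\<lambda>p. g_lim (fst p)) (\<lambda>p. - nbar1 \<sigma> * sgn (sdist (fst p)))"
proof -
  let ?h = "\<lambda>y. - nbar1 \<sigma> * sgn (sdist y)"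
  have i: "integrable (circ l) ?h" by (rule integrable_mult_right[OF integrable_sgn_sdist])
  then have io: "?h integrable_on {-l..l}" using integral_circ_HK by blast
  show cont: "continuous_on {-l..l} g_lim"
    unfolding g_lim_def[abs_def] by (rule indefinite_integral_continuous_1[OF io])
  have "(LINT x|circ l. ?h x) = 0" using integral_sgn_sdist by simp
  with integral_unique[OF integral_circ_HK[OF i]] have "integral {-l..l} ?h = 0" by (simp only:)
  then have end_eq: "g_lim (-l) = g_lim l" by (simp add: g_lim_def)
  \<comment> \<open>Off the jumps \<open>sdist\<close> is continuous and nonzero, so its sign is
    continuous there.\<close>
  have deriv: "(g_lim has_real_derivative ?h x) (at x)" if x: "x \<in> {-l<..<l} - (B \<inter> {-l..l})" for x
  proof -
    have xB: "x \<notin> B" using x by auto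
    then have "sdist x \<noteq> 0" using sdist_sign[of x] by (auto simp: ess_boundary_def)
    moreover have "isCont sdist x" using sdist_continuous[of UNIV] by (simp add: continuous_on_eq_continuous_at)
    ultimately have "isCont ?h x" by (intro continuous_intros) auto
    then have "continuous (at x within {-l..l} - {}) ?h" by (rule continuous_at_imp_continuous_at_within)
    from integral_has_vector_derivative_continuous_at[OF io _ _ this]
    have "(g_lim has_vector_derivative ?h x) (at x within {-l..l})"
      using x unfolding g_lim_def[abs_def] by simp
    moreover have "at x within {-l..l} = at x" using x by (intro at_within_interior) simp
    ultimately show ?thesis by (simp only: has_real_derivative_iff_has_vector_derivative)
  qed
  have hm: "?h \<in> borel_measurable borel" by (intro borel_measurable_times borel_measurable_const sgn_sdist_borel)
  have hb: "\<bar>?h x\<bar> \<le> nbar1 \<sigma>" for x using nbar1_bounds by (simp add: abs_mult sgn_if)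
  show "is_weak_dx l (\<lambda>p. g_lim (fst p)) (\<lambda>p. - nbar1 \<sigma> * sgn (sdist (fst p)))"
    by (rule is_weak_dx_fst[OF l_pos finite_B_interval hm hb cont end_eq deriv])
qed

text \<open>Both primitives vanish at \<open>-l\<close>, so they differ by at most the integral of
  the difference of the slopes. The mean and the deviation of the profile contribute equally, hence
  the factor 2.\<close>

lemma primitive_dev:
  assumes \<epsilon>: "0 < \<epsilon>" and G: "per_C1 l G (slope_rec \<epsilon>)" "G (- l) = 0" and x: "x \<in> {-l..l}"
  shows "\<bar>G x - g_lim x\<bar> \<le> 2 * dev_const * layer_const * \<epsilon>"
proof -
  let ?h = "\<lambda>y. - nbar1 \<sigma> * sgn (sdist y)"
  let ?b = "\<lambda>y. \<bar>mean_rec \<epsilon>\<bar> + dev_const * speed (sdist y / \<epsilon>)"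
  have ih: "?h integrable_on {-l..l}"
    using integral_circ_HK[OF integrable_mult_right[OF integrable_sgn_sdist, of "- nbar1 \<sigma>"]] by blast
  then have ihx: "?h integrable_on {-l..x}" by (rule integrable_on_subinterval) (use x in auto)
  have bc: "continuous_on S ?b" for S by (intro continuous_intros speed_sdist_continuous \<epsilon>)
  have ib: "integrable (circ l) ?b" by (intro integrable_circ_continuous bc)
  have b0: "0 \<le> ?b y" for y using dev_const_nonneg speed_pos[of "sdist y / \<epsilon>"] by simp
  have "(slope_rec \<epsilon> has_integral (G x - G (-l))) {-l..x}"
    using x G(1) by (intro fundamental_theorem_of_calculus)
      (auto simp: per_C1_def has_real_derivative_iff_has_vector_derivative[symmetric] intro: has_field_derivative_at_within)
  then have Gx: "(slope_rec \<epsilon> has_integral G x) {-l..x}" using G(2) by simp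
  have "((\<lambda>y. slope_rec \<epsilon> y - ?h y) has_integral (G x - g_lim x)) {-l..x}"
    unfolding g_lim_def by (intro has_integral_diff Gx integrable_integral ihx)
  moreover have bx: "?b integrable_on {-l..x}" by (intro integrable_continuous_real bc)
  ultimately have "\<bar>G x - g_lim x\<bar> \<le> integral {-l..x} ?b"
  proof -
    assume 1: "((\<lambda>y. slope_rec \<epsilon> y - ?h y) has_integral (G x - g_lim x)) {-l..x}"
    have "norm (integral {-l..x} (\<lambda>y. slope_rec \<epsilon> y - ?h y)) \<le> integral {-l..x} ?b"
    proof (rule integral_norm_bound_integral[OF _ bx])
      show "(\<lambda>y. slope_rec \<epsilon> y - ?h y) integrable_on {-l..x}" using 1 by blast
      show "norm (slope_rec \<epsilon> y - ?h y) \<le> ?b y" for y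
        using sin_sdist_dev[OF \<epsilon>, of y] by (simp add: slope_rec_def)
    qed
    then show ?thesis using 1 by (simp add: integral_unique)
  qed
  also have "\<dots> \<le> integral {-l..l} ?b"
    using x b0 by (intro integral_subset_le bx integrable_continuous_real bc) auto
  also have "\<dots> = (LINT y|circ l. ?b y)"
    using integral_circ_HK[OF ib] by (rule integral_unique)
  also have "\<dots> = 2 * l * \<bar>mean_rec \<epsilon>\<bar> + dev_const * (LINT y|circ l. speed (sdist y / \<epsilon>))"
  proof -
    have "integrable (circ l) (\<lambda>x. \<bar>mean_rec \<epsilon>\<bar>)" by (rule integrable_circ_continuous) simp
    then show ?thesis
      using integral_speed_le(1)[OF \<epsilon>] by (subst Bochner_Integration.integral_add) (auto simp: integral_const_circ measure_circ_space l_pos less_imp_le)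
  qed
  also have "\<dots> \<le> dev_const * layer_const * \<epsilon> + dev_const * (layer_const * \<epsilon>)"
    by (intro add_mono mean_rec_le \<epsilon> mult_left_mono integral_speed_le(2) dev_const_nonneg)
  finally show ?thesis by (simp add: algebra_simps)
qed

text \<open>A weak derivative determines the potential only up to a constant; the recovery sequence
  has to carry the constant of the given \<open>g\<close> along.\<close>

lemma limit_potential:
  assumes v: "integrable (circ l) v"
    and weak: "is_weak_dx l (\<lambda>p. v (fst p)) (\<lambda>p. nbar1 \<sigma> * (if fst p \<in> E then 1 else -1))"
  obtains k where "AE x in circ l. v x = k + g_lim x"
proof -
  have ig: "integrable (circ l) g_lim" by (rule integrable_circ_continuous[OF g_lim_weak_dx(1)])
  have iq: "integrable (circ l) (\<lambda>x. v x - g_lim x)" by (intro Bochner_Integration.integrable_diff v ig)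
  have "is_weak_dx l (\<lambda>p. v (fst p) - g_lim (fst p)) (\<lambda>p. 0)"
    unfolding is_weak_dx_def
  proof
    fix \<phi> assume \<phi>: "\<phi> \<in> torus_C1 l"
    have i: "integrable (torus l) (\<lambda>p. v (fst p) * part_x \<phi> p)" "integrable (torus l) (\<lambda>p. g_lim (fst p) * part_x \<phi> p)"
      by (intro integrable_torus_times_continuous continuous_part_x[OF \<phi>] integral_torus_fst(1)[OF l_pos] v ig)+
    have "(LINT p|torus l. (v (fst p) - g_lim (fst p)) * part_x \<phi> p)
       = (LINT p|torus l. v (fst p) * part_x \<phi> p) - (LINT p|torus l. g_lim (fst p) * part_x \<phi> p)"
      unfolding left_diff_distrib by (rule Bochner_Integration.integral_diff[OF i])
    also have "\<dots> = - (LINT p|torus l. nbar1 \<sigma> * (if fst p \<in> E then 1 else -1) * \<phi> p)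
       + (LINT p|torus l. - nbar1 \<sigma> * sgn (sdist (fst p)) * \<phi> p)"
      using weak g_lim_weak_dx(2) \<phi> unfolding is_weak_dx_def by force
    also have "(LINT p|torus l. nbar1 \<sigma> * (if fst p \<in> E then 1 else -1) * \<phi> p)
       = (LINT p|torus l. - nbar1 \<sigma> * sgn (sdist (fst p)) * \<phi> p)"
    proof (rule integral_cong_AE)
      have \<phi>m: "\<phi> \<in> borel_measurable (torus l)"
        by (intro borel_measurable_torus borel_measurable_continuous_onI torus_C1_continuous[OF \<phi>])
      have "(\<lambda>x. nbar1 \<sigma> * (if x \<in> E then 1 else -1)) \<in> borel_measurable borel" using E_borel by measurable
      from borel_measurable_times[OF borel_measurable_torus_fst[OF this] \<phi>m]
      show "(\<lambda>p. nbar1 \<sigma> * (if fst p \<in> E then 1 else -1) * \<phi> p) \<in> borel_measurable (torus l)" .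
      have "(\<lambda>x. - nbar1 \<sigma> * sgn (sdist x)) \<in> borel_measurable borel"
        by (intro borel_measurable_times borel_measurable_const sgn_sdist_borel)
      from borel_measurable_times[OF borel_measurable_torus_fst[OF this] \<phi>m]
      show "(\<lambda>p. - nbar1 \<sigma> * sgn (sdist (fst p)) * \<phi> p) \<in> borel_measurable (torus l)" .
      show "AE p in torus l. nbar1 \<sigma> * (if fst p \<in> E then 1 else -1) * \<phi> p = - nbar1 \<sigma> * sgn (sdist (fst p)) * \<phi> p"
        using AE_torus_fst[OF AE_sgn_sdist] by eventually_elim simp
    qed
    finally show "(LINT p|torus l. (v (fst p) - g_lim (fst p)) * part_x \<phi> p) = - (LINT p|torus l. 0 * \<phi> p)" by simp
  qed
  from du_Bois_Reymond[OF l_pos iq this] obtain k where "AE x in circ l. v x - g_lim x = k" by blast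
  then have "AE x in circ l. v x = k + g_lim x" by eventually_elim simp
  then show ?thesis by (rule that)
qed

end

section \<open>Energy of the recovery sequence\<close>

context recovery begin

text \<open>The terms are the gradient, the potential and the square of \<open>g_x + n1\<close>; the
  fourth term of the energy vanishes. The gradient lives in the layers only, where
  \<open>sslope\<close> has square 1, while the potential also has a tail outside.\<close>

definition energy_density :: "real \<Rightarrow> real \<Rightarrow> real" where
  "energy_density \<epsilon> x = (if jdist x < r then (speed (jdist x / \<epsilon>))\<^sup>2 / \<epsilon> else 0)
     + (speed (sdist x / \<epsilon>))\<^sup>2 / \<epsilon> + (mean_rec \<epsilon>)\<^sup>2 / \<epsilon>"

text \<open>Gradient and potential each yield \<open>2 * tension (r / \<epsilon>)\<close> per jump.
  The error consists of the tail of the potential, at most \<open>(pi / r)^2 * \<epsilon>\<close>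
  per unit length, and of the squared mean divided by \<open>\<epsilon>\<close>.\<close>

lemma energy_density_integral:
  assumes \<epsilon>: "0 < \<epsilon>"
  shows "integrable (circ l) (energy_density \<epsilon>)"
    and "\<bar>(LINT x|circ l. energy_density \<epsilon> x) - 4 * real njumps * tension (r / \<epsilon>)\<bar>
      \<le> (2 * l * (pi / r)\<^sup>2 + 2 * l * (dev_const * layer_const / (2 * l))\<^sup>2) * \<epsilon>"
proof -
  let ?g = "\<lambda>t. (speed (t / \<epsilon>))\<^sup>2 / \<epsilon>"
  have g: "continuous_on UNIV ?g" using \<epsilon> by (intro continuous_intros speed_scaled_continuous) auto
  have ge: "(speed (- t / \<epsilon>))\<^sup>2 / \<epsilon> = (speed (t / \<epsilon>))\<^sup>2 / \<epsilon>" for t using speed_even[of "t / \<epsilon>"] by simp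
  note layer = layer_integral[OF g ge tension_scaled_derivative[OF \<epsilon>], folded njumps_def]
  define L where "L x = (if jdist x < r then (speed (jdist x / \<epsilon>))\<^sup>2 / \<epsilon> else 0)" for x
  have iL: "integrable (circ l) L" unfolding L_def by (rule layer(1))
  have L_val: "(LINT x|circ l. L x) = 2 * real njumps * tension (r / \<epsilon>)"
    using layer(2) tension_odd[of "r / \<epsilon>"] by (simp add: L_def)
  have iS: "integrable (circ l) (\<lambda>x. (speed (sdist x / \<epsilon>))\<^sup>2 / \<epsilon>)"
    using \<epsilon> by (intro integrable_circ_continuous continuous_intros speed_sdist_continuous) auto
  have ic: "integrable (circ l) (\<lambda>x. k :: real)" for k by (rule integrable_circ_continuous) simp
  have eq: "energy_density \<epsilon> = (\<lambda>x. L x + (speed (sdist x / \<epsilon>))\<^sup>2 / \<epsilon> + (mean_rec \<epsilon>)\<^sup>2 / \<epsilon>)"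
    by (rule ext) (simp add: energy_density_def L_def)
  show "integrable (circ l) (energy_density \<epsilon>)"
    unfolding eq by (intro Bochner_Integration.integrable_add iL iS ic)
  have val: "(LINT x|circ l. energy_density \<epsilon> x) = 2 * real njumps * tension (r / \<epsilon>)
      + (LINT x|circ l. (speed (sdist x / \<epsilon>))\<^sup>2 / \<epsilon>) + 2 * l * ((mean_rec \<epsilon>)\<^sup>2 / \<epsilon>)"
    unfolding eq
    by (simp only: Bochner_Integration.integral_add Bochner_Integration.integrable_add iL iS ic L_val integral_const_circ)
  have sr: "(speed (r / \<epsilon>))\<^sup>2 / \<epsilon> \<le> (pi / r)\<^sup>2 * \<epsilon>"
  proof -
    have "(speed (r / \<epsilon>))\<^sup>2 \<le> (pi / r * \<epsilon>)\<^sup>2"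
      using speed_r_le[OF \<epsilon>] speed_pos[of "r / \<epsilon>"] by (intro power_mono) auto
    then have "(speed (r / \<epsilon>))\<^sup>2 / \<epsilon> \<le> (pi / r * \<epsilon>)\<^sup>2 / \<epsilon>" using \<epsilon> by (intro divide_right_mono) auto
    also have "\<dots> = (pi / r)\<^sup>2 * \<epsilon>" using \<epsilon> by (simp only: power_mult_distrib) (simp add: power2_eq_square)
    finally show ?thesis .
  qed
  have low: "(LINT x|circ l. L x) \<le> (LINT x|circ l. (speed (sdist x / \<epsilon>))\<^sup>2 / \<epsilon>)"
    using \<epsilon> by (intro integral_mono iL iS) (auto simp: L_def speed_sdist[OF \<epsilon>])
  have up: "(LINT x|circ l. (speed (sdist x / \<epsilon>))\<^sup>2 / \<epsilon>) \<le> (LINT x|circ l. L x) + 2 * l * ((pi / r)\<^sup>2 * \<epsilon>)"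
  proof -
    have "(LINT x|circ l. (speed (sdist x / \<epsilon>))\<^sup>2 / \<epsilon>) \<le> (LINT x|circ l. L x + (pi / r)\<^sup>2 * \<epsilon>)"
      using \<epsilon> sr by (intro integral_mono iS Bochner_Integration.integrable_add iL ic)
        (auto simp: L_def speed_sdist[OF \<epsilon>])
    then show ?thesis by (simp only: Bochner_Integration.integral_add iL ic integral_const_circ)
  qed
  have m: "(mean_rec \<epsilon>)\<^sup>2 / \<epsilon> \<le> (dev_const * layer_const / (2 * l))\<^sup>2 * \<epsilon>"
  proof -
    have "\<bar>mean_rec \<epsilon>\<bar> \<le> dev_const * layer_const / (2 * l) * \<epsilon>"
      using mean_rec_le[OF \<epsilon>] l_pos by (simp add: field_simps)
    then have "(mean_rec \<epsilon>)\<^sup>2 \<le> (dev_const * layer_const / (2 * l) * \<epsilon>)\<^sup>2"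
      by (metis abs_ge_zero power2_abs power_mono)
    then have "(mean_rec \<epsilon>)\<^sup>2 / \<epsilon> \<le> (dev_const * layer_const / (2 * l) * \<epsilon>)\<^sup>2 / \<epsilon>" using \<epsilon> by (intro divide_right_mono) auto
    also have "\<dots> = (dev_const * layer_const / (2 * l))\<^sup>2 * \<epsilon>"
      using \<epsilon> by (simp only: power_mult_distrib[of _ \<epsilon>]) (simp add: power2_eq_square)
    finally show ?thesis .
  qed
  have m2: "2 * l * ((mean_rec \<epsilon>)\<^sup>2 / \<epsilon>) \<le> 2 * l * ((dev_const * layer_const / (2 * l))\<^sup>2 * \<epsilon>)"
    using m l_pos by (intro mult_left_mono) auto
  have m0: "0 \<le> 2 * l * ((mean_rec \<epsilon>)\<^sup>2 / \<epsilon>)" using l_pos \<epsilon> by simp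
  have "\<bar>(LINT x|circ l. energy_density \<epsilon> x) - 4 * real njumps * tension (r / \<epsilon>)\<bar>
      \<le> 2 * l * ((pi / r)\<^sup>2 * \<epsilon>) + 2 * l * ((dev_const * layer_const / (2 * l))\<^sup>2 * \<epsilon>)"
    using val low up m2 m0 unfolding L_val by linarith
  then show "\<bar>(LINT x|circ l. energy_density \<epsilon> x) - 4 * real njumps * tension (r / \<epsilon>)\<bar>
      \<le> (2 * l * (pi / r)\<^sup>2 + 2 * l * (dev_const * layer_const / (2 * l))\<^sup>2) * \<epsilon>"
    by (simp add: distrib_right mult.assoc)
qed

lemma n_rec_components:
  assumes \<epsilon>: "0 < \<epsilon>"
  shows "(\<lambda>p. n_rec \<epsilon> p $ i) \<in> torus_W12 l"
    and "AE p in torus l. grad_sq l (n_rec \<epsilon>) p = (speed (sdist (fst p) / \<epsilon>) / \<epsilon>)\<^sup>2 * (sslope (fst p))\<^sup>2"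
proof -
  have e0: "\<epsilon> \<noteq> 0" using \<epsilon> by simp
  define d where "d t = speed (t / \<epsilon>) / \<epsilon>" for t
  have dc: "continuous_on UNIV d" unfolding d_def[abs_def]
    by (intro continuous_intros speed_scaled_continuous) (use e0 in auto)
  note pd = profile_scaled_derivative[OF \<epsilon>, folded d_def]
  note pc = profile_scaled_continuous[OF e0, of UNIV]
  have d1: "((\<lambda>t. sin (\<theta> (t / \<epsilon>))) has_real_derivative cos (\<theta> (t / \<epsilon>)) * d t) (at t)" for t
    by (rule DERIV_chain2[OF DERIV_sin pd])
  have d3: "((\<lambda>t. cos (\<theta> (t / \<epsilon>))) has_real_derivative - sin (\<theta> (t / \<epsilon>)) * d t) (at t)" for t
    by (rule DERIV_chain2[OF DERIV_cos pd])
  have d2: "((\<lambda>t. 0) has_real_derivative (0 :: real)) (at t)" for t by simp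
  have c1: "continuous_on UNIV (\<lambda>t. cos (\<theta> (t / \<epsilon>)) * d t)" by (intro continuous_intros pc dc)
  have c3: "continuous_on UNIV (\<lambda>t. - sin (\<theta> (t / \<epsilon>)) * d t)" by (intro continuous_intros pc dc)
  have c2: "continuous_on UNIV (\<lambda>t. 0 :: real)" by simp
  note w1 = sdist_compose_W12[OF d1 c1] and w2 = sdist_compose_W12[OF d2 c2] and w3 = sdist_compose_W12[OF d3 c3]
  have comp: "(\<lambda>p. n_rec \<epsilon> p $ 1) = (\<lambda>p. sin (\<theta> (sdist (fst p) / \<epsilon>)))"
    "(\<lambda>p. n_rec \<epsilon> p $ 2) = (\<lambda>p. 0)" "(\<lambda>p. n_rec \<epsilon> p $ 3) = (\<lambda>p. cos (\<theta> (sdist (fst p) / \<epsilon>)))"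
    by (simp_all add: n_rec_def)
  show "(\<lambda>p. n_rec \<epsilon> p $ i) \<in> torus_W12 l"
    using exhaust_3[of i] w1(1) w2(1) w3(1) comp by metis
  show "AE p in torus l. grad_sq l (n_rec \<epsilon>) p = (speed (sdist (fst p) / \<epsilon>) / \<epsilon>)\<^sup>2 * (sslope (fst p))\<^sup>2"
    using w1(2,3) w2(2,3) w3(2,3)
  proof eventually_elim
    case (elim p)
    let ?t = "\<theta> (sdist (fst p) / \<epsilon>)" and ?d = "d (sdist (fst p))" and ?s = "sslope (fst p)"
    have "grad_sq l (n_rec \<epsilon>) p = (cos ?t * ?d * ?s)\<^sup>2 + (- sin ?t * ?d * ?s)\<^sup>2"
      using elim by (simp add: grad_sq_def sum_3 comp)
    also have "\<dots> = ((cos ?t)\<^sup>2 + (sin ?t)\<^sup>2) * (?d\<^sup>2 * ?s\<^sup>2)"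
      by (simp only: power_mult_distrib power2_minus distrib_right mult.assoc)
    finally show ?case by (simp add: d_def)
  qed
qed

lemma primitive_W12:
  assumes \<epsilon>: "0 < \<epsilon>" and G: "per_C1 l G (slope_rec \<epsilon>)"
  shows "(\<lambda>p. k + G (fst p)) \<in> torus_W12 l"
    and "AE p in torus l. weak_dx l (\<lambda>p. k + G (fst p)) p = slope_rec \<epsilon> (fst p)"
    and "AE p in torus l. weak_dy l (\<lambda>p. k + G (fst p)) p = 0"
proof -
  let ?w = "\<lambda>x. k + G x"
  have wc: "continuous_on S ?w" for S by (intro continuous_intros per_C1_continuous[OF G])
  have sc: "continuous_on UNIV (slope_rec \<epsilon>)" using G by (simp add: per_C1_def)
  obtain C where C: "\<And>x. x \<in> {-l..l} \<Longrightarrow> \<bar>?w x\<bar> \<le> C"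
    by (rule continuous_bounded_interval[OF continuous_on_subset[OF wc], of "-l" l]) auto
  obtain M where M: "\<And>x. x \<in> {-l..l} \<Longrightarrow> \<bar>slope_rec \<epsilon> x\<bar> \<le> M"
    by (rule continuous_bounded_interval[OF continuous_on_subset[OF sc], of "-l" l]) auto
  have w2: "(\<lambda>p. ?w (fst p)) \<in> torus_L2 l"
    by (rule torus_L2_bounded[OF borel_measurable_torus_fst[OF borel_measurable_continuous_onI[OF wc]], of C], rule AE_I2) (use C in force)
  have d2: "(\<lambda>p. slope_rec \<epsilon> (fst p)) \<in> torus_L2 l"
    by (rule torus_L2_bounded[OF borel_measurable_torus_fst[OF borel_measurable_continuous_onI[OF sc]], of M], rule AE_I2) (use M in force)
  have z2: "(\<lambda>p. 0) \<in> torus_L2 l" by (rule torus_L2_bounded[of _ _ 0]) auto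
  have wx: "is_weak_dx l (\<lambda>p. ?w (fst p)) (\<lambda>p. slope_rec \<epsilon> (fst p))"
  proof (rule is_weak_dx_fst[OF l_pos, where K = "{}" and M = M])
    show "slope_rec \<epsilon> \<in> borel_measurable borel" by (rule borel_measurable_continuous_onI[OF sc])
    show "\<bar>slope_rec \<epsilon> x\<bar> \<le> M" if "x \<in> {-l..<l}" for x using M that by simp
    have "G (-l + 2 * l) = G (-l)" using G unfolding per_C1_def by blast
    then show "?w (-l) = ?w l" by simp
    show "(?w has_real_derivative slope_rec \<epsilon> x) (at x)" if "x \<in> {-l<..<l} - {}" for x
      using G DERIV_add[OF DERIV_const[of k], of G "slope_rec \<epsilon> x" x UNIV] by (simp add: per_C1_def)
  qed (simp_all add: wc)
  have wy: "is_weak_dy l (\<lambda>p. ?w (fst p)) (\<lambda>p. 0)"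
    by (rule is_weak_dy_fst[OF l_pos integrable_circ_continuous[OF wc]])
  show "(\<lambda>p. k + G (fst p)) \<in> torus_W12 l"
    unfolding torus_W12_def using w2 d2 z2 wx wy by blast
  show "AE p in torus l. weak_dx l (\<lambda>p. k + G (fst p)) p = slope_rec \<epsilon> (fst p)"
    by (rule weak_dx_AE_eq[OF l_pos d2 wx])
  show "AE p in torus l. weak_dy l (\<lambda>p. k + G (fst p)) p = 0"
    by (rule weak_dy_AE_eq[OF l_pos z2 wy])
qed

lemma norm_n_rec: "norm (n_rec \<epsilon> p) = 1"
proof -
  have "(norm (n_rec \<epsilon> p))\<^sup>2 = 1" by (simp add: norm_sq_vec3 n_rec_def)
  then show ?thesis using norm_ge_zero[of "n_rec \<epsilon> p"] by (simp add: power2_eq_1_iff)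
qed

lemma recovery_class_Y:
  assumes \<epsilon>: "0 < \<epsilon>" and G: "per_C1 l G (slope_rec \<epsilon>)"
  shows "(n_rec \<epsilon>, \<lambda>p. k + G (fst p)) \<in> class_Y l"
  unfolding class_Y_def using n_rec_components(1)[OF \<epsilon>] primitive_W12(1)[OF \<epsilon> G] by (simp add: norm_n_rec)

lemma recovery_energy:
  assumes \<epsilon>: "0 < \<epsilon>" and G: "per_C1 l G (slope_rec \<epsilon>)"
  shows "F_energy \<sigma> l \<epsilon> (n_rec \<epsilon>) (\<lambda>p. k + G (fst p)) = ennreal (2 * l * (LINT x|circ l. energy_density \<epsilon> x))"
proof -
  have "F_energy \<sigma> l \<epsilon> (n_rec \<epsilon>) (\<lambda>p. k + G (fst p)) = (\<integral>\<^sup>+ p. ennreal (energy_density \<epsilon> (fst p)) \<partial>torus l)"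
    unfolding F_energy_def
  proof (rule nn_integral_cong_AE)
    show "AE p in torus l. ennreal (\<epsilon> * grad_sq l (n_rec \<epsilon>) p + 1 / \<epsilon> * W \<sigma> (n_rec \<epsilon> p)
      + 1 / \<epsilon> * (weak_dx l (\<lambda>p. k + G (fst p)) p + n_rec \<epsilon> p $ 1)\<^sup>2
      + 1 / \<epsilon> * (weak_dy l (\<lambda>p. k + G (fst p)) p + n_rec \<epsilon> p $ 2)\<^sup>2) = ennreal (energy_density \<epsilon> (fst p))"
      using n_rec_components(2)[OF \<epsilon>] primitive_W12(2,3)[OF \<epsilon> G, of k] AE_torus_fst[OF AE_sslope_sq]
    proof eventually_elim
      case (elim p)
      let ?v = "speed (sdist (fst p) / \<epsilon>)"
      have "\<epsilon> * ((?v / \<epsilon>)\<^sup>2 * (sslope (fst p))\<^sup>2) = (if jdist (fst p) < r then (speed (jdist (fst p) / \<epsilon>))\<^sup>2 / \<epsilon> else 0)"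
        using elim(4) \<epsilon> by (simp add: speed_sdist[OF \<epsilon>] power2_eq_square)
      moreover have "W \<sigma> (n_rec \<epsilon> p) = ?v\<^sup>2" unfolding n_rec_def by (rule W_profile)
      moreover have "weak_dx l (\<lambda>p. k + G (fst p)) p + n_rec \<epsilon> p $ 1 = mean_rec \<epsilon>"
        using elim(2) by (simp add: slope_rec_def n_rec_def)
      moreover have "weak_dy l (\<lambda>p. k + G (fst p)) p + n_rec \<epsilon> p $ 2 = 0"
        using elim(3) by (simp add: n_rec_def)
      ultimately show ?case using elim(1) by (simp add: energy_density_def)
    qed
  qed
  also have "\<dots> = ennreal (LINT p|torus l. energy_density \<epsilon> (fst p))"
    by (rule nn_integral_eq_integral[OF integral_torus_fst(1)[OF l_pos energy_density_integral(1)[OF \<epsilon>]]])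
       (use \<epsilon> in \<open>simp add: energy_density_def\<close>)
  also have "(LINT p|torus l. energy_density \<epsilon> (fst p)) = 2 * l * (LINT x|circ l. energy_density \<epsilon> x)"
    by (rule integral_torus_fst(2)[OF l_pos energy_density_integral(1)[OF \<epsilon>]])
  finally show ?thesis .
qed

lemma n_rec_L1_le:
  assumes \<epsilon>: "0 < \<epsilon>" and n: "AE p in torus l. n p = (if fst p \<in> E then n_minus \<sigma> else n_plus \<sigma>)"
  shows "torus_L1_dist l (n_rec \<epsilon>) n \<le> 2 * l * ((dev_const + sqrt (constA \<sigma>)) * layer_const) * \<epsilon>"
proof -
  \<comment> \<open>One summand for each varying component: the cosine deviates from
    \<open>A\<close> by exactly \<open>sqrt A * speed\<close>.\<close>
  let ?K = "dev_const + sqrt (constA \<sigma>)"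
  have K0: "0 \<le> ?K" using dev_const_nonneg constA_bounds by simp
  have i: "integrable (circ l) (\<lambda>x. ?K * speed (sdist x / \<epsilon>))"
    by (rule integrable_mult_right[OF integral_speed_le(1)[OF \<epsilon>]])
  have "torus_L1_dist l (n_rec \<epsilon>) n \<le> (LINT p|torus l. ?K * speed (sdist (fst p) / \<epsilon>))"
    unfolding torus_L1_dist_def
  proof (rule integral_mono_AE'[OF integral_torus_fst(1)[OF l_pos i]])
    show "AE p in torus l. norm (n_rec \<epsilon> p - n p) \<le> ?K * speed (sdist (fst p) / \<epsilon>)"
      using n AE_torus_fst[OF AE_sgn_sdist]
    proof eventually_elim
      case (elim p)
      let ?t = "sdist (fst p) / \<epsilon>"
      have n': "n p = vector [nbar1 \<sigma> * sgn (sdist (fst p)), 0, constA \<sigma>]"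
        using elim by (auto simp: n_plus_def n_minus_def)
      have "norm (n_rec \<epsilon> p - n p) \<le> (\<Sum>i\<in>UNIV. \<bar>(n_rec \<epsilon> p - n p) $ i\<bar>)" by (rule norm_le_l1_cart)
      also have "\<dots> = \<bar>sin (\<theta> ?t) - nbar1 \<sigma> * sgn (sdist (fst p))\<bar> + \<bar>cos (\<theta> ?t) - constA \<sigma>\<bar>"
        unfolding n' by (simp add: sum_3 n_rec_def)
      also have "\<bar>cos (\<theta> ?t) - constA \<sigma>\<bar> = sqrt (constA \<sigma>) * speed ?t"
        using cos_profile[of ?t] speed_pos[of ?t] constA_bounds by simp
      finally show ?case using sin_sdist_dev[OF \<epsilon>, of "fst p"] by (simp add: distrib_right)
    qed
    show "AE p in torus l. 0 \<le> ?K * speed (sdist (fst p) / \<epsilon>)"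
      by (intro AE_I2 mult_nonneg_nonneg K0 less_imp_le[OF speed_pos])
  qed
  also have "\<dots> = 2 * l * (?K * (LINT x|circ l. speed (sdist x / \<epsilon>)))"
    using integral_torus_fst(2)[OF l_pos i] by simp
  also have "\<dots> \<le> 2 * l * (?K * (layer_const * \<epsilon>))"
    using l_pos K0 by (intro mult_left_mono integral_speed_le(2)[OF \<epsilon>]) auto
  finally show ?thesis by (simp add: mult.assoc)
qed

lemma primitive_L2_le:
  assumes \<epsilon>: "0 < \<epsilon>" and G: "per_C1 l G (slope_rec \<epsilon>)" "G (- l) = 0"
    and g: "AE p in torus l. g p = k + g_lim (fst p)"
  shows "torus_L2_dist l (\<lambda>p. k + G (fst p)) g \<le> 2 * l * (2 * dev_const * layer_const * \<epsilon>)"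
proof -
  define \<delta> where "\<delta> = 2 * dev_const * layer_const * \<epsilon>"
  have \<delta>0: "0 \<le> \<delta>" using \<epsilon> dev_const_nonneg layer_const_nonneg by (simp add: \<delta>_def)
  have i: "integrable (circ l) (\<lambda>x. \<delta>\<^sup>2)" by (rule integrable_circ_continuous) simp
  have "(LINT p|torus l. (k + G (fst p) - g p)\<^sup>2) \<le> (LINT p|torus l. \<delta>\<^sup>2)"
  proof (rule integral_mono_AE'[OF integral_torus_fst(1)[OF l_pos i]])
    show "AE p in torus l. (k + G (fst p) - g p)\<^sup>2 \<le> \<delta>\<^sup>2"
      using g AE_space
    proof eventually_elim
      case (elim p)
      then have "fst p \<in> {-l..l}" by auto
      from primitive_dev[OF \<epsilon> G this] have "\<bar>k + G (fst p) - g p\<bar> \<le> \<bar>\<delta>\<bar>"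
        using elim \<delta>0 by (simp add: \<delta>_def)
      then show ?case by (simp only: abs_le_square_iff)
    qed
  qed simp
  \<comment> \<open>The torus has area \<open>4 * l * l\<close>, so the uniform bound
    \<open>\<delta>\<close> picks up the factor \<open>2 * l\<close> in \<open>L2\<close>.\<close>
  also have "\<dots> = (2 * l * \<delta>)\<^sup>2"
    unfolding integral_torus_fst(2)[OF l_pos i] integral_const_circ by (simp add: power2_eq_square)
  finally have "(LINT p|torus l. (k + G (fst p) - g p)\<^sup>2) \<le> (2 * l * \<delta>)\<^sup>2" .
  then have "sqrt (LINT p|torus l. (k + G (fst p) - g p)\<^sup>2) \<le> 2 * l * \<delta>"
    using l_pos \<delta>0 by (intro real_le_lsqrt) auto
  then show ?thesis by (simp only: torus_L2_dist_def \<delta>_def)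
qed

end

theorem lemma2p2:
  fixes \<sigma> l :: real and \<epsilon> :: "nat \<Rightarrow> real"
    and n :: "real \<times> real \<Rightarrow> real^3" and g :: "real \<times> real \<Rightarrow> real"
  assumes "\<sigma> > 0" and "l > 0"
    and "\<And>j. \<epsilon> j > 0" and "\<epsilon> \<longlonglongrightarrow> 0"
    and "(n, g) \<in> class_A \<sigma> l"
  shows "\<exists>(nj :: nat \<Rightarrow> real \<times> real \<Rightarrow> real^3) (gj :: nat \<Rightarrow> real \<times> real \<Rightarrow> real).
           (\<forall>j. (nj j, gj j) \<in> class_Y l) \<and>
           (\<lambda>j. torus_L1_dist l (nj j) n) \<longlonglongrightarrow> 0 \<and>
           (\<lambda>j. torus_L2_dist l (gj j) g) \<longlonglongrightarrow> 0 \<and>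
           limsup (\<lambda>j. G_eps \<sigma> l (\<epsilon> j) (nj j) (gj j)) = G_zero \<sigma> l n g"
proof -
  obtain c r E v where jump: "jump_set l c r E"
    and n_E: "AE p in torus l. n p = (if fst p \<in> E then n_minus \<sigma> else n_plus \<sigma>)"
    and mean: "(LINT x|circ l. (if x \<in> E then -1 else 1 :: real)) = 0"
    and v: "AE p in torus l. g p = v (fst p)" "integrable (circ l) v"
      "is_weak_dx l (\<lambda>p. v (fst p)) (\<lambda>p. nbar1 \<sigma> * (if fst p \<in> E then 1 else -1))"
    by (rule class_A_structure[OF assms(1,2,5)]) blast
  interpret anisotropy \<sigma> by unfold_locales (rule assms(1))
  obtain \<theta> where "optimal_profile \<sigma> \<theta>"
  proof (rule optimal_profile_exists)
    fix \<theta>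
    assume "\<And>t. (\<theta> has_real_derivative (cos (\<theta> t) - constA \<sigma>) / sqrt (constA \<sigma>)) (at t)"
      "\<And>t. \<theta> (- t) = - \<theta> t" "\<And>t. 0 \<le> t \<Longrightarrow> 0 \<le> \<theta> t" "\<And>t. 0 \<le> t \<Longrightarrow> \<theta> t < arccos (constA \<sigma>)"
    then have "optimal_profile \<sigma> \<theta>" by unfold_locales
    then show thesis by (rule that)
  qed
  with jump mean interpret recovery l c r E \<sigma> \<theta>
    by (simp add: recovery_def recovery_axioms_def)
  obtain k where k: "AE x in circ l. v x = k + g_lim x" by (rule limit_potential[OF v(2,3)])
  have g_k: "AE p in torus l. g p = k + g_lim (fst p)"
    using v(1) AE_torus_fst[OF k] by eventually_elim simp
  have "\<exists>G. per_C1 l G (slope_rec (\<epsilon> j)) \<and> G (- l) = 0" for j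
    using slope_rec_primitive[OF assms(3)[of j]] by metis
  then obtain G where G: "\<And>j. per_C1 l (G j) (slope_rec (\<epsilon> j))" "\<And>j. G j (- l) = 0" by metis
  define nj where "nj j = n_rec (\<epsilon> j)" for j
  define gj where "gj j = (\<lambda>p :: real \<times> real. k + G j (fst p))" for j
  have Y: "(nj j, gj j) \<in> class_Y l" for j
    unfolding nj_def gj_def by (rule recovery_class_Y[OF assms(3) G(1)])
  have lin: "(\<lambda>j. C * \<epsilon> j) \<longlonglongrightarrow> 0" for C
    using tendsto_mult_right_zero[OF assms(4)] by simp
  have L1: "(\<lambda>j. torus_L1_dist l (nj j) n) \<longlonglongrightarrow> 0"
  proof (rule real_tendsto_sandwich[OF _ _ tendsto_const lin])
    show "\<forall>\<^sub>F j in sequentially. 0 \<le> torus_L1_dist l (nj j) n"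
      by (simp add: torus_L1_dist_def)
    show "\<forall>\<^sub>F j in sequentially. torus_L1_dist l (nj j) n
        \<le> 2 * l * ((dev_const + sqrt (constA \<sigma>)) * layer_const) * \<epsilon> j"
      unfolding nj_def by (intro always_eventually allI n_rec_L1_le[OF assms(3) n_E])
  qed
  have L2: "(\<lambda>j. torus_L2_dist l (gj j) g) \<longlonglongrightarrow> 0"
  proof (rule real_tendsto_sandwich[OF _ _ tendsto_const lin])
    show "\<forall>\<^sub>F j in sequentially. 0 \<le> torus_L2_dist l (gj j) g"
      by (simp add: torus_L2_dist_def)
    show "\<forall>\<^sub>F j in sequentially. torus_L2_dist l (gj j) g \<le> 2 * l * (2 * dev_const * layer_const) * \<epsilon> j"
      unfolding gj_def using primitive_L2_le[OF assms(3) G(1) G(2) g_k]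
      by (intro always_eventually allI) (simp add: mult.assoc)
  qed
  \<comment> \<open>As \<open>r\<close> does not depend on \<open>j\<close>, the scaled half-width
    \<open>r / \<epsilon> j\<close> tends to infinity and the layers become complete
    transitions.\<close>
  have tens: "(\<lambda>j. 4 * real njumps * tension (r / \<epsilon> j)) \<longlonglongrightarrow> 4 * real njumps * (transition_cost / 2)"
  proof (intro tendsto_mult tendsto_const filterlim_compose[OF tension_tendsto])
    have "filterlim (\<lambda>j. inverse (\<epsilon> j)) at_top sequentially"
      using assms(3,4) by (intro filterlim_inverse_at_top) auto
    from filterlim_tendsto_pos_mult_at_top[OF tendsto_const r_pos this]
    show "filterlim (\<lambda>j. r / \<epsilon> j) at_top sequentially" by (simp add: divide_inverse)
  qed
  have "(\<lambda>j. (LINT x|circ l. energy_density (\<epsilon> j) x) - 4 * real njumps * tension (r / \<epsilon> j)) \<longlonglongrightarrow> 0"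
  proof (rule Lim_null_comparison[OF _ lin])
    show "\<forall>\<^sub>F j in sequentially. norm ((LINT x|circ l. energy_density (\<epsilon> j) x) - 4 * real njumps * tension (r / \<epsilon> j))
        \<le> (2 * l * (pi / r)\<^sup>2 + 2 * l * (dev_const * layer_const / (2 * l))\<^sup>2) * \<epsilon> j"
      unfolding real_norm_def by (intro always_eventually allI energy_density_integral(2)[OF assms(3)])
  qed
  from tendsto_add[OF this tens]
  have "(\<lambda>j. LINT x|circ l. energy_density (\<epsilon> j) x) \<longlonglongrightarrow> 2 * real njumps * transition_cost" by (simp add: mult_ac)
  then have "(\<lambda>j. ennreal (2 * l * (LINT x|circ l. energy_density (\<epsilon> j) x)))
      \<longlonglongrightarrow> ennreal (2 * l * (2 * real njumps * transition_cost))"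
    by (intro tendsto_ennrealI tendsto_mult tendsto_const)
  moreover have "G_eps \<sigma> l (\<epsilon> j) (nj j) (gj j) = ennreal (2 * l * (LINT x|circ l. energy_density (\<epsilon> j) x))" for j
    using Y[of j] recovery_energy[OF assms(3) G(1), of j k] by (simp add: G_eps_def nj_def gj_def)
  ultimately have "limsup (\<lambda>j. G_eps \<sigma> l (\<epsilon> j) (nj j) (gj j)) = ennreal (2 * l * (2 * real njumps * transition_cost))"
    by (intro lim_imp_Limsup) auto
  also have "\<dots> = G_zero \<sigma> l n g"
  proof -
    have nn: "n_minus \<sigma> \<noteq> n_plus \<sigma>"
      using nbar1_bounds by (auto simp: n_minus_def n_plus_def vec_eq_iff forall_3)
    have nm: "(\<lambda>p. n p $ i) \<in> borel_measurable (torus l)" for i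
      using assms(5) by (auto simp: class_A_def torus_BV_def torus_L1_def)
    let ?S = "{p \<in> space (torus l). n p = n_minus \<sigma>}"
    have "?S = {p \<in> space (torus l). n p $ 1 = n_minus \<sigma> $ 1 \<and> n p $ 2 = n_minus \<sigma> $ 2 \<and> n p $ 3 = n_minus \<sigma> $ 3}"
      by (simp add: vec_eq_iff forall_3)
    also have "\<dots> \<in> sets (torus l)" using nm[of 1] nm[of 2] nm[of 3] by measurable
    finally have "indicator ?S \<in> borel_measurable (torus l)" by (rule borel_measurable_indicator)
    moreover have "AE p in torus l. indicator ?S p = (indicator E (fst p) :: real)"
      using n_E AE_space by eventually_elim (use nn in \<open>auto simp: indicator_def split: if_splits\<close>)
    ultimately have "torus_perimeter l ?S = ennreal (2 * l * real njumps)"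
      unfolding torus_perimeter_def by (rule torus_variation_eq)
    \<comment> \<open>Needed to multiply inside \<open>ennreal\<close>, which would cut a negative
      constant to 0.\<close>
    moreover have "0 \<le> transition_cost"
    proof -
      have "0 \<le> tension t" if "0 \<le> t" for t
        using DERIV_nonneg_imp_nondecreasing[OF that, of tension] tension_derivative
        by (metis profile_0 tension_def sin_zero mult_zero_right diff_zero divide_eq_0_iff zero_le_power2)
      then have "0 \<le> transition_cost / 2"
        by (intro tendsto_lowerbound[OF tension_tendsto]) (auto intro: eventually_mono[OF eventually_ge_at_top[of 0]])
      then show ?thesis by simp
    qed
    ultimately show ?thesis
      using assms(5) l_pos by (simp add: G_zero_def c0_eq ennreal_mult[symmetric] mult_ac)
  qed
  finally show ?thesis using Y L1 L2 by blast
qed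

end
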